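(* Let $u\in C^4(\Omega)\cap C^{1,1}(\bar\Omega)$ be a solution of $$\det[D^2u-A(x,u,Du)]=B(x,u,Du)\quad\text{in }\Omega$$ in a bounded domain $\Omega\subset\mathbb{R}^n$, with $D^2u-A(x,u,Du)$ positive definite in $\Omega$, where $B$ is a positive function and $B^{\frac1{n-1}}\in C^{1,1}(\bar\Omega\times\mathbb{R}\times\mathbb{R}^n)$. Assume that $$D_{pp}\tilde B\ \ge\ -C_BI$$ for some nonnegative constant $C_B$, where $I$ is the $n\times n$ identity matrix and $\tilde B=\log B$. Assume that $A\in C^2(\bar\Omega\times\mathbb{R}\times\mathbb{R}^n,\mathbb{R}^{n\times n})$ is strictly regular, i.e. there is a constant $c_0>0$ such that $$\sum_{i,j,k,l=1}^n D^2_{p_kp_l}A_{ij}(x,z,p)\,\xi_i\xi_j\eta_k\eta_l\ \ge\ c_0|\xi|^2|\eta|^2$$ for all $(x,z,p)\in\Omega\times\mathbb{R}\times\mathbb{R}^n$ and all $\xi,\eta\in\mathbb{R}^n$ with $\xi\cdot\eta=0$. Then $$|D^2u(x)|\le C,$$ where $C$ depends on $n$, $\mathrm{dist}(x,\partial\Omega)$, $\sup_\Omega|Du|$, $\|B^{\frac1{n-1}}\|_{C^{1,1}}$, $\|A\|_{C^2}$ and $c_0$.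
   Context: $Du$ and $D^2u$ denote the gradient and the Hessian matrix of $u:\Omega\to\mathbb{R}$. $A$ is a symmetric $n\times n$ matrix valued function and $B$ a scalar function of $(x,z,p)\in\Omega\times\mathbb{R}\times\mathbb{R}^n$, where $x$, $z$, $p$ denote points of $\Omega$, $\mathbb{R}$, $\mathbb{R}^n$ respectively. $D_{pp}\tilde B$ is the matrix of second derivatives of $\tilde B$ in $p$, and matrix inequalities are in the sense of symmetric matrices. *)

theory Defs
  imports "HOL-Analysis.Analysis"
begin

definition dir_deriv ::
  "'a::euclidean_space \<Rightarrow> ('a \<Rightarrow> 'b::real_normed_vector) \<Rightarrow> 'a \<Rightarrow> 'b" where
  "dir_deriv e f x = frechet_derivative f (at x) e"

section \<open>Function spaces\<close>

text \<open>Throughout this section \<open>S\<close> is meant to be open. \<open>C_k k S\<close> is the space $C^k(S)$.\<close>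

primrec C_k :: "nat \<Rightarrow> 'a::euclidean_space set \<Rightarrow> ('a \<Rightarrow> 'b::real_normed_vector) \<Rightarrow> bool" where
  "C_k 0 S f = continuous_on S f"
| "C_k (Suc k) S f =
     ((\<forall>x\<in>S. f differentiable (at x)) \<and> (\<forall>e\<in>Basis. C_k k S (dir_deriv e f)))"

text \<open>The space $C^k(\bar S)$ in the sense of Gilbarg and Trudinger: all partial derivatives of
  order at most \<open>k\<close> exist in \<open>S\<close> and extend continuously to the closure. The values of \<open>f\<close> outside
  \<open>S\<close> play no role.\<close>

definition extends_continuously ::
  "'a::euclidean_space set \<Rightarrow> ('a \<Rightarrow> 'b::real_normed_vector) \<Rightarrow> bool" where
  "extends_continuously S f \<longleftrightarrow> (\<exists>g. continuous_on (closure S) g \<and> (\<forall>x\<in>S. g x = f x))"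

primrec C_k_closure ::
  "nat \<Rightarrow> 'a::euclidean_space set \<Rightarrow> ('a \<Rightarrow> 'b::real_normed_vector) \<Rightarrow> bool" where
  "C_k_closure 0 S f = extends_continuously S f"
| "C_k_closure (Suc k) S f =
     (extends_continuously S f \<and> (\<forall>x\<in>S. f differentiable (at x)) \<and>
      (\<forall>e\<in>Basis. C_k_closure k S (dir_deriv e f)))"

text \<open>The space $C^{1,1}(\bar S)$. If \<open>S\<close> is bounded, the Lipschitz condition is the uniform one on
  \<open>S\<close>; if \<open>S\<close> is unbounded, it is uniform on bounded parts of \<open>S\<close>.\<close>

definition C_11_closure ::
  "'a::euclidean_space set \<Rightarrow> ('a \<Rightarrow> 'b::real_normed_vector) \<Rightarrow> bool" where
  "C_11_closure S f \<longleftrightarrow> C_k_closure 1 S f \<and>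
     (\<forall>e\<in>Basis. \<forall>R. \<exists>L. L-lipschitz_on (S \<inter> cball 0 R) (dir_deriv e f))"

text \<open>The norms are taken over a set \<open>Q\<close> on which they are finite; \<open>Q\<close> need not be open, but the
  functions are differentiated as functions on a neighbourhood of its points.\<close>

primrec C_k_norm ::
  "nat \<Rightarrow> 'a::euclidean_space set \<Rightarrow> ('a \<Rightarrow> 'b::real_normed_vector) \<Rightarrow> real" where
  "C_k_norm 0 Q f = (SUP x\<in>Q. norm (f x))"
| "C_k_norm (Suc k) Q f =
     (SUP x\<in>Q. norm (f x)) + (\<Sum>e\<in>Basis. C_k_norm k Q (dir_deriv e f))"

text \<open>Pairs with equal components contribute \<open>0 / 0 = 0\<close>.\<close>

definition lip_seminorm ::
  "'a::euclidean_space set \<Rightarrow> ('a \<Rightarrow> 'b::real_normed_vector) \<Rightarrow> real" where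
  "lip_seminorm Q f = (SUP (x, y)\<in>Q \<times> Q. norm (f x - f y) / norm (x - y))"

definition C_11_norm ::
  "'a::euclidean_space set \<Rightarrow> ('a \<Rightarrow> 'b::real_normed_vector) \<Rightarrow> real" where
  "C_11_norm Q f = C_k_norm 1 Q f + (\<Sum>e\<in>Basis. lip_seminorm Q (dir_deriv e f))"

section \<open>Gradient, Hessian and matrix inequalities\<close>

definition grad :: "(real^'n::finite \<Rightarrow> real) \<Rightarrow> real^'n \<Rightarrow> real^'n" where
  "grad u x = (\<chi> i. dir_deriv (axis i 1) u x)"

definition hessian :: "(real^'n::finite \<Rightarrow> real) \<Rightarrow> real^'n \<Rightarrow> real^'n^'n" where
  "hessian u x = (\<chi> i j. dir_deriv (axis i 1) (dir_deriv (axis j 1) u) x)"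

definition pos_def :: "real^'n^'n::finite \<Rightarrow> bool" where
  "pos_def M \<longleftrightarrow> transpose M = M \<and> (\<forall>v. v \<noteq> 0 \<longrightarrow> 0 < v \<bullet> (M *v v))"

definition matrix_le :: "real^'n^'n::finite \<Rightarrow> real^'n^'n \<Rightarrow> bool" where
  "matrix_le M N \<longleftrightarrow> (\<forall>v. v \<bullet> (M *v v) \<le> v \<bullet> (N *v v))"

section \<open>Functions of \<open>(x, z, p)\<close>\<close>

text \<open>\<open>A\<close> and \<open>B\<close> are functions of the triple \<open>(x, z, p)\<close>.\<close>

type_synonym 'n jet = "(real^'n) \<times> real \<times> (real^'n)"

definition jet :: "(real^'n::finite \<Rightarrow> real) \<Rightarrow> real^'n \<Rightarrow> 'n jet" where
  "jet u x = (x, u x, grad u x)"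

definition phase_space :: "(real^'n::finite) set \<Rightarrow> 'n jet set" where
  "phase_space \<Omega> = \<Omega> \<times> UNIV \<times> UNIV"

definition dp :: "'n \<Rightarrow> ('n::finite jet \<Rightarrow> 'b::real_normed_vector) \<Rightarrow> 'n jet \<Rightarrow> 'b" where
  "dp k f = dir_deriv (0, 0, axis k 1) f"

definition Dpp :: "('n::finite jet \<Rightarrow> real) \<Rightarrow> 'n jet \<Rightarrow> real^'n^'n" where
  "Dpp f y = (\<chi> k l. dp k (dp l f) y)"

definition twice_differentiable_at ::
  "('a::euclidean_space \<Rightarrow> 'b::real_normed_vector) \<Rightarrow> 'a \<Rightarrow> bool" where
  "twice_differentiable_at f y \<longleftrightarrow> (\<forall>e\<in>Basis. dir_deriv e f differentiable (at y))"

text \<open>The inequality $D_{pp} f \ge -c I$ for a function \<open>f\<close> that is locally $C^{1,1}$. Such a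
  function has second derivatives only almost everywhere (Rademacher), and the inequality is
  required at the points where they exist.\<close>

definition Dpp_ge :: "(real^'n::finite) set \<Rightarrow> ('n jet \<Rightarrow> real) \<Rightarrow> real \<Rightarrow> bool" where
  "Dpp_ge \<Omega> f c \<longleftrightarrow>
     (\<forall>y\<in>phase_space \<Omega>. twice_differentiable_at f y \<longrightarrow> matrix_le (c *\<^sub>R mat 1) (Dpp f y))"

definition strictly_regular ::
  "(real^'n::finite) set \<Rightarrow> ('n jet \<Rightarrow> real^'n^'n) \<Rightarrow> real \<Rightarrow> bool" where
  "strictly_regular \<Omega> A c0 \<longleftrightarrow>
     (\<forall>y\<in>phase_space \<Omega>. \<forall>\<xi> \<eta>. \<xi> \<bullet> \<eta> = 0 \<longrightarrow>
        c0 * (norm \<xi>)\<^sup>2 * (norm \<eta>)\<^sup>2 \<le>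
        (\<Sum>i\<in>UNIV. \<Sum>j\<in>UNIV. \<Sum>k\<in>UNIV. \<Sum>l\<in>UNIV.
           dp k (dp l A) y $ i $ j * \<xi> $ i * \<xi> $ j * \<eta> $ k * \<eta> $ l))"

text \<open>The \<open>(x, z, p)\<close> that are relevant for \<open>u\<close>. The norms of \<open>A\<close> and \<open>B\<close> in the estimate are taken
  over this set, as is usual for data on $\bar\Omega\times\mathbb{R}\times\mathbb{R}^n$: a
  strictly regular \<open>A\<close> grows quadratically in \<open>p\<close>, so that its $C^2$ norm over the whole of
  $\bar\Omega\times\mathbb{R}\times\mathbb{R}^n$ is never finite.\<close>

definition sup_grad :: "(real^'n::finite) set \<Rightarrow> (real^'n \<Rightarrow> real) \<Rightarrow> real" where
  "sup_grad \<Omega> u = (SUP x\<in>\<Omega>. norm (grad u x))"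

definition jet_range :: "(real^'n::finite) set \<Rightarrow> (real^'n \<Rightarrow> real) \<Rightarrow> 'n jet set" where
  "jet_range \<Omega> u = \<Omega> \<times> u ` \<Omega> \<times> cball 0 (sup_grad \<Omega> u)"

end

theory Submission
  imports Defs
begin

text \<open>Write \<open>W = D\<^sup>2u - A(x, u, Du)\<close> and \<open>b = B\<^bsup>1/(n-1)\<^esup>\<close>, so that the equation reads
  \<open>det W = b\<^bsup>n-1\<^esup>\<close> along the jet \<open>(x, u, Du)\<close> of the solution. The proof applies the maximum
  principle to \<open>\<eta>\<^sup>2\<close> times the largest eigenvalue of \<open>W\<close>, where \<open>\<eta>(z) = r\<^sup>2 - |z - x|\<^sup>2\<close> on the ball about
  \<open>x\<close> whose radius \<open>r\<close> is half the distance to the boundary.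

  At a maximum point let \<open>\<lambda>\<^sub>i\<close> be the eigenvalues of \<open>W\<close>, \<open>\<lambda>\<close> the largest one, \<open>e\<close> its eigenvector, and
  \<open>\<tau>\<close> the sum of the inverses of the other eigenvalues. Apply \<open>\<Sum>\<^sub>i \<lambda>\<^sub>i\<^sup>-\<^sup>1 \<partial>\<^sub>i\<^sub>i\<close> to the
  logarithm of the auxiliary function and use the equation differentiated twice in direction \<open>e\<close>.
  Since \<open>D\<^sup>2u e = \<lambda> e + A e\<close>, the second derivatives of \<open>A\<close> in \<open>p\<close> contribute
  \<open>\<lambda>\<^sup>2 \<Sum>\<^sub>i \<lambda>\<^sub>i\<^sup>-\<^sup>1 D\<^sub>p\<^sub>pA\<^sub>i\<^sub>i[e, e]\<close>, and strict regularity applied to the eigenvectors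
  orthogonal to \<open>e\<close> bounds this from below by \<open>c\<^sub>0 \<lambda>\<^sup>2 \<tau>\<close> up to lower order terms. Three observations
  show that everything else is smaller.

  \<^item> The product of the \<open>\<lambda>\<^sub>i\<close> is \<open>b\<^bsup>n-1\<^esup>\<close>, hence \<open>\<tau> \<ge> \<lambda>\<^bsup>1/(n-1)\<^esup> / b\<close>
    (\<open>trace_inverse_lower_bound\<close>). Errors of size \<open>\<lambda>\<^sup>2 / b\<close>, as produced by the derivatives of
    \<open>ln b\<close>, are therefore at most \<open>\<lambda>\<^sup>2 \<tau>\<close> times a negative power of \<open>\<lambda>\<close>, however small \<open>b\<close> is.
  \<^item> The square \<open>(\<partial>\<^sub>eb / b)\<^sup>2\<close> is too large to be an error term. It cancels against the squares of third
    derivatives that the twice differentiated equation provides (\<open>diagonal_sum_of_squares\<close>); the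
    remaining mixed term contains \<open>\<partial>\<^sub>eW\<^sub>e\<^sub>e / \<lambda>\<close>, which equals \<open>-2 \<partial>\<^sub>e\<eta> / \<eta>\<close> at the maximum point.
  \<^item> All other third derivatives of \<open>u\<close> occur either as \<open>\<partial>\<^sub>kW\<^sub>e\<^sub>e\<close>, again given by the maximum point
    condition, or as \<open>\<Sum>\<^sub>i \<lambda>\<^sub>i\<^sup>-\<^sup>1 \<partial>\<^sub>kW\<^sub>i\<^sub>i\<close>, given by the equation differentiated once.

  The outcome is \<open>c\<^sub>0 \<le> C ((1 + 1/\<eta>)\<^sup>2 / \<lambda> + \<lambda>\<^bsup>-1/(n-1)\<^esup>)\<close>, which bounds \<open>\<eta>\<^sup>2 \<lambda>\<close>
  (\<open>pointwise_estimate\<close>) and, at the centre of the ball, all eigenvalues of \<open>W\<close>.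

  Neither the determinant nor \<open>b\<close> is differentiated twice. In a fixed eigenframe at the maximum point
  Hadamard's inequality bounds \<open>ln (det W)\<close> by \<open>\<Sum>\<^sub>i ln W\<^sub>i\<^sub>i\<close> with equality at that point, and \<open>b\<close> is
  bounded below by a quadratic expansion that uses only the Lipschitz constant of its gradient. The
  difference of the two sides has a minimum, and the conditions for a minimum are the
  differentiated equations (\<open>differentiated_equation\<close>).\<close>

section \<open>Orthonormal frames, eigenvalues and determinants\<close>

definition orthonormal_frame :: "('n::finite \<Rightarrow> real^'n) \<Rightarrow> bool" where
  "orthonormal_frame E \<longleftrightarrow> (\<forall>i j. E i \<bullet> E j = (if i = j then 1 else 0))"

lemma frame_dot: "orthonormal_frame E \<Longrightarrow> E i \<bullet> E j = (if i = j then 1 else 0)"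
  by (simp add: orthonormal_frame_def)

lemma frame_norm: "orthonormal_frame E \<Longrightarrow> norm (E i) = 1"
  by (simp add: orthonormal_frame_def norm_eq_1)

lemma frame_expansion:
  fixes E :: "'n::finite \<Rightarrow> real^'n"
  assumes "orthonormal_frame E"
  shows "(\<Sum>i\<in>UNIV. (x \<bullet> E i) *\<^sub>R E i) = x"
proof -
  have inj: "inj E"
  proof (rule injI)
    fix i j assume "E i = E j"
    then have "E i \<bullet> E j = 1" using frame_dot[OF assms, of i i] by simp
    then show "i = j" using frame_dot[OF assms, of i j] by (auto split: if_splits)
  qed
  have po: "pairwise orthogonal (range E)"
    using frame_dot[OF assms] by (auto simp: pairwise_def orthogonal_def)
  have "0 \<notin> range E"
    using frame_norm[OF assms] by (metis imageE norm_zero zero_neq_one)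
  then have "independent (range E)" using po pairwise_orthogonal_independent by blast
  moreover have "card (range E) = DIM(real^'n)"
    using inj by (simp add: card_image)
  ultimately have sp: "span (range E) = UNIV"
    using dim_eq_card_independent[of "range E"] dim_eq_full[of "range E"] by simp
  define z where "z = x - (\<Sum>i\<in>UNIV. (x \<bullet> E i) *\<^sub>R E i)"
  have "z \<bullet> E j = 0" for j
    by (simp add: z_def inner_diff_left inner_sum_left frame_dot[OF assms] if_distrib cong: if_cong)
  then have "orthogonal z w" if "w \<in> span (range E)" for w
    using that by (intro orthogonal_to_span[of w "range E" z]) (auto simp: orthogonal_def)
  then have "z = 0" using sp by (metis UNIV_I orthogonal_self)
  then show ?thesis by (simp add: z_def)
qed

lemma frame_inner:
  assumes "orthonormal_frame E"
  shows "x \<bullet> y = (\<Sum>i\<in>UNIV. (x \<bullet> E i) * (y \<bullet> E i))"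
proof -
  have "x \<bullet> y = x \<bullet> (\<Sum>i\<in>UNIV. (y \<bullet> E i) *\<^sub>R E i)"
    by (simp add: frame_expansion[OF assms])
  also have "\<dots> = (\<Sum>i\<in>UNIV. (x \<bullet> E i) * (y \<bullet> E i))"
    unfolding inner_sum_right by (simp add: mult.commute)
  finally show ?thesis .
qed

lemma symmetric_dot_swap:
  fixes M :: "real^'n^'n::finite"
  assumes "transpose M = M"
  shows "x \<bullet> (M *v y) = (M *v x) \<bullet> y"
  using assms by (metis dot_lmul_matrix vector_transpose_matrix)

text \<open>The Rayleigh quotient attains its maximum over the unit sphere of the orthogonal complement of
  \<open>S\<close>. At a maximum point the derivative of the quadratic form in any direction of the complement
  vanishes, and the complement is invariant under \<open>M\<close> because \<open>S\<close> consists of eigenvectors; so the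
  maximum point is an eigenvector.\<close>

lemma eigenvector_in_complement:
  fixes M :: "real^'n^'n::finite"
  assumes sym: "transpose M = M"
    and fin: "finite S" and cS: "card S < CARD('n)"
    and eig: "\<And>s. s \<in> S \<Longrightarrow> \<exists>\<mu>. M *v s = \<mu> *\<^sub>R s"
  shows "\<exists>v l. norm v = 1 \<and> (\<forall>s\<in>S. s \<bullet> v = 0) \<and> M *v v = l *\<^sub>R v"
proof -
  define U where "U = {x. \<forall>s\<in>S. s \<bullet> x = 0}"
  have "dim S < DIM(real^'n)"
    using dim_le_card'[OF fin] cS by simp
  then have "span S \<noteq> UNIV" using dim_eq_full[of S] by auto
  then obtain a where a: "a \<noteq> 0" "\<And>x. x \<in> span S \<Longrightarrow> orthogonal a x"
    using orthogonal_to_subspace_exists[OF \<open>dim S < DIM(real^'n)\<close>] by blast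
  have aU: "a \<in> U"
    using a(2) by (auto simp: U_def orthogonal_def inner_commute span_base)
  have Usc: "c *\<^sub>R x \<in> U" if "x \<in> U" for c x using that by (simp add: U_def)
  have Uadd: "x + y \<in> U" if "x \<in> U" "y \<in> U" for x y using that by (simp add: U_def inner_add_right)
  have clU: "closed U"
  proof -
    have "U = (\<Inter>s\<in>S. {x. s \<bullet> x = 0})" by (auto simp: U_def)
    then show ?thesis by (simp add: closed_INT closed_hyperplane)
  qed
  define K where "K = U \<inter> sphere 0 1"
  have "compact K" unfolding K_def by (simp add: clU closed_Int_compact)
  moreover have "(1 / norm a) *\<^sub>R a \<in> K" using a(1) aU Usc by (simp add: K_def)
  moreover have "continuous_on K (\<lambda>x. x \<bullet> (M *v x))"
    by (intro continuous_intros linear_continuous_on matrix_vector_mul_bounded_linear)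
  ultimately obtain v where v: "v \<in> K" "\<And>y. y \<in> K \<Longrightarrow> y \<bullet> (M *v y) \<le> v \<bullet> (M *v v)"
    using continuous_attains_sup[of K "\<lambda>x. x \<bullet> (M *v x)"] by auto
  define l where "l = v \<bullet> (M *v v)"
  have nv: "norm v = 1" and vU: "v \<in> U" using v(1) by (auto simp: K_def)
  have quad: "y \<bullet> (M *v y) \<le> l * (y \<bullet> y)" if "y \<in> U" for y
  proof (cases "y = 0")
    case False
    have "(1 / norm y) *\<^sub>R y \<in> K" using False that Usc by (simp add: K_def)
    from v(2)[OF this] have "(y \<bullet> (M *v y)) / (norm y)^2 \<le> l"
      by (simp add: l_def matrix_vector_mult_scaleR power2_eq_square)
    then show ?thesis using False by (simp add: divide_simps power2_norm_eq_inner)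
  qed simp
  define z where "z = M *v v - l *\<^sub>R v"
  have zU: "z \<in> U"
  proof -
    have "s \<bullet> (M *v v) = 0" if s: "s \<in> S" for s
    proof -
      obtain \<mu> where "M *v s = \<mu> *\<^sub>R s" using eig[OF s] by auto
      then show ?thesis using vU s by (simp add: symmetric_dot_swap[OF sym] U_def)
    qed
    then show ?thesis using vU by (simp add: U_def z_def inner_diff_right)
  qed
  have vz: "v \<bullet> z = 0"
    using nv by (simp add: z_def inner_diff_right l_def norm_eq_1)
  have lin: "2 * t * (z \<bullet> z) + t^2 * (z \<bullet> (M *v z) - l * (z \<bullet> z)) \<le> 0" for t
  proof -
    have "v + t *\<^sub>R z \<in> U" using vU zU Uadd Usc by blast
    from quad[OF this] have "l + t * (v \<bullet> (M *v z)) + t * (z \<bullet> (M *v v)) + t * (t * (z \<bullet> (M *v z)))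
        \<le> l * (1 + t * (t * (z \<bullet> z)))"
      using nv vz by (simp add: matrix_vector_right_distrib matrix_vector_mult_scaleR inner_add_left
          inner_add_right inner_commute[of z v] l_def norm_eq_1 algebra_simps)
    moreover have "v \<bullet> (M *v z) = z \<bullet> (M *v v)"
      using symmetric_dot_swap[OF sym, of v z] inner_commute[of "M *v v" z] by simp
    moreover have "z \<bullet> (M *v v) = z \<bullet> z"
    proof -
      have "M *v v = z + l *\<^sub>R v" by (simp add: z_def)
      then show ?thesis using vz by (simp add: inner_add_right inner_commute)
    qed
    ultimately show ?thesis by (simp add: algebra_simps power2_eq_square)
  qed
  \<comment> \<open>The linear term in \<open>t\<close> dominates for small \<open>t > 0\<close>.\<close>
  have "z \<bullet> z = 0"
  proof (rule ccontr)
    assume nz: "z \<bullet> z \<noteq> 0"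
    define a where "a = z \<bullet> z"
    define c where "c = z \<bullet> (M *v z) - l * (z \<bullet> z)"
    have "a > 0" using nz by (simp add: a_def)
    define t where "t = a / (1 + \<bar>c\<bar>)"
    have tp: "t > 0" using \<open>a > 0\<close> by (simp add: t_def)
    have "t * c \<ge> - a"
    proof -
      have "t * \<bar>c\<bar> \<le> a" using \<open>a > 0\<close> by (simp add: t_def divide_simps)
      then show ?thesis using tp by (smt (verit, best) mult_left_mono mult_minus_right)
    qed
    then have "t * (2 * a + t * c) > 0" using tp \<open>a > 0\<close> by simp
    moreover have "t * (2 * a + t * c) \<le> 0"
      using lin[of t] by (simp add: a_def c_def algebra_simps power2_eq_square)
    ultimately show False by simp
  qed
  then have "M *v v = l *\<^sub>R v" by (simp add: z_def)
  then show ?thesis using nv vU by (auto simp: U_def)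
qed

lemma spectral_theorem:
  fixes M :: "real^'n^'n::finite"
  assumes sym: "transpose M = M"
  obtains E \<mu> where "orthonormal_frame E" "\<And>i. M *v E i = \<mu> i *\<^sub>R E i"
proof -
  have "\<exists>S. finite S \<and> card S = k \<and> (\<forall>s\<in>S. norm s = 1 \<and> (\<exists>\<mu>. M *v s = \<mu> *\<^sub>R s)) \<and>
      pairwise orthogonal S" if "k \<le> CARD('n)" for k
    using that
  proof (induction k)
    case 0
    show ?case by (intro exI[of _ "{}"]) simp
  next
    case (Suc k)
    then obtain S where S: "finite S" "card S = k" "\<And>s. s \<in> S \<Longrightarrow> norm s = 1"
      "\<And>s. s \<in> S \<Longrightarrow> \<exists>\<mu>. M *v s = \<mu> *\<^sub>R s" "pairwise orthogonal S" by auto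
    obtain v l where v: "norm v = 1" "\<And>s. s \<in> S \<Longrightarrow> s \<bullet> v = 0" "M *v v = l *\<^sub>R v"
      using eigenvector_in_complement[OF sym S(1) _ S(4)] S(2) Suc.prems by force
    have "v \<notin> S" using v(1,2) by (metis norm_eq_1 zero_neq_one)
    then show ?case
      using S v by (intro exI[of _ "insert v S"])
        (auto simp: pairwise_insert orthogonal_commute, auto simp: orthogonal_def inner_commute)
  qed
  from this[of "CARD('n)"] obtain S where S: "finite S" "card S = CARD('n)" "\<And>s. s \<in> S \<Longrightarrow> norm s = 1"
      "\<And>s. s \<in> S \<Longrightarrow> \<exists>\<mu>. M *v s = \<mu> *\<^sub>R s" "pairwise orthogonal S" by auto
  obtain E where E: "bij_betw E (UNIV :: 'n set) S"
    using finite_same_card_bij[of "UNIV :: 'n set" S] S by auto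
  have ES: "E i \<in> S" for i using E by (auto simp: bij_betw_def)
  have "E i \<bullet> E j = (if i = j then 1 else 0)" for i j
  proof (cases "i = j")
    case True
    then show ?thesis using S(3)[OF ES[of i]] by (simp add: norm_eq_1)
  next
    case False
    then have "E i \<noteq> E j" using E by (metis UNIV_I bij_betw_def inj_on_def)
    then show ?thesis using S(5) ES False by (simp add: pairwise_def orthogonal_def)
  qed
  then have "orthonormal_frame E" by (simp add: orthonormal_frame_def)
  moreover obtain \<mu> where "\<And>i. M *v E i = \<mu> i *\<^sub>R E i" using S(4)[OF ES] by metis
  ultimately show ?thesis using that by blast
qed

lemma det_eq_prod_eigenvalues:
  fixes M :: "real^'n^'n::finite"
  assumes fr: "orthonormal_frame E" and eig: "\<And>i. M *v E i = \<mu> i *\<^sub>R E i"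
  shows "det M = (\<Prod>i\<in>UNIV. \<mu> i)"
proof -
  define Q :: "real^'n^'n" where "Q = (\<chi> i. E i)"
  have row: "row i Q = E i" for i by (simp add: Q_def row_def vec_eq_iff)
  have "orthogonal_matrix Q"
    unfolding orthogonal_matrix_orthonormal_rows row
    using fr by (auto simp: frame_norm orthogonal_def frame_dot)
  then have QQ: "Q ** transpose Q = mat 1" by (simp add: orthogonal_matrix_def)
  have ent: "(Q ** M ** transpose Q) $ i $ j = E i \<bullet> (M *v E j)" for i j
  proof -
    have E: "transpose Q *v axis k 1 = E k" for k
      by (simp only: matrix_vector_mult_basis) (simp add: column_def transpose_def Q_def vec_eq_iff)
    have "(Q ** M ** transpose Q) $ i $ j = axis i 1 \<bullet> ((Q ** M ** transpose Q) *v axis j 1)"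
      by (simp add: matrix_vector_mult_basis column_def inner_axis')
    also have "\<dots> = axis i 1 \<bullet> (Q *v (M *v (transpose Q *v axis j 1)))"
      by (simp only: matrix_vector_mul_assoc matrix_mul_assoc)
    also have "\<dots> = (transpose Q *v axis i 1) \<bullet> (M *v (transpose Q *v axis j 1))"
      by (simp only: dot_lmul_matrix[symmetric] transpose_matrix_vector)
    finally show ?thesis by (simp only: E)
  qed
  have "det Q * det Q = 1"
    using arg_cong[OF QQ, of det] by (simp add: det_mul)
  then have "det M = det (Q ** M ** transpose Q)"
    by (simp add: det_mul mult.commute mult.left_commute)
  also have "\<dots> = (\<Prod>i\<in>UNIV. (Q ** M ** transpose Q) $ i $ i)"
    by (rule det_diagonal) (simp add: ent eig frame_dot[OF fr])
  also have "\<dots> = (\<Prod>i\<in>UNIV. \<mu> i)"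
    by (simp add: ent eig frame_dot[OF fr])
  finally show ?thesis .
qed

lemma norm_matrix_le_eigenvalue_bound:
  fixes M :: "real^'n^'n::finite"
  assumes E: "orthonormal_frame E" and eig: "\<And>i. M *v E i = \<mu> i *\<^sub>R E i"
    and \<mu>: "\<And>i. \<bar>\<mu> i\<bar> \<le> c"
  shows "norm M \<le> real CARD('n) ^ 3 * c"
proof -
  have "M $ i $ j = (\<Sum>k\<in>UNIV. \<mu> k * (E k $ i * E k $ j))" for i j
  proof -
    have "M *v axis j 1 = M *v (\<Sum>k\<in>UNIV. (axis j 1 \<bullet> E k) *\<^sub>R E k)"
      by (simp only: frame_expansion[OF E])
    also have "\<dots> = (\<Sum>k\<in>UNIV. (axis j 1 \<bullet> E k) *\<^sub>R (\<mu> k *\<^sub>R E k))"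
      by (simp only: linear_sum[OF matrix_vector_mul_linear] linear_scale[OF matrix_vector_mul_linear] eig)
    finally have "(M *v axis j 1) $ i = (\<Sum>k\<in>UNIV. \<mu> k * (E k $ i * E k $ j))"
      by (simp add: inner_axis' mult_ac)
    then show ?thesis by (simp add: matrix_vector_mult_basis column_def)
  qed
  moreover have "\<bar>\<Sum>k\<in>UNIV. \<mu> k * (E k $ i * E k $ j)\<bar> \<le> real CARD('n) * c" for i j
  proof -
    have "\<bar>\<mu> k * (E k $ i * E k $ j)\<bar> \<le> c * (1 * 1)" for k
      unfolding abs_mult
      using component_le_norm_cart[of "E k"] \<mu>[of k] by (intro mult_mono) (auto simp: frame_norm[OF E])
    then have "(\<Sum>k\<in>UNIV. \<bar>\<mu> k * (E k $ i * E k $ j)\<bar>) \<le> (\<Sum>k\<in>(UNIV :: 'n set). c)"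
      by (intro sum_mono) simp
    then show ?thesis by (intro order_trans[OF sum_abs]) simp
  qed
  ultimately have ent: "\<bar>M $ i $ j\<bar> \<le> real CARD('n) * c" for i j by simp
  have row: "norm (M $ i) \<le> real CARD('n) * (real CARD('n) * c)" for i
  proof -
    have "norm (M $ i) \<le> (\<Sum>j\<in>UNIV. \<bar>M $ i $ j\<bar>)" by (rule norm_le_l1_cart)
    also have "\<dots> \<le> (\<Sum>j\<in>(UNIV :: 'n set). real CARD('n) * c)" by (intro sum_mono ent)
    finally show ?thesis by simp
  qed
  have "norm M \<le> (\<Sum>i\<in>UNIV. norm (M $ i))"
    unfolding norm_vec_def[of M] by (rule L2_set_le_sum) simp
  also have "\<dots> \<le> (\<Sum>i\<in>(UNIV :: 'n set). real CARD('n) * (real CARD('n) * c))" by (intro sum_mono row)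
  also have "\<dots> = real CARD('n) ^ 3 * c" by (simp add: power3_eq_cube)
  finally show ?thesis .
qed

text \<open>In an eigenbasis \<open>V\<close> of \<open>M\<close> every diagonal entry with respect to \<open>E\<close> is an average of the
  eigenvalues with weights \<open>(E i \<bullet> V j)\<^sup>2\<close>, a doubly stochastic matrix. The claim is Jensen's inequality
  for the logarithm, summed over \<open>i\<close>. It serves as a substitute for differentiating the determinant:
  equality holds where \<open>E\<close> diagonalises \<open>M\<close>, so first and second order information about the
  determinant follows from that about the diagonal entries.\<close>

lemma hadamard_inequality:
  fixes M :: "real^'n^'n::finite"
  assumes pd: "pos_def M" and fr: "orthonormal_frame E"
  shows "ln (det M) \<le> (\<Sum>i\<in>UNIV. ln (E i \<bullet> (M *v E i)))"
proof -
  obtain V \<mu> where V: "orthonormal_frame V" "\<And>i. M *v V i = \<mu> i *\<^sub>R V i"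
    using spectral_theorem[of M] pd by (auto simp: pos_def_def)
  have pos: "0 < v \<bullet> (M *v v)" if "v \<noteq> 0" for v using pd that by (simp add: pos_def_def)
  have mup: "\<mu> j > 0" for j
  proof -
    have "V j \<noteq> 0" using frame_norm[OF V(1), of j] by auto
    from pos[OF this] show ?thesis by (simp add: V(2) frame_dot[OF V(1)])
  qed
  have detM: "det M = (\<Prod>i\<in>UNIV. \<mu> i)" using det_eq_prod_eigenvalues V by blast
  define s where "s i j = (E i \<bullet> V j)^2" for i j
  have s1: "(\<Sum>j\<in>UNIV. s i j) = 1" for i
    using frame_inner[OF V(1), of "E i" "E i"] by (simp add: s_def power2_eq_square frame_dot[OF fr])
  have s2: "(\<Sum>i\<in>UNIV. s i j) = 1" for j
    using frame_inner[OF fr, of "V j" "V j"]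
    by (simp add: s_def power2_eq_square frame_dot[OF V(1)] inner_commute)
  have d: "E i \<bullet> (M *v E i) = (\<Sum>j\<in>UNIV. s i j * \<mu> j)" for i
  proof -
    have "(M *v E i) \<bullet> V j = \<mu> j * (E i \<bullet> V j)" for j
      using symmetric_dot_swap[of M "E i" "V j"] pd V(2) by (simp add: pos_def_def)
    then show ?thesis using frame_inner[OF V(1), of "E i" "M *v E i"]
      by (simp add: s_def power2_eq_square mult_ac)
  qed
  have dp: "E i \<bullet> (M *v E i) > 0" for i
    using pos[of "E i"] frame_norm[OF fr, of i] by (metis norm_zero zero_neq_one)
  have jensen: "(\<Sum>j\<in>UNIV. s i j * ln (\<mu> j)) \<le> ln (E i \<bullet> (M *v E i))" for i
  proof -
    define c where "c = E i \<bullet> (M *v E i)"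
    have "c > 0" using dp by (simp add: c_def)
    have "s i j * ln (\<mu> j) \<le> s i j * (ln c + \<mu> j / c - 1)" for j
    proof -
      \<comment> \<open>The tangent of the logarithm at the average \<open>c\<close> lies above its graph.\<close>
      have "ln (\<mu> j / c) \<le> \<mu> j / c - 1" using mup[of j] \<open>c > 0\<close> by (intro ln_le_minus_one) simp
      then have "ln (\<mu> j) \<le> ln c + \<mu> j / c - 1" using mup[of j] \<open>c > 0\<close> by (simp add: ln_div)
      then show ?thesis by (intro mult_left_mono) (auto simp: s_def)
    qed
    then have "(\<Sum>j\<in>UNIV. s i j * ln (\<mu> j)) \<le> (\<Sum>j\<in>UNIV. s i j * (ln c + \<mu> j / c - 1))"
      by (rule sum_mono)
    also have "\<dots> = (\<Sum>j\<in>UNIV. s i j) * (ln c - 1) + (\<Sum>j\<in>UNIV. s i j * \<mu> j) / c"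
      by (simp add: sum_distrib_right sum_divide_distrib flip: sum.distrib) (simp add: algebra_simps)
    also have "\<dots> = ln c" using \<open>c > 0\<close> by (simp add: s1 d[symmetric] c_def)
    finally show ?thesis by (simp add: c_def)
  qed
  have "ln (det M) = (\<Sum>j\<in>UNIV. ln (\<mu> j))"
    unfolding detM using mup by (intro ln_prod, simp, metis less_irrefl)
  also have "\<dots> = (\<Sum>j\<in>UNIV. (\<Sum>i\<in>UNIV. s i j) * ln (\<mu> j))" by (simp add: s2)
  also have "\<dots> = (\<Sum>i\<in>UNIV. \<Sum>j\<in>UNIV. s i j * ln (\<mu> j))"
    by (subst sum.swap) (simp add: sum_distrib_right)
  also have "\<dots> \<le> (\<Sum>i\<in>UNIV. ln (E i \<bullet> (M *v E i)))" by (intro sum_mono jensen)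
  finally show "ln (det M) \<le> (\<Sum>i\<in>UNIV. ln (E i \<bullet> (M *v E i)))" .
qed

section \<open>Second order expansions along curves\<close>

text \<open>\<open>a\<close> and \<open>b\<close> are the first and second derivatives of \<open>g\<close> at \<open>0\<close>. All second order information is
  collected along curves through the point of interest; this turns the maximum principle into the
  second derivative test for functions of one variable.\<close>

definition has_2jet :: "(real \<Rightarrow> 'b::real_normed_vector) \<Rightarrow> 'b \<Rightarrow> 'b \<Rightarrow> bool" where
  "has_2jet g a b \<longleftrightarrow> (\<exists>g'. (\<forall>\<^sub>F t in nhds 0. (g has_vector_derivative g' t) (at t)) \<and>
     g' 0 = a \<and> (g' has_vector_derivative b) (at 0))"

lemma has_2jetI:
  assumes "\<forall>\<^sub>F t in nhds 0. (g has_vector_derivative g' t) (at t)" "(g' has_vector_derivative b) (at 0)"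
    "g' 0 = a"
  shows "has_2jet g a b"
  using assms unfolding has_2jet_def by blast

lemma has_2jetE:
  assumes "has_2jet g a b"
  obtains g' where "\<forall>\<^sub>F t in nhds 0. (g has_vector_derivative g' t) (at t)" "g' 0 = a"
    "(g' has_vector_derivative b) (at 0)" "(g has_vector_derivative a) (at 0)"
proof -
  obtain g' where g': "\<forall>\<^sub>F t in nhds 0. (g has_vector_derivative g' t) (at t)" "g' 0 = a"
    "(g' has_vector_derivative b) (at 0)" using assms unfolding has_2jet_def by blast
  moreover have "(g has_vector_derivative a) (at 0)"
    using eventually_nhds_x_imp_x[OF g'(1)] g'(2) by simp
  ultimately show ?thesis using that by blast
qed

lemma has_2jet_isCont: "has_2jet g a b \<Longrightarrow> isCont g 0"
  by (erule has_2jetE) (rule has_vector_derivative_continuous)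

lemma eventually_along_curve:
  assumes "isCont c 0" "open S" "c 0 \<in> S"
  shows "\<forall>\<^sub>F t in nhds 0. c t \<in> S"
proof -
  have "(c \<longlongrightarrow> c 0) (nhds 0)"
    using assms(1) by (simp add: isCont_def tendsto_at_iff_tendsto_nhds)
  then show ?thesis using assms topological_tendstoD by blast
qed

lemma has_2jet_cong:
  assumes "has_2jet g a b" "\<forall>\<^sub>F t in nhds 0. g t = h t"
  shows "has_2jet h a b"
proof -
  obtain g' where g': "\<forall>\<^sub>F t in nhds 0. (g has_vector_derivative g' t) (at t)" "g' 0 = a"
    "(g' has_vector_derivative b) (at 0)" "(g has_vector_derivative a) (at 0)"
    by (rule has_2jetE[OF assms(1)])
  have "\<forall>\<^sub>F t in nhds 0. \<forall>\<^sub>F s in nhds t. g s = h s"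
    using assms(2) by (simp add: eventually_eventually)
  with g'(1) have "\<forall>\<^sub>F t in nhds 0. (h has_vector_derivative g' t) (at t)"
  proof eventually_elim
    case (elim t)
    then have "g t = h t" using eventually_nhds_x_imp_x by blast
    with elim(2) have "\<forall>\<^sub>F s in nhds t. s \<in> UNIV \<longrightarrow> g s = h s" by simp
    from has_vector_derivative_cong_ev[OF this \<open>g t = h t\<close>] elim(1)
    show ?case by simp
  qed
  then show ?thesis using g' by (blast intro: has_2jetI)
qed

lemma has_2jet_affine: "has_2jet (\<lambda>t. c + t *\<^sub>R v) v 0"
  by (rule has_2jetI[where g' = "\<lambda>_. v"]) (auto intro!: derivative_eq_intros always_eventually)

lemma has_2jet_const: "has_2jet (\<lambda>t. c) 0 0"
  by (rule has_2jetI[where g' = "\<lambda>_. 0"]) (auto intro!: derivative_eq_intros always_eventually)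

lemma has_2jet_add:
  assumes "has_2jet f a b" "has_2jet g c d"
  shows "has_2jet (\<lambda>t. f t + g t) (a + c) (b + d)"
proof -
  obtain f' where f: "\<forall>\<^sub>F t in nhds 0. (f has_vector_derivative f' t) (at t)" "f' 0 = a"
    "(f' has_vector_derivative b) (at 0)" "(f has_vector_derivative a) (at 0)"
    by (rule has_2jetE[OF assms(1)])
  obtain g' where g: "\<forall>\<^sub>F t in nhds 0. (g has_vector_derivative g' t) (at t)" "g' 0 = c"
    "(g' has_vector_derivative d) (at 0)" "(g has_vector_derivative c) (at 0)"
    by (rule has_2jetE[OF assms(2)])
  show ?thesis
  proof (rule has_2jetI[where g' = "\<lambda>t. f' t + g' t"])
    show "\<forall>\<^sub>F t in nhds 0. ((\<lambda>t. f t + g t) has_vector_derivative f' t + g' t) (at t)"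
      using f(1) g(1) by eventually_elim (rule has_vector_derivative_add)
  qed (use f g in \<open>auto intro!: derivative_eq_intros\<close>)
qed

lemma has_2jet_bounded_linear:
  assumes "bounded_linear L" "has_2jet f a b"
  shows "has_2jet (\<lambda>t. L (f t)) (L a) (L b)"
proof -
  obtain f' where f: "\<forall>\<^sub>F t in nhds 0. (f has_vector_derivative f' t) (at t)" "f' 0 = a"
    "(f' has_vector_derivative b) (at 0)" "(f has_vector_derivative a) (at 0)"
    by (rule has_2jetE[OF assms(2)])
  show ?thesis
  proof (rule has_2jetI[where g' = "\<lambda>t. L (f' t)"])
    show "\<forall>\<^sub>F t in nhds 0. ((\<lambda>t. L (f t)) has_vector_derivative L (f' t)) (at t)"
      using f(1) by eventually_elim (rule bounded_linear.has_vector_derivative[OF assms(1)])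
  qed (use f bounded_linear.has_vector_derivative[OF assms(1)] in auto)
qed

lemma has_2jet_diff:
  assumes "has_2jet f a b" "has_2jet g c d"
  shows "has_2jet (\<lambda>t. f t - g t) (a - c) (b - d)"
  using has_2jet_add[OF assms(1) has_2jet_bounded_linear[OF bounded_linear_minus[OF bounded_linear_ident] assms(2)]]
  by simp

lemma has_2jet_sum:
  assumes "\<And>i. i \<in> I \<Longrightarrow> has_2jet (f i) (a i) (b i)"
  shows "has_2jet (\<lambda>t. \<Sum>i\<in>I. f i t) (\<Sum>i\<in>I. a i) (\<Sum>i\<in>I. b i)"
  using assms by (induction I rule: infinite_finite_induct) (auto intro!: has_2jet_add has_2jet_const)

lemma has_2jet_Pair:
  assumes "has_2jet f a b" "has_2jet g c d"
  shows "has_2jet (\<lambda>t. (f t, g t)) (a, c) (b, d)"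
proof -
  have "bounded_linear (\<lambda>x::'a. (x, 0::'b))" "bounded_linear (\<lambda>x::'b. (0::'a, x))"
    by (intro bounded_linear_Pair bounded_linear_ident bounded_linear_zero)+
  from has_2jet_add[OF has_2jet_bounded_linear[OF this(1) assms(1)]
      has_2jet_bounded_linear[OF this(2) assms(2)]]
  show ?thesis by simp
qed

lemma has_2jet_inner:
  assumes "has_2jet f a b" "has_2jet g c d"
  shows "has_2jet (\<lambda>t. f t \<bullet> g t) (a \<bullet> g 0 + f 0 \<bullet> c) (b \<bullet> g 0 + 2 * (a \<bullet> c) + f 0 \<bullet> d)"
proof -
  obtain f' where f: "\<forall>\<^sub>F t in nhds 0. (f has_vector_derivative f' t) (at t)" "f' 0 = a"
    "(f' has_vector_derivative b) (at 0)" "(f has_vector_derivative a) (at 0)"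
    by (rule has_2jetE[OF assms(1)])
  obtain g' where g: "\<forall>\<^sub>F t in nhds 0. (g has_vector_derivative g' t) (at t)" "g' 0 = c"
    "(g' has_vector_derivative d) (at 0)" "(g has_vector_derivative c) (at 0)"
    by (rule has_2jetE[OF assms(2)])
  show ?thesis
  proof (rule has_2jetI[where g' = "\<lambda>t. f' t \<bullet> g t + f t \<bullet> g' t"])
    show "\<forall>\<^sub>F t in nhds 0. ((\<lambda>t. f t \<bullet> g t) has_vector_derivative (f' t \<bullet> g t + f t \<bullet> g' t)) (at t)"
      using f(1) g(1)
      by eventually_elim
        (metis add.commute bounded_bilinear.has_vector_derivative[OF bounded_bilinear_inner])
    have "((\<lambda>t. f' t \<bullet> g t + f t \<bullet> g' t) has_vector_derivative
        (f' 0 \<bullet> c + b \<bullet> g 0) + (f 0 \<bullet> d + a \<bullet> g' 0)) (at 0)"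
      by (intro has_vector_derivative_add bounded_bilinear.has_vector_derivative[OF bounded_bilinear_inner]
          f g)
    then show "((\<lambda>t. f' t \<bullet> g t + f t \<bullet> g' t) has_vector_derivative b \<bullet> g 0 + 2 * (a \<bullet> c) + f 0 \<bullet> d) (at 0)"
      by (simp add: f(2) g(2) algebra_simps)
  qed (simp add: f g)
qed

lemma has_2jet_ln:
  fixes g :: "real \<Rightarrow> real"
  assumes "has_2jet g a b" "g 0 > 0"
  shows "has_2jet (\<lambda>t. ln (g t)) (a / g 0) (b / g 0 - (a / g 0)\<^sup>2)"
proof -
  obtain g' where g: "\<forall>\<^sub>F t in nhds 0. (g has_vector_derivative g' t) (at t)" "g' 0 = a"
    "(g' has_vector_derivative b) (at 0)" "(g has_vector_derivative a) (at 0)"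
    by (rule has_2jetE[OF assms(1)])
  have "(g \<longlongrightarrow> g 0) (nhds 0)"
    using has_2jet_isCont[OF assms(1)] by (simp add: isCont_def tendsto_at_iff_tendsto_nhds)
  from order_tendstoD(1)[OF this assms(2)] have pos: "\<forall>\<^sub>F t in nhds 0. g t > 0" .
  show ?thesis
  proof (rule has_2jetI[where g' = "\<lambda>t. g' t / g t"])
    show "\<forall>\<^sub>F t in nhds 0. ((\<lambda>t. ln (g t)) has_vector_derivative g' t / g t) (at t)"
      using g(1) pos
    proof eventually_elim
      case (elim t)
      then have "((\<lambda>t. ln (g t)) has_real_derivative 1 / g t * g' t) (at t)"
        by (intro DERIV_chain2[OF DERIV_ln_divide])
          (simp_all add: has_real_derivative_iff_has_vector_derivative)
      then show ?case by (simp add: has_real_derivative_iff_has_vector_derivative)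
    qed
    have "((\<lambda>t. g' t / g t) has_real_derivative (b * g 0 - g' 0 * a) / (g 0 * g 0)) (at 0)"
      using g(3,4) assms(2)
      by (intro DERIV_divide) (simp_all add: has_real_derivative_iff_has_vector_derivative)
    moreover have "(b * g 0 - g' 0 * a) / (g 0 * g 0) = b / g 0 - (a / g 0)\<^sup>2"
      using assms(2) g(2) by (simp add: field_simps power2_eq_square)
    ultimately show "((\<lambda>t. g' t / g t) has_vector_derivative b / g 0 - (a / g 0)\<^sup>2) (at 0)"
      by (simp add: has_real_derivative_iff_has_vector_derivative)
  qed (simp add: g)
qed

text \<open>If the second derivative were negative, the first derivative would be negative to the right of
  \<open>0\<close>, and the mean value theorem would produce smaller values.\<close>

lemma has_2jet_local_min:
  fixes g :: "real \<Rightarrow> real"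
  assumes jet: "has_2jet g a b" and min: "\<forall>\<^sub>F t in nhds 0. g 0 \<le> g t"
  shows "a = 0" "0 \<le> b"
proof -
  obtain g' where g: "\<forall>\<^sub>F t in nhds 0. (g has_real_derivative g' t) (at t)" "g' 0 = a"
    "(g' has_real_derivative b) (at 0)" "(g has_real_derivative a) (at 0)"
    using jet by (auto simp: has_real_derivative_iff_has_vector_derivative elim: has_2jetE)
  obtain d where d: "d > 0" "\<And>t. \<bar>t\<bar> < d \<Longrightarrow> g 0 \<le> g t"
    using min by (auto simp: eventually_nhds_metric dist_real_def)
  show a: "a = 0" using DERIV_local_min[OF g(4) d(1)] d(2) by simp
  show "0 \<le> b"
  proof (rule ccontr)
    assume "\<not> 0 \<le> b"
    then obtain d1 where d1: "d1 > 0" "\<And>h. 0 < h \<Longrightarrow> h < d1 \<Longrightarrow> g' h < 0"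
      using DERIV_neg_dec_right[OF g(3)] a g(2) by auto
    obtain d2 where d2: "d2 > 0" "\<And>t. \<bar>t\<bar> < d2 \<Longrightarrow> (g has_real_derivative g' t) (at t)"
      using g(1) by (auto simp: eventually_nhds_metric dist_real_def)
    define h where "h = Min {d, d1, d2} / 2"
    have h: "0 < h" "h < d" "h < d1" "h < d2" using d(1) d1(1) d2(1) by (auto simp: h_def)
    obtain z where z: "0 < z" "z < h" "g h - g 0 = (h - 0) * g' z"
      using MVT2[of 0 h g g'] h d2(2) by force
    have "h * g' z < 0" using z h d1(2)[of z] by (simp add: mult_pos_neg)
    moreover have "g 0 \<le> g h" using d(2) h by simp
    ultimately show False using z(3) by simp
  qed
qed

lemma cutoff_along_line:
  fixes x y v :: "real^'n"
  shows "has_2jet (\<lambda>t. r\<^sup>2 - (norm (y + t *\<^sub>R v - x))\<^sup>2) (- 2 * ((y - x) \<bullet> v)) (- 2 * (v \<bullet> v))"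
proof -
  have "has_2jet (\<lambda>t. (y - x) + t *\<^sub>R v) v 0" by (rule has_2jet_affine)
  from has_2jet_diff[OF has_2jet_const[of "r\<^sup>2"] has_2jet_inner[OF this this]]
  have "has_2jet (\<lambda>t. r\<^sup>2 - ((y - x) + t *\<^sub>R v) \<bullet> ((y - x) + t *\<^sub>R v)) (- 2 * ((y - x) \<bullet> v)) (- 2 * (v \<bullet> v))"
    by (simp add: inner_commute)
  then show ?thesis by (simp add: power2_norm_eq_inner algebra_simps)
qed

text \<open>First and second order conditions for a maximum of \<open>c\<^sup>2 w\<close>, written for its logarithm.\<close>

lemma auxiliary_function_conditions:
  fixes w :: "real \<Rightarrow> real"
  assumes w: "has_2jet w X Y" "0 < w 0" and c: "has_2jet c c1 c2" "0 < c 0"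
    and max: "\<forall>\<^sub>F t in nhds 0. (c t)\<^sup>2 * w t \<le> (c 0)\<^sup>2 * w 0"
  shows "X / w 0 + 2 * (c1 / c 0) = 0"
    "Y / w 0 - (X / w 0)\<^sup>2 + 2 * (c2 / c 0 - (c1 / c 0)\<^sup>2) \<le> 0"
proof -
  have j: "has_2jet (\<lambda>t. 0 - (ln (w t) + 2 * ln (c t))) (0 - (X / w 0 + 2 * (c1 / c 0)))
     (0 - (Y / w 0 - (X / w 0)\<^sup>2 + 2 * (c2 / c 0 - (c1 / c 0)\<^sup>2)))"
    by (intro has_2jet_diff has_2jet_const has_2jet_add has_2jet_ln w c
        has_2jet_bounded_linear[OF bounded_linear_mult_right])
  have "\<forall>\<^sub>F t in nhds 0. w t \<in> {0<..}" "\<forall>\<^sub>F t in nhds 0. c t \<in> {0<..}"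
    by (rule eventually_along_curve[OF has_2jet_isCont], rule w c, simp, simp add: w c)+
  with max have "\<forall>\<^sub>F t in nhds 0. 0 - (ln (w 0) + 2 * ln (c 0)) \<le> 0 - (ln (w t) + 2 * ln (c t))"
  proof eventually_elim
    case (elim t)
    then have p: "0 < w t" "0 < c t" by auto
    have "ln ((c t)\<^sup>2 * w t) \<le> ln ((c 0)\<^sup>2 * w 0)" using elim(1) p by (intro ln_mono) auto
    moreover have "ln ((c t)\<^sup>2 * w t) = ln (w t) + 2 * ln (c t)" using p by (simp add: ln_mult ln_realpow)
    moreover have "ln ((c 0)\<^sup>2 * w 0) = ln (w 0) + 2 * ln (c 0)" using w c by (simp add: ln_mult ln_realpow)
    ultimately show ?case by linarith
  qed
  from has_2jet_local_min[OF j this]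
  show "X / w 0 + 2 * (c1 / c 0) = 0" "Y / w 0 - (X / w 0)\<^sup>2 + 2 * (c2 / c 0 - (c1 / c 0)\<^sup>2) \<le> 0"
    by auto
qed

section \<open>Directional derivatives and the second order chain rule\<close>

lemma has_derivative_dir_deriv:
  assumes "f differentiable (at x)"
  shows "(f has_derivative (\<lambda>v. dir_deriv v f x)) (at x)"
  using assms by (simp add: dir_deriv_def frechet_derivative_works[symmetric])

lemma dir_deriv_linear:
  assumes "f differentiable (at x)"
  shows "linear (\<lambda>v. dir_deriv v f x)"
  using linear_frechet_derivative[OF assms] by (simp add: dir_deriv_def[abs_def])

lemma dir_deriv_basis:
  fixes f :: "'a::euclidean_space \<Rightarrow> 'b::real_normed_vector"
  assumes "f differentiable (at x)"
  shows "dir_deriv v f x = (\<Sum>e\<in>Basis. (v \<bullet> e) *\<^sub>R dir_deriv e f x)"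
proof -
  have "dir_deriv (\<Sum>e\<in>Basis. (v \<bullet> e) *\<^sub>R e) f x = (\<Sum>e\<in>Basis. (v \<bullet> e) *\<^sub>R dir_deriv e f x)"
    by (simp add: linear_sum[OF dir_deriv_linear[OF assms]] linear_scale[OF dir_deriv_linear[OF assms]])
  then show ?thesis by (simp add: euclidean_representation)
qed

lemma dir_deriv_eqI:
  assumes "(f has_derivative f') (at x)"
  shows "dir_deriv v f x = f' v"
  using frechet_derivative_at[OF assms] by (simp add: dir_deriv_def)

lemma dir_deriv_cong:
  assumes "open S" "x \<in> S" "f differentiable (at x)" "\<And>y. y \<in> S \<Longrightarrow> f y = g y"
  shows "dir_deriv v f x = dir_deriv v g x"
  using frechet_derivative_transform_within_open[OF assms(3,1,2,4)] by (simp add: dir_deriv_def)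

lemma differentiable_cong_open:
  assumes "open S" "x \<in> S" "f differentiable (at x)" "\<And>y. y \<in> S \<Longrightarrow> f y = g y"
  shows "g differentiable (at x)"
proof -
  obtain D where "(f has_derivative D) (at x)" using assms(3) by (auto simp: differentiable_def)
  from has_derivative_transform_within_open[OF this assms(1,2,4)] show ?thesis
    by (auto simp: differentiable_def)
qed

lemma dir_deriv_bounded_linear:
  assumes "bounded_linear L" "f differentiable (at x)"
  shows "dir_deriv v (\<lambda>y. L (f y)) x = L (dir_deriv v f x)"
  by (rule dir_deriv_eqI, rule bounded_linear.has_derivative[OF assms(1)],
      rule has_derivative_dir_deriv[OF assms(2)])

lemma has_vector_derivative_along_curve:
  assumes "f differentiable (at (c t))" "(c has_vector_derivative v) (at t)"
  shows "((\<lambda>t. f (c t)) has_vector_derivative dir_deriv v f (c t)) (at t)"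
proof -
  have "((f \<circ> c) has_derivative (\<lambda>v. dir_deriv v f (c t)) \<circ> (\<lambda>h. h *\<^sub>R v)) (at t)"
    using assms by (intro diff_chain_at has_derivative_dir_deriv)
      (simp_all add: has_vector_derivative_def)
  then show ?thesis
    by (simp add: has_vector_derivative_def o_def linear_scale[OF dir_deriv_linear[OF assms(1)]])
qed

text \<open>The Hessian of \<open>f\<close> as a bilinear form, expanded over the basis in the argument of the inner
  derivative, so that linearity in \<open>w\<close> holds without any regularity.\<close>

definition second_deriv :: "('a::euclidean_space \<Rightarrow> 'b::real_normed_vector) \<Rightarrow> 'a \<Rightarrow> 'a \<Rightarrow> 'a \<Rightarrow> 'b" where
  "second_deriv f x v w = (\<Sum>e\<in>Basis. (w \<bullet> e) *\<^sub>R dir_deriv v (dir_deriv e f) x)"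

lemma has_2jet_compose:
  fixes f :: "'a::euclidean_space \<Rightarrow> 'b::real_normed_vector"
  assumes jet: "has_2jet c a b" and S: "open S" "c 0 \<in> S"
    and d1: "\<And>x. x \<in> S \<Longrightarrow> f differentiable (at x)"
    and d2: "\<And>e. e \<in> Basis \<Longrightarrow> dir_deriv e f differentiable (at (c 0))"
  shows "has_2jet (\<lambda>t. f (c t)) (dir_deriv a f (c 0)) (second_deriv f (c 0) a a + dir_deriv b f (c 0))"
proof -
  obtain c' where c: "\<forall>\<^sub>F t in nhds 0. (c has_vector_derivative c' t) (at t)" "c' 0 = a"
    "(c' has_vector_derivative b) (at 0)" "(c has_vector_derivative a) (at 0)"
    by (rule has_2jetE[OF jet])
  note ev = eventually_along_curve[OF has_2jet_isCont[OF jet] S]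
  show ?thesis
  proof (rule has_2jetI[where g' = "\<lambda>t. \<Sum>e\<in>Basis. (c' t \<bullet> e) *\<^sub>R dir_deriv e f (c t)"])
    show "\<forall>\<^sub>F t in nhds 0. ((\<lambda>t. f (c t)) has_vector_derivative
        (\<Sum>e\<in>Basis. (c' t \<bullet> e) *\<^sub>R dir_deriv e f (c t))) (at t)"
      using c(1) ev
    proof eventually_elim
      case (elim t)
      then show ?case
        using has_vector_derivative_along_curve[OF d1[OF elim(2)] elim(1)]
        by (simp add: dir_deriv_basis[OF d1[OF elim(2)], of "c' t"])
    qed
    have "((\<lambda>t. (c' t \<bullet> e) *\<^sub>R dir_deriv e f (c t)) has_vector_derivative
        (c' 0 \<bullet> e) *\<^sub>R dir_deriv a (dir_deriv e f) (c 0) + (b \<bullet> e) *\<^sub>R dir_deriv e f (c 0)) (at 0)"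
      if e: "e \<in> Basis" for e
    proof (rule bounded_bilinear.has_vector_derivative[OF bounded_bilinear_scaleR])
      show "((\<lambda>t. c' t \<bullet> e) has_vector_derivative b \<bullet> e) (at 0)"
        by (rule bounded_linear.has_vector_derivative[OF bounded_linear_inner_left c(3)])
      show "((\<lambda>t. dir_deriv e f (c t)) has_vector_derivative dir_deriv a (dir_deriv e f) (c 0)) (at 0)"
        by (rule has_vector_derivative_along_curve[OF d2[OF e] c(4)])
    qed
    then have "((\<lambda>t. \<Sum>e\<in>Basis. (c' t \<bullet> e) *\<^sub>R dir_deriv e f (c t)) has_vector_derivative
        (\<Sum>e\<in>Basis. (c' 0 \<bullet> e) *\<^sub>R dir_deriv a (dir_deriv e f) (c 0) + (b \<bullet> e) *\<^sub>R dir_deriv e f (c 0))) (at 0)"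
      by (rule has_vector_derivative_sum)
    then show "((\<lambda>t. \<Sum>e\<in>Basis. (c' t \<bullet> e) *\<^sub>R dir_deriv e f (c t)) has_vector_derivative
        second_deriv f (c 0) a a + dir_deriv b f (c 0)) (at 0)"
      by (simp add: c(2) sum.distrib second_deriv_def dir_deriv_basis[OF d1[OF S(2)], of b])
    show "(\<Sum>e\<in>Basis. (c' 0 \<bullet> e) *\<^sub>R dir_deriv e f (c 0)) = dir_deriv a f (c 0)"
      by (simp add: c(2) dir_deriv_basis[OF d1[OF S(2)], of a])
  qed
qed

section \<open>Functions of class \<open>C\<^sup>k\<close> and the symmetry of their derivatives\<close>

lemma C_k_cong:
  assumes "open S" "C_k k S f" "\<And>x. x \<in> S \<Longrightarrow> f x = g x"
  shows "C_k k S g"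
  using assms(2,3)
proof (induction k arbitrary: f g)
  case 0
  then show ?case by (metis C_k.simps(1) continuous_on_cong)
next
  case (Suc k)
  then have d: "\<And>x. x \<in> S \<Longrightarrow> f differentiable (at x)" by simp
  have "C_k k S (dir_deriv e g)" if "e \<in> Basis" for e
    by (rule Suc.IH[of "dir_deriv e f"]) (use Suc.prems that dir_deriv_cong[OF assms(1) _ d] in auto)
  moreover have "g differentiable (at x)" if "x \<in> S" for x
    using differentiable_cong_open[OF assms(1) that d[OF that]] Suc.prems(2) by blast
  ultimately show ?case by simp
qed

lemma C_k_Suc_imp:
  assumes "C_k (Suc k) S f"
  shows "C_k k S f"
  using assms
proof (induction k arbitrary: f)
  case 0
  then have "f differentiable_on S"
    by (simp add: differentiable_on_def differentiable_at_withinI)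
  then show ?case by (simp add: differentiable_imp_continuous_on)
next
  case (Suc k)
  have "C_k k S (dir_deriv e f)" if "e \<in> Basis" for e
    using Suc.IH Suc.prems that by (metis C_k.simps(2))
  then show ?case using Suc.prems by (metis C_k.simps(2))
qed

lemma C_k_const: "C_k k S (\<lambda>x. c)"
proof (induction k arbitrary: c)
  case (Suc k)
  have "dir_deriv e (\<lambda>x. c) = (\<lambda>x. 0)" for e :: 'a
    by (rule ext) (simp add: dir_deriv_def)
  then show ?case using Suc by simp
qed simp

lemma C_k_add:
  assumes "open S" "C_k k S f" "C_k k S g"
  shows "C_k k S (\<lambda>x. f x + g x)"
  using assms(2,3)
proof (induction k arbitrary: f g)
  case 0
  then show ?case by (simp add: continuous_on_add)
next
  case (Suc k)
  have "C_k k S (dir_deriv e (\<lambda>x. f x + g x))" if e: "e \<in> Basis" for e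
  proof (rule C_k_cong[OF assms(1)])
    show "C_k k S (\<lambda>x. dir_deriv e f x + dir_deriv e g x)" using Suc e by simp
    show "dir_deriv e f x + dir_deriv e g x = dir_deriv e (\<lambda>x. f x + g x) x" if "x \<in> S" for x
      using that Suc.prems
      by (intro dir_deriv_eqI[symmetric] has_derivative_add has_derivative_dir_deriv) auto
  qed
  then show ?case using Suc.prems by simp
qed

lemma C_k_bounded_linear:
  assumes "open S" "bounded_linear L" "C_k k S f"
  shows "C_k k S (\<lambda>x. L (f x))"
  using assms(3)
proof (induction k arbitrary: f)
  case 0
  then show ?case by (simp add: bounded_linear.continuous_on[OF assms(2)])
next
  case (Suc k)
  have "C_k k S (dir_deriv e (\<lambda>x. L (f x)))" if e: "e \<in> Basis" for e
    by (rule C_k_cong[OF assms(1) Suc.IH[of "dir_deriv e f"]])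
      (use Suc.prems e dir_deriv_bounded_linear[OF assms(2), symmetric] in auto)
  moreover have "(\<lambda>x. L (f x)) differentiable (at x)" if "x \<in> S" for x
    using bounded_linear.has_derivative[OF assms(2) has_derivative_dir_deriv[of f x]] Suc.prems that
    unfolding differentiable_def by (meson C_k.simps(2) differentiable_def)
  ultimately show ?case by simp
qed

lemma C_k_sum:
  assumes "open S" "\<And>i. i \<in> I \<Longrightarrow> C_k k S (f i)"
  shows "C_k k S (\<lambda>x. \<Sum>i\<in>I. f i x)"
  using assms(2) by (induction I rule: infinite_finite_induct) (auto intro!: C_k_const C_k_add[OF assms(1)])

lemma C_k_dir_deriv:
  assumes "open S" "C_k (Suc k) S f"
  shows "C_k k S (dir_deriv v f)"
proof (rule C_k_cong[OF assms(1)])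
  show "C_k k S (\<lambda>x. \<Sum>e\<in>Basis. (v \<bullet> e) *\<^sub>R dir_deriv e f x)"
    using assms by (intro C_k_sum C_k_bounded_linear[OF _ bounded_linear_scaleR_right]) auto
  show "(\<Sum>e\<in>Basis. (v \<bullet> e) *\<^sub>R dir_deriv e f x) = dir_deriv v f x" if "x \<in> S" for x
    using dir_deriv_basis[of f x v] assms that by simp
qed

lemma C_k_differentiable: "C_k (Suc k) S f \<Longrightarrow> x \<in> S \<Longrightarrow> f differentiable (at x)"
  by simp

lemma C_k_along_line:
  assumes "open S" "C_k 2 S f" "x \<in> S"
  shows "has_2jet (\<lambda>t. f (x + t *\<^sub>R v)) (dir_deriv v f x) (dir_deriv v (dir_deriv v f) x)"
proof (rule has_2jetI[where g' = "\<lambda>t. dir_deriv v f (x + t *\<^sub>R v)"])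
  have l: "((\<lambda>t. x + t *\<^sub>R v) has_vector_derivative v) (at t)" for t
    by (auto intro!: derivative_eq_intros)
  have f2: "C_k (Suc 1) S f" using assms(2) by (simp add: numeral_2_eq_2)
  have "\<forall>\<^sub>F t in nhds 0. x + t *\<^sub>R v \<in> S"
    using assms by (intro eventually_along_curve continuous_intros) auto
  then show "\<forall>\<^sub>F t in nhds 0. ((\<lambda>t. f (x + t *\<^sub>R v)) has_vector_derivative dir_deriv v f (x + t *\<^sub>R v)) (at t)"
    by eventually_elim (rule has_vector_derivative_along_curve[OF C_k_differentiable[OF f2] l])
  have "C_k (Suc 0) S (dir_deriv v f)" using C_k_dir_deriv[OF assms(1), of 1] f2 by simp
  from has_vector_derivative_along_curve[of _ "\<lambda>t. x + t *\<^sub>R v" 0, OF _ l] C_k_differentiable[OF this assms(3)]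
  show "((\<lambda>t. dir_deriv v f (x + t *\<^sub>R v)) has_vector_derivative dir_deriv v (dir_deriv v f) x) (at 0)"
    by fastforce
qed simp

lemma second_difference_mean_value:
  fixes f :: "'a::euclidean_space \<Rightarrow> real"
  assumes h: "0 < h"
    and inS: "\<And>s t. 0 \<le> s \<Longrightarrow> s \<le> h \<Longrightarrow> 0 \<le> t \<Longrightarrow> t \<le> h \<Longrightarrow> x + s *\<^sub>R v + t *\<^sub>R w \<in> S"
    and d1: "\<And>y. y \<in> S \<Longrightarrow> f differentiable (at y)"
    and d2: "\<And>y. y \<in> S \<Longrightarrow> dir_deriv v f differentiable (at y)"
  obtains s t where "0 < s" "s < h" "0 < t" "t < h"
    "f (x + h *\<^sub>R v + h *\<^sub>R w) - f (x + h *\<^sub>R v) - f (x + h *\<^sub>R w) + f x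
      = h * (h * dir_deriv w (dir_deriv v f) (x + s *\<^sub>R v + t *\<^sub>R w))"
proof -
  define g where "g s = f (x + s *\<^sub>R v + h *\<^sub>R w) - f (x + s *\<^sub>R v)" for s
  have "(g has_real_derivative dir_deriv v f (x + s *\<^sub>R v + h *\<^sub>R w) - dir_deriv v f (x + s *\<^sub>R v)) (at s)"
    if s: "0 \<le> s" "s \<le> h" for s
    unfolding g_def has_real_derivative_iff_has_vector_derivative
  proof (intro has_vector_derivative_diff)
    show "((\<lambda>s. f (x + s *\<^sub>R v + h *\<^sub>R w)) has_vector_derivative dir_deriv v f (x + s *\<^sub>R v + h *\<^sub>R w)) (at s)"
      using inS[of s h] s h by (intro has_vector_derivative_along_curve d1) (auto intro!: derivative_eq_intros)
    show "((\<lambda>s. f (x + s *\<^sub>R v)) has_vector_derivative dir_deriv v f (x + s *\<^sub>R v)) (at s)"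
      using inS[of s 0] s h by (intro has_vector_derivative_along_curve d1) (auto intro!: derivative_eq_intros)
  qed
  from MVT2[OF h this] obtain s where s: "0 < s" "s < h"
    "g h - g 0 = h * (dir_deriv v f (x + s *\<^sub>R v + h *\<^sub>R w) - dir_deriv v f (x + s *\<^sub>R v))" by auto
  have "((\<lambda>t. dir_deriv v f (x + s *\<^sub>R v + t *\<^sub>R w)) has_real_derivative
      dir_deriv w (dir_deriv v f) (x + s *\<^sub>R v + t *\<^sub>R w)) (at t)" if t: "0 \<le> t" "t \<le> h" for t
    unfolding has_real_derivative_iff_has_vector_derivative
    using inS[of s t] s t by (intro has_vector_derivative_along_curve d2) (auto intro!: derivative_eq_intros)
  from MVT2[OF h this] obtain t where t: "0 < t" "t < h"
    "dir_deriv v f (x + s *\<^sub>R v + h *\<^sub>R w) - dir_deriv v f (x + s *\<^sub>R v) =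
      h * dir_deriv w (dir_deriv v f) (x + s *\<^sub>R v + t *\<^sub>R w)" by auto
  show ?thesis using that[of s t] s t by (simp add: g_def)
qed

text \<open>Schwarz's theorem: the symmetric second difference of \<open>f\<close> equals, up to the factor \<open>h * h\<close>, a value
  of either mixed derivative at a nearby point, and both mixed derivatives are continuous.\<close>

lemma C_2_mixed_derivatives_commute:
  fixes f :: "'a::euclidean_space \<Rightarrow> real"
  assumes S: "open S" "x \<in> S" and f: "C_k 2 S f"
  shows "dir_deriv v (dir_deriv w f) x = dir_deriv w (dir_deriv v f) x"
proof -
  have f2: "C_k (Suc 1) S f" using f by (simp add: numeral_2_eq_2)
  have d1: "\<And>y. y \<in> S \<Longrightarrow> f differentiable (at y)" using f2 by simp
  have c1: "C_k (Suc 0) S (dir_deriv a f)" for a using C_k_dir_deriv[OF S(1), of 1] f2 by simp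
  have d2: "\<And>y. y \<in> S \<Longrightarrow> dir_deriv a f differentiable (at y)" for a using c1 C_k_differentiable by blast
  have c0: "continuous_on S (dir_deriv a (dir_deriv b f))" for a b
    using C_k_dir_deriv[OF S(1) c1] by simp
  have close: "\<bar>dir_deriv v (dir_deriv w f) x - dir_deriv w (dir_deriv v f) x\<bar> \<le> 2 * \<epsilon>" if e: "\<epsilon> > 0" for \<epsilon>
  proof -
    have near: "\<exists>d>0. \<forall>y. dist y x < d \<longrightarrow> y \<in> S \<and> \<bar>dir_deriv a (dir_deriv b f) y - dir_deriv a (dir_deriv b f) x\<bar> < \<epsilon>" for a b
    proof -
      have "isCont (dir_deriv a (dir_deriv b f)) x"
        using c0 S continuous_on_eq_continuous_at by blast
      then obtain d where "d > 0" "\<And>y. dist y x < d \<Longrightarrow> \<bar>dir_deriv a (dir_deriv b f) y - dir_deriv a (dir_deriv b f) x\<bar> < \<epsilon>"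
        using e unfolding continuous_at_eps_delta dist_real_def by meson
      moreover obtain d' where "d' > 0" "ball x d' \<subseteq> S" using S open_contains_ball by blast
      ultimately show ?thesis
        by (intro exI[of _ "min d d'"]) (auto simp: subset_iff dist_commute)
    qed
    obtain d where d: "d > 0" "\<And>y. dist y x < d \<Longrightarrow> y \<in> S"
      "\<And>y. dist y x < d \<Longrightarrow> \<bar>dir_deriv v (dir_deriv w f) y - dir_deriv v (dir_deriv w f) x\<bar> < \<epsilon>"
      "\<And>y. dist y x < d \<Longrightarrow> \<bar>dir_deriv w (dir_deriv v f) y - dir_deriv w (dir_deriv v f) x\<bar> < \<epsilon>"
    proof -
      obtain d1 d2 where "d1 > 0" "d2 > 0"
        "\<And>y. dist y x < d1 \<Longrightarrow> y \<in> S \<and> \<bar>dir_deriv v (dir_deriv w f) y - dir_deriv v (dir_deriv w f) x\<bar> < \<epsilon>"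
        "\<And>y. dist y x < d2 \<Longrightarrow> \<bar>dir_deriv w (dir_deriv v f) y - dir_deriv w (dir_deriv v f) x\<bar> < \<epsilon>"
        using near[of v w] near[of w v] by blast
      then show ?thesis using that[of "min d1 d2"] by simp
    qed
    define h where "h = d / (norm v + norm w + 1) / 2"
    have nn: "norm v + norm w + 1 > 0" by (simp add: add_nonneg_pos)
    have h: "h > 0" using d(1) nn by (simp add: h_def)
    have hd: "h * (norm v + norm w) < d"
    proof -
      have "h * (norm v + norm w + 1) = d / 2" using nn unfolding h_def by (simp only: times_divide_eq_left times_divide_eq_right nonzero_mult_div_cancel_right less_imp_neq[symmetric] not_False_eq_True)
      moreover have "h * (norm v + norm w) \<le> h * (norm v + norm w + 1)" using h by simp
      ultimately show ?thesis using d(1) by simp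
    qed
    have small: "dist (x + s *\<^sub>R v + t *\<^sub>R w) x < d" if "0 \<le> s" "s \<le> h" "0 \<le> t" "t \<le> h" for s t
    proof -
      have "norm (s *\<^sub>R v + t *\<^sub>R w) \<le> s * norm v + t * norm w"
        using that by (metis abs_of_nonneg norm_scaleR norm_triangle_ineq)
      also have "\<dots> \<le> h * norm v + h * norm w" using that by (intro add_mono mult_right_mono) auto
      finally show ?thesis using hd by (simp add: dist_norm algebra_simps)
    qed
    obtain s t where st: "0 < s" "s < h" "0 < t" "t < h"
      "f (x + h *\<^sub>R v + h *\<^sub>R w) - f (x + h *\<^sub>R v) - f (x + h *\<^sub>R w) + f x
      = h * (h * dir_deriv w (dir_deriv v f) (x + s *\<^sub>R v + t *\<^sub>R w))"
    proof (rule second_difference_mean_value[OF h, of x v w S f])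
      show "x + s *\<^sub>R v + t *\<^sub>R w \<in> S" if "0 \<le> s" "s \<le> h" "0 \<le> t" "t \<le> h" for s t
        using small[OF that] d(2) by blast
    qed (use d1 d2 in blast)+
    have small': "x + s *\<^sub>R w + t *\<^sub>R v \<in> S" if "0 \<le> s" "s \<le> h" "0 \<le> t" "t \<le> h" for s t
      using d(2)[OF small[of t s]] that by (simp add: add_ac)
    obtain s' t' where st': "0 < s'" "s' < h" "0 < t'" "t' < h"
      "f (x + h *\<^sub>R w + h *\<^sub>R v) - f (x + h *\<^sub>R w) - f (x + h *\<^sub>R v) + f x
      = h * (h * dir_deriv v (dir_deriv w f) (x + s' *\<^sub>R w + t' *\<^sub>R v))"
      by (rule second_difference_mean_value[OF h, of x w v S f, OF small' d1 d2])
    have "h * (h * dir_deriv w (dir_deriv v f) (x + s *\<^sub>R v + t *\<^sub>R w)) =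
        h * (h * dir_deriv v (dir_deriv w f) (x + s' *\<^sub>R w + t' *\<^sub>R v))"
    proof -
      have "x + h *\<^sub>R w + h *\<^sub>R v = x + h *\<^sub>R v + h *\<^sub>R w" by (simp add: add_ac)
      with st'(5) have "f (x + h *\<^sub>R v + h *\<^sub>R w) - f (x + h *\<^sub>R w) - f (x + h *\<^sub>R v) + f x
          = h * (h * dir_deriv v (dir_deriv w f) (x + s' *\<^sub>R w + t' *\<^sub>R v))" by metis
      with st(5) show ?thesis by linarith
    qed
    then have "dir_deriv w (dir_deriv v f) (x + s *\<^sub>R v + t *\<^sub>R w) =
        dir_deriv v (dir_deriv w f) (x + s' *\<^sub>R w + t' *\<^sub>R v)" using h by simp
    moreover have "dist (x + s' *\<^sub>R w + t' *\<^sub>R v) x < d" using small[of t' s'] st' by (simp add: add_ac)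
    ultimately show ?thesis using d(3)[of "x + s' *\<^sub>R w + t' *\<^sub>R v"] d(4)[of "x + s *\<^sub>R v + t *\<^sub>R w"] small[of s t] st
      by simp
  qed
  show ?thesis
  proof (rule ccontr)
    assume "\<not> ?thesis"
    then show False
      using close[of "\<bar>dir_deriv v (dir_deriv w f) x - dir_deriv w (dir_deriv v f) x\<bar> / 4"] by simp
  qed
qed

lemma C_3_mixed_derivatives_commute:
  fixes f :: "'a::euclidean_space \<Rightarrow> real"
  assumes S: "open S" "x \<in> S" and f: "C_k 3 S f"
  shows "dir_deriv w (dir_deriv v (dir_deriv v f)) x = dir_deriv v (dir_deriv v (dir_deriv w f)) x"
proof -
  have 3: "Suc 2 = 3" and 2: "Suc 1 = 2" by simp_all
  have f3: "C_k (Suc 2) S f" using f by (simp only: 3)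
  have f2: "C_k 2 S f" by (rule C_k_Suc_imp[OF f3])
  have g2: "C_k 2 S (dir_deriv a f)" for a by (rule C_k_dir_deriv[OF S(1) f3])
  have g2': "C_k (Suc 1) S (dir_deriv a f)" for a using g2 by (simp only: 2)
  have h1: "C_k (Suc 0) S (dir_deriv a (dir_deriv c f))" for a c
    using C_k_dir_deriv[OF S(1) g2'] by simp
  have "dir_deriv w (dir_deriv v (dir_deriv v f)) x = dir_deriv v (dir_deriv w (dir_deriv v f)) x"
    by (rule C_2_mixed_derivatives_commute[OF S g2])
  also have "\<dots> = dir_deriv v (dir_deriv v (dir_deriv w f)) x"
    by (rule dir_deriv_cong[OF S C_k_differentiable[OF h1 S(2)]])
      (rule C_2_mixed_derivatives_commute[OF S(1) _ f2])
  finally show ?thesis .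
qed

section \<open>Pointwise bounds from the norms of the data\<close>

text \<open>A supremum of real numbers carries information only if it is taken over a set that is bounded
  above. Continuity up to the closure provides this on bounded sets, whose closure is compact.\<close>

lemma extends_continuously_bdd_above:
  assumes f: "extends_continuously S f" and Q: "Q \<subseteq> S" "bounded Q"
  shows "bdd_above ((\<lambda>y. norm (f y)) ` Q)"
proof -
  obtain g where g: "continuous_on (closure S) g" "\<And>x. x \<in> S \<Longrightarrow> g x = f x"
    using f by (auto simp: extends_continuously_def)
  have "compact (closure Q)" using Q(2) by (simp add: compact_closure)
  moreover have "continuous_on (closure Q) g"
    using g(1) closure_mono[OF Q(1)] continuous_on_subset by blast
  ultimately have "bounded (g ` closure Q)" by (intro compact_imp_bounded compact_continuous_image)
  then obtain M where M: "\<And>x. x \<in> closure Q \<Longrightarrow> norm (g x) \<le> M" by (auto simp: bounded_iff)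
  show ?thesis
  proof (rule bdd_aboveI2)
    show "norm (f y) \<le> M" if "y \<in> Q" for y
      using M[OF subsetD[OF closure_subset that]] g(2)[OF subsetD[OF Q(1) that]] by simp
  qed
qed

lemma C_k_closure_extends: "C_k_closure k S f \<Longrightarrow> extends_continuously S f"
  by (cases k) auto

lemma norm_le_SUP_norm:
  assumes "C_k_closure k S f" "Q \<subseteq> S" "bounded Q" "y \<in> Q"
  shows "norm (f y) \<le> (SUP y\<in>Q. norm (f y))"
  using assms(4) by (rule cSUP_upper) (rule extends_continuously_bdd_above[OF C_k_closure_extends[OF assms(1)] assms(2,3)])

lemma C_k_norm_nonneg:
  assumes "C_k_closure k S f" "Q \<subseteq> S" "bounded Q" "y \<in> Q"
  shows "0 \<le> C_k_norm k Q f"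
  using assms(1)
proof (induction k arbitrary: f)
  case 0
  from order_trans[OF norm_ge_zero norm_le_SUP_norm[OF this assms(2-4)]] show ?case by simp
next
  case (Suc k)
  have "0 \<le> (SUP y\<in>Q. norm (f y))"
    by (rule order_trans[OF norm_ge_zero norm_le_SUP_norm[OF Suc.prems assms(2-4)]])
  moreover have "0 \<le> (\<Sum>e\<in>Basis. C_k_norm k Q (dir_deriv e f))"
    using Suc by (intro sum_nonneg) auto
  ultimately show ?case by simp
qed

lemma norm_le_C_k_norm:
  assumes "C_k_closure k S f" "Q \<subseteq> S" "bounded Q" "y \<in> Q"
  shows "norm (f y) \<le> C_k_norm k Q f"
proof (cases k)
  case 0
  then show ?thesis using norm_le_SUP_norm[OF assms] by simp
next
  case (Suc j)
  have "0 \<le> (\<Sum>e\<in>Basis. C_k_norm j Q (dir_deriv e f))"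
    using assms(1) Suc by (intro sum_nonneg C_k_norm_nonneg[OF _ assms(2-4)]) auto
  then show ?thesis using norm_le_SUP_norm[OF assms] Suc by simp
qed

lemma C_k_norm_Suc_ge:
  assumes "C_k_closure (Suc k) S f" "Q \<subseteq> S" "bounded Q" "y \<in> Q"
  shows "(\<Sum>e\<in>Basis. C_k_norm k Q (dir_deriv e f)) \<le> C_k_norm (Suc k) Q f"
  using order_trans[OF norm_ge_zero norm_le_SUP_norm[OF assms]] by simp

lemma norm_sum_Basis_le:
  fixes v :: "'a::euclidean_space" and F :: "'a \<Rightarrow> 'b::real_normed_vector"
  assumes "\<And>e. e \<in> Basis \<Longrightarrow> norm (F e) \<le> c e"
  shows "norm (\<Sum>e\<in>Basis. (v \<bullet> e) *\<^sub>R F e) \<le> (\<Sum>e\<in>Basis. c e) * norm v"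
proof -
  have "norm (\<Sum>e\<in>Basis. (v \<bullet> e) *\<^sub>R F e) \<le> (\<Sum>e\<in>Basis. c e * norm v)"
  proof (rule sum_norm_le)
    fix e :: 'a assume e: "e \<in> Basis"
    have "\<bar>v \<bullet> e\<bar> * norm (F e) \<le> norm v * c e"
      using e assms[OF e] Basis_le_norm[OF e] by (intro mult_mono) auto
    then show "norm ((v \<bullet> e) *\<^sub>R F e) \<le> c e * norm v" by (simp add: mult.commute)
  qed
  then show ?thesis by (simp add: sum_distrib_right)
qed

lemma norm_dir_deriv_le:
  assumes "C_k_closure (Suc k) S f" "Q \<subseteq> S" "bounded Q" "y \<in> Q"
  shows "norm (dir_deriv v f y) \<le> C_k_norm (Suc k) Q f * norm v"
proof -
  have "f differentiable (at y)" using assms by auto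
  moreover have "norm (\<Sum>e\<in>Basis. (v \<bullet> e) *\<^sub>R dir_deriv e f y) \<le> (\<Sum>e\<in>Basis. C_k_norm k Q (dir_deriv e f)) * norm v"
    using assms by (intro norm_sum_Basis_le norm_le_C_k_norm[of k S]) auto
  moreover have "(\<Sum>e\<in>Basis. C_k_norm k Q (dir_deriv e f)) * norm v \<le> C_k_norm (Suc k) Q f * norm v"
    using C_k_norm_Suc_ge[OF assms] by (rule mult_right_mono) simp
  ultimately show ?thesis by (simp only: dir_deriv_basis[of f y v])
qed

lemma norm_second_deriv_le:
  assumes "C_k_closure 2 S f" "Q \<subseteq> S" "bounded Q" "y \<in> Q"
  shows "norm (second_deriv f y v w) \<le> C_k_norm 2 Q f * norm v * norm w"
proof -
  have f: "C_k_closure (Suc (Suc 0)) S f" using assms(1) by (simp only: numeral_2_eq_2)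
  have "norm (second_deriv f y v w) \<le> (\<Sum>e\<in>Basis. C_k_norm (Suc 0) Q (dir_deriv e f) * norm v) * norm w"
    unfolding second_deriv_def
    using f by (intro norm_sum_Basis_le norm_dir_deriv_le[OF _ assms(2-4)]) auto
  also have "\<dots> = (\<Sum>e\<in>Basis. C_k_norm (Suc 0) Q (dir_deriv e f)) * (norm v * norm w)"
    by (simp only: sum_distrib_right mult.assoc)
  also have "\<dots> \<le> C_k_norm (Suc (Suc 0)) Q f * (norm v * norm w)"
    by (rule mult_right_mono[OF C_k_norm_Suc_ge[OF f assms(2-4)]]) simp
  finally show ?thesis by (simp only: numeral_2_eq_2 mult.assoc)
qed

lemma lip_quotients_bdd_above:
  fixes f :: "'a::euclidean_space \<Rightarrow> 'b::real_normed_vector"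
  assumes "L-lipschitz_on Q f"
  shows "bdd_above ((\<lambda>(x, y). norm (f x - f y) / norm (x - y)) ` (Q \<times> Q))"
proof (rule bdd_aboveI2)
  fix p assume "p \<in> Q \<times> Q"
  then obtain x y where p: "p = (x, y)" "x \<in> Q" "y \<in> Q" by blast
  have "norm (f x - f y) / norm (x - y) \<le> L"
  proof (cases "x = y")
    case True
    then show ?thesis using lipschitz_on_nonneg[OF assms] by simp
  next
    case False
    then have "0 < norm (x - y)" by simp
    then show ?thesis using lipschitz_onD[OF assms p(2,3)] by (simp only: pos_divide_le_eq dist_norm)
  qed
  then show "(\<lambda>(x, y). norm (f x - f y) / norm (x - y)) p \<le> L" by (simp only: p(1) prod.case)
qed

lemma lip_quotient_le_seminorm:
  fixes f :: "'a::euclidean_space \<Rightarrow> 'b::real_normed_vector"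
  assumes "L-lipschitz_on Q f" "x \<in> Q" "y \<in> Q"
  shows "norm (f x - f y) / norm (x - y) \<le> lip_seminorm Q f"
proof -
  have "(x, y) \<in> Q \<times> Q" using assms by blast
  from cSUP_upper[OF this lip_quotients_bdd_above[OF assms(1)]]
  show ?thesis by (simp only: lip_seminorm_def prod.case)
qed

lemma lip_seminorm_bound:
  fixes f :: "'a::euclidean_space \<Rightarrow> 'b::real_normed_vector"
  assumes "L-lipschitz_on Q f" "x \<in> Q" "y \<in> Q"
  shows "norm (f x - f y) \<le> lip_seminorm Q f * norm (x - y)"
proof (cases "x = y")
  case False
  then have "0 < norm (x - y)" by simp
  then show ?thesis using lip_quotient_le_seminorm[OF assms] by (simp only: pos_divide_le_eq)
qed simp

lemma lip_seminorm_nonneg: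
  fixes f :: "'a::euclidean_space \<Rightarrow> 'b::real_normed_vector"
  assumes "L-lipschitz_on Q f" "x \<in> Q"
  shows "0 \<le> lip_seminorm Q f"
  using lip_quotient_le_seminorm[OF assms(1,2,2)] by simp

lemma C_11_closure_lipschitz:
  assumes "C_11_closure S f" "Q \<subseteq> S" "bounded Q" "e \<in> Basis"
  obtains L where "L-lipschitz_on Q (dir_deriv e f)"
proof -
  obtain R where R: "Q \<subseteq> cball 0 R"
    using bounded_subset_ballD[OF assms(3), of 0] ball_subset_cball by blast
  obtain L where "L-lipschitz_on (S \<inter> cball 0 R) (dir_deriv e f)"
    using assms(1,4) unfolding C_11_closure_def by blast
  then have "L-lipschitz_on Q (dir_deriv e f)"
    by (rule lipschitz_on_subset) (use assms(2) R in auto)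
  then show ?thesis by (rule that)
qed

lemma C_11_norm_bounds:
  fixes f :: "'a::euclidean_space \<Rightarrow> 'b::real_normed_vector"
  assumes f: "C_11_closure S f" and Q: "Q \<subseteq> S" "bounded Q" "y \<in> Q"
  shows "norm (f y) \<le> C_11_norm Q f"
    "norm (dir_deriv v f y) \<le> C_11_norm Q f * norm v"
    "z \<in> Q \<Longrightarrow> norm (dir_deriv v f z - dir_deriv v f y) \<le> C_11_norm Q f * norm v * norm (z - y)"
proof -
  have f1: "C_k_closure (Suc 0) S f" using f by (simp add: C_11_closure_def)
  have lip0: "0 \<le> lip_seminorm Q (dir_deriv e f)" if "e \<in> Basis" for e
    by (rule C_11_closure_lipschitz[OF f Q(1,2) that]) (rule lip_seminorm_nonneg[OF _ Q(3)])
  then have s0: "0 \<le> (\<Sum>e\<in>Basis. lip_seminorm Q (dir_deriv e f))" by (intro sum_nonneg)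
  have N1: "C_k_norm (Suc 0) Q f \<le> C_11_norm Q f"
    using s0 by (simp add: C_11_norm_def)
  have N2: "(\<Sum>e\<in>Basis. lip_seminorm Q (dir_deriv e f)) \<le> C_11_norm Q f"
    using C_k_norm_nonneg[OF f1 Q] by (simp add: C_11_norm_def)
  show "norm (f y) \<le> C_11_norm Q f" using norm_le_C_k_norm[OF f1 Q] N1 by linarith
  show "norm (dir_deriv v f y) \<le> C_11_norm Q f * norm v"
    using norm_dir_deriv_le[OF f1 Q, of v] mult_right_mono[OF N1 norm_ge_zero[of v]] by linarith
  assume z: "z \<in> Q"
  have d: "f differentiable (at y)" "f differentiable (at z)" using f1 Q z by auto
  have "dir_deriv v f z - dir_deriv v f y = (\<Sum>e\<in>Basis. (v \<bullet> e) *\<^sub>R (dir_deriv e f z - dir_deriv e f y))"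
    by (simp add: dir_deriv_basis[OF d(1), of v] dir_deriv_basis[OF d(2), of v] sum_subtractf scaleR_diff_right)
  also have "norm \<dots> \<le> (\<Sum>e\<in>Basis. lip_seminorm Q (dir_deriv e f) * norm (z - y)) * norm v"
  proof (rule norm_sum_Basis_le)
    fix e :: 'a assume "e \<in> Basis"
    from C_11_closure_lipschitz[OF f Q(1,2) this] obtain L where "L-lipschitz_on Q (dir_deriv e f)" .
    from lip_seminorm_bound[OF this z Q(3)]
    show "norm (dir_deriv e f z - dir_deriv e f y) \<le> lip_seminorm Q (dir_deriv e f) * norm (z - y)" .
  qed
  also have "\<dots> = (\<Sum>e\<in>Basis. lip_seminorm Q (dir_deriv e f)) * (norm v * norm (z - y))"
    by (simp only: sum_distrib_right[symmetric] mult.assoc mult.commute[of "norm v"])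
  also have "\<dots> \<le> C_11_norm Q f * (norm v * norm (z - y))"
    by (rule mult_right_mono[OF N2]) simp
  finally show "norm (dir_deriv v f z - dir_deriv v f y) \<le> C_11_norm Q f * norm v * norm (z - y)"
    by (simp only: mult.assoc)
qed

text \<open>A \<open>C_11_closure\<close> function need not have second derivatives, so the chain rule cannot be applied
  twice to its composition with a curve. This one-sided expansion with a smooth lower bound that
  touches \<open>f\<close> at \<open>y\<close> takes its place.\<close>

lemma C_11_lower_taylor:
  fixes f :: "'a::euclidean_space \<Rightarrow> real"
  assumes f: "C_11_closure S f" and Q: "Q \<subseteq> S" "bounded Q"
    and seg: "closed_segment y z \<subseteq> Q"
  shows "f y + dir_deriv (z - y) f y - C_11_norm Q f * (norm (z - y))\<^sup>2 \<le> f z"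
proof -
  define w where "w = z - y"
  have in_seg: "y + t *\<^sub>R w \<in> Q" if "0 \<le> t" "t \<le> 1" for t
  proof -
    have "y + t *\<^sub>R w = (1 - t) *\<^sub>R y + t *\<^sub>R z" by (simp add: w_def algebra_simps)
    then have "y + t *\<^sub>R w \<in> closed_segment y z" using that by (auto simp: in_segment)
    then show ?thesis using seg by blast
  qed
  have y: "y \<in> Q" using in_seg[of 0] by simp
  have "((\<lambda>t. f (y + t *\<^sub>R w)) has_real_derivative dir_deriv w f (y + t *\<^sub>R w)) (at t)"
    if "0 \<le> t" "t \<le> 1" for t
    unfolding has_real_derivative_iff_has_vector_derivative
  proof (rule has_vector_derivative_along_curve)
    show "f differentiable (at (y + t *\<^sub>R w))"
      using f in_seg[OF that] Q(1) by (auto simp: C_11_closure_def)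
    show "((\<lambda>t. y + t *\<^sub>R w) has_vector_derivative w) (at t)" by (auto intro!: derivative_eq_intros)
  qed
  from MVT2[OF zero_less_one this] obtain t where t: "0 < t" "t < 1"
    "f (y + w) - f y = dir_deriv w f (y + t *\<^sub>R w)" by auto
  have N: "0 \<le> C_11_norm Q f" using C_11_norm_bounds(1)[OF f Q y] norm_ge_zero order_trans by blast
  have "norm (dir_deriv w f (y + t *\<^sub>R w) - dir_deriv w f y) \<le> C_11_norm Q f * norm w * norm ((y + t *\<^sub>R w) - y)"
    using C_11_norm_bounds(3)[OF f Q y in_seg] t by auto
  also have "\<dots> \<le> C_11_norm Q f * norm w * norm w"
    using t N by (intro mult_left_mono) (auto intro: mult_left_le_one_le)
  finally have "dir_deriv w f y - C_11_norm Q f * (norm w)\<^sup>2 \<le> dir_deriv w f (y + t *\<^sub>R w)"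
    by (simp add: power2_eq_square)
  then show ?thesis using t(3) by (simp add: w_def)
qed

section \<open>The inequality at a maximum point\<close>

text \<open>This is where the exponent \<open>1 / (n - 1)\<close> of the right-hand side comes from. Some \<open>lam i\<close> with
  \<open>i \<noteq> m\<close> is at most the geometric mean \<open>b / \<rho>\<close> of the eigenvalues other than \<open>lam m\<close>. The resulting
  bound of \<open>1 / b\<close> by a small multiple of the sum of inverses absorbs every error term with \<open>b\<close> in the
  denominator, however small \<open>b\<close> is.\<close>

lemma trace_inverse_lower_bound:
  fixes lam :: "'n::finite \<Rightarrow> real"
  assumes n2: "CARD('n) \<ge> 2" and pos: "\<And>i. 0 < lam i" and b: "0 < b"
    and prod: "(\<Prod>i\<in>UNIV. lam i) = b ^ (CARD('n) - 1)"
    and \<rho>: "0 < \<rho>" "\<rho> ^ (CARD('n) - 1) = lam m"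
  shows "\<rho> / b \<le> (\<Sum>i\<in>UNIV - {m}. 1 / lam i)"
proof -
  have cd: "card (UNIV - {m}) = CARD('n) - 1" by simp
  have "\<exists>i\<in>UNIV - {m}. lam i \<le> b / \<rho>"
  proof (rule ccontr)
    assume "\<not> ?thesis"
    then have gt: "\<And>i. i \<in> UNIV - {m} \<Longrightarrow> b / \<rho> < lam i" by force
    have "card (UNIV - {m}) \<noteq> 0" unfolding cd using n2 by simp
    then have ne: "UNIV - {m} \<noteq> {}" by (metis card.empty)
    have "(\<Prod>i\<in>UNIV - {m}. b / \<rho>) < (\<Prod>i\<in>UNIV - {m}. lam i)"
    proof -
      have p: "0 < b / \<rho>" using b \<rho>(1) by simp
      from ne obtain j where j: "j \<in> UNIV - {m}" by blast
      show ?thesis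
      proof (rule prod_mono_strict[where i = j])
        show "0 \<le> b / \<rho> \<and> b / \<rho> \<le> lam i" if "i \<in> UNIV - {m}" for i
          using gt[OF that] p by (meson less_imp_le)
      qed (use j gt[OF j] pos in auto)
    qed
    then have "lam m * (b / \<rho>) ^ (CARD('n) - 1) < lam m * (\<Prod>i\<in>UNIV - {m}. lam i)"
      using pos[of m] cd by simp
    also have "\<dots> = (\<Prod>i\<in>UNIV. lam i)" by (simp add: prod.remove[of UNIV m])
    also have "\<dots> = lam m * (b / \<rho>) ^ (CARD('n) - 1)"
      using prod \<rho> pos[of m] by (simp add: power_divide)
    finally show False by simp
  qed
  then obtain i where i: "i \<in> UNIV - {m}" "lam i \<le> b / \<rho>" by blast
  have "\<rho> / b \<le> 1 / lam i" using i(2) pos[of i] b \<rho>(1) by (simp add: field_simps)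
  also have "\<dots> \<le> (\<Sum>i\<in>UNIV - {m}. 1 / lam i)"
    by (rule member_le_sum[OF i(1)]) (auto intro: less_imp_le pos)
  finally show ?thesis .
qed

text \<open>Cauchy-Schwarz over the \<open>n - 1\<close> indices other than \<open>m\<close>. The coefficient of \<open>y\<^sup>2\<close> is exactly the one that
  is needed to cancel the negative square in the second derivative of \<open>ln (b ^ (n - 1))\<close>; using all \<open>n\<close>
  indices would give only \<open>(n - 1)\<^sup>2 / n\<close>. The price is the mixed term with \<open>x m\<close>, which is controlled at
  a maximum of the auxiliary function.\<close>

lemma diagonal_sum_of_squares:
  fixes x :: "'n::finite \<Rightarrow> real"
  assumes n2: "CARD('n) \<ge> 2" and s: "(\<Sum>i\<in>UNIV. x i) = (real CARD('n) - 1) * y"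
  shows "(real CARD('n) - 1) * y\<^sup>2 - 2 * y * x m \<le> (\<Sum>i\<in>UNIV. (x i)\<^sup>2)"
proof -
  define k where "k = real CARD('n) - 1"
  have k: "k > 0" using n2 by (simp add: k_def)
  have "(\<Sum>i\<in>UNIV. x i) = x m + (\<Sum>i\<in>UNIV - {m}. x i)" by (simp add: sum.remove[of UNIV m])
  then have s': "(\<Sum>i\<in>UNIV - {m}. x i) = k * y - x m" using s by (simp add: k_def)
  have "0 \<le> (\<Sum>i\<in>UNIV - {m}. (x i - y)\<^sup>2)" by (simp add: sum_nonneg)
  also have "\<dots> = (\<Sum>i\<in>UNIV - {m}. (x i)\<^sup>2) - 2 * y * (\<Sum>i\<in>UNIV - {m}. x i) + (\<Sum>i\<in>UNIV - {m}. y\<^sup>2)"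
    by (simp add: power2_diff sum.distrib sum_subtractf sum_distrib_left mult_ac)
  also have "(\<Sum>i\<in>UNIV - {m}. y\<^sup>2) = k * y\<^sup>2" using n2 by (simp add: k_def)
  finally have "k * y\<^sup>2 - 2 * y * x m \<le> (\<Sum>i\<in>UNIV - {m}. (x i)\<^sup>2)"
    unfolding s' by (simp add: algebra_simps power2_eq_square)
  also have "\<dots> \<le> (\<Sum>i\<in>UNIV. (x i)\<^sup>2)" by (rule sum_mono2) auto
  finally show ?thesis by (simp add: k_def)
qed

text \<open>The bound for \<open>\<eta>\<^sup>2\<close> times the largest eigenvalue: its three terms belong to the cases of an
  eigenvalue below \<open>1\<close>, one that is controlled by the cut-off function, and one that is controlled by its
  power \<open>1 / (n - 1)\<close>.\<close>

definition eigenvalue_bound :: "nat \<Rightarrow> real \<Rightarrow> real \<Rightarrow> real" where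
  "eigenvalue_bound n K c = K ^ 4 + 944 * K ^ 9 / c + K ^ 4 * (16 * K ^ 5 / c) ^ (n - 1)"

text \<open>The arithmetic of the maximum principle. At the maximum point, with an eigenframe \<open>E\<close> of
  \<open>W = D\<^sup>2u - A\<close> and the eigenvalues \<open>lam\<close>, the letters stand for

  \<^item> \<open>X k i\<close> and \<open>Y k i\<close>: first and second derivatives in direction \<open>E k\<close> of the entry \<open>W\<^bsub>ii\<^esub>\<close>;
  \<^item> \<open>T i k\<close>: the third derivative \<open>u\<^bsub>iik\<^esub>\<close>, and \<open>uu k\<close>: the second derivative \<open>u\<^bsub>kk\<^esub>\<close>;
  \<^item> \<open>A1 k i\<close>, \<open>A2 k i\<close>, \<open>A3 k i\<close>: the terms that the chain rule produces from \<open>A\<^bsub>ii\<^esub>(x, u, Du)\<close>, namely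
    the first derivative of \<open>A\<close> on the first derivative of \<open>(x, u, Du)\<close>, the second derivative of \<open>A\<close> on
    that derivative, and the first derivative of \<open>A\<close> on the second derivative of \<open>(x, u, Du)\<close>;
  \<^item> \<open>B1\<close>, \<open>B2\<close>: the corresponding terms for \<open>b\<close>, and \<open>J\<close>: the size of the derivative of \<open>(x, u, Du)\<close> in
    direction \<open>E m\<close>.

  Hypotheses \<open>F1\<close> and \<open>F2\<close> say that \<open>\<eta>\<^sup>2 W\<^bsub>mm\<^esub>\<close> is maximal, \<open>F3\<close> and \<open>F4\<close> are the once and twice
  differentiated equation, and \<open>Q\<close> expresses that fourth derivatives of \<open>u\<close> commute. Strict
  regularity enters only through \<open>A2m\<close>. Summing \<open>F2\<close> over \<open>k\<close> with the weights \<open>1 / lam k\<close>, exchanging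
  the order of differentiation by \<open>Q\<close> and inserting \<open>F4\<close> leaves the good term \<open>c0 * (lam m)\<^sup>2 * \<tau>\<close>,
  where \<open>\<tau>\<close> is the sum of the inverses of the other eigenvalues, against error terms of the sizes
  \<open>lam m * \<tau> / \<eta>\<^sup>2\<close> and \<open>(lam m)\<^sup>2 / b\<close>. The lower bound for \<open>\<tau>\<close> makes both of them small relative to the
  good term unless \<open>\<eta>\<^sup>2 * lam m\<close> is bounded.\<close>

lemma pointwise_estimate:
  fixes lam etak B1 uu :: "'n::finite \<Rightarrow> real" and X Y A1 A2 A3 T :: "'n \<Rightarrow> 'n \<Rightarrow> real"
  assumes n2: "CARD('n) \<ge> 2" and K: "1 \<le> K" "real CARD('n) \<le> K" and c0: "0 < c0"
    and lam: "\<And>i. 0 < lam i" "\<And>i. lam i \<le> lam m"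
    and b: "0 < b" "b \<le> K"
    and prod: "(\<Prod>i\<in>UNIV. lam i) = b ^ (CARD('n) - 1)"
    and eta: "0 < \<eta>" "\<eta> \<le> K\<^sup>2" "\<And>k. \<bar>etak k\<bar> \<le> 2 * K"
    and F1: "\<And>k. X k m / lam m + 2 * (etak k / \<eta>) = 0"
    and F2: "\<And>k. Y k m / lam m - (X k m / lam m)\<^sup>2 + 2 * ((-2) / \<eta> - (etak k / \<eta>)\<^sup>2) \<le> 0"
    and F3: "\<And>k. (\<Sum>i\<in>UNIV. X k i / lam i) = (real CARD('n) - 1) * (B1 k / b)"
    and F4: "(real CARD('n) - 1) * ((B2 - 2 * K * J\<^sup>2) / b - (B1 m / b)\<^sup>2)
       \<le> (\<Sum>i\<in>UNIV. Y m i / lam i - (X m i / lam i)\<^sup>2)"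
    and T: "\<And>i k. T i k = X k i + A1 k i"
    and Q: "\<And>i k. Y k i + A2 k i + A3 k i = Y i k + A2 i k + A3 i k"
    and J: "0 \<le> J" "J \<le> K + lam m"
    and A1: "\<And>i k. \<bar>A1 k i\<bar> \<le> K * (K + lam k)"
    and B1: "\<And>k. \<bar>B1 k\<bar> \<le> K * (K + lam k)"
    and uu: "\<And>k. \<bar>uu k\<bar> \<le> lam k + K"
    and A3m: "\<And>i. \<bar>A3 m i\<bar> \<le> K * (\<bar>uu m\<bar> + (\<Sum>k\<in>UNIV. \<bar>T m k\<bar>))"
    and B2: "\<bar>B2\<bar> \<le> K * (\<bar>uu m\<bar> + (\<Sum>k\<in>UNIV. \<bar>T m k\<bar>))"
    and A3: "\<bar>\<Sum>k\<in>UNIV. A3 k m / lam k\<bar> \<le>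
       K * (\<bar>\<Sum>k\<in>UNIV. uu k / lam k\<bar> + (\<Sum>j\<in>UNIV. \<bar>\<Sum>k\<in>UNIV. T k j / lam k\<bar>))"
    and A2: "\<And>i k. \<bar>A2 k i\<bar> \<le> K * (K + lam k)\<^sup>2"
    and A2m: "\<And>i. i \<noteq> m \<Longrightarrow> c0 * (lam m)\<^sup>2 - K * (2 * K * lam m + K\<^sup>2) \<le> A2 m i"
  shows "\<eta>\<^sup>2 * lam m \<le> eigenvalue_bound CARD('n) K c0"
proof (cases "lam m \<ge> 1")
  case False
  have "\<eta>\<^sup>2 * lam m \<le> (K\<^sup>2)\<^sup>2 * 1"
    using False eta lam(1)[of m] by (intro mult_mono power_mono) auto
  also have "\<dots> = K ^ 4" by simp
  also have "\<dots> \<le> K ^ 4 + 944 * K ^ 9 / c0 + K ^ 4 * (16 * K ^ 5 / c0) ^ (CARD('n) - 1)"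
    using K(1) c0 by simp
  finally show ?thesis by (simp only: eigenvalue_bound_def)
next
  case True
  define l where "l = lam m"
  define s where "s = 1 + 1 / \<eta>"
  define n1 where "n1 = real CARD('n) - 1"
  define \<tau> where "\<tau> = (\<Sum>i\<in>UNIV - {m}. 1 / lam i)"
  define TT where "TT = (\<Sum>i\<in>UNIV. 1 / lam i)"
  define \<rho> where "\<rho> = root (CARD('n) - 1) l"
  have n1: "0 < n1" "n1 \<le> K" using n2 K by (auto simp: n1_def)
  have l1: "1 \<le> l" using True by (simp add: l_def)
  have s1: "1 \<le> s" "1 / \<eta> \<le> s" using eta by (auto simp: s_def)
  have \<rho>: "1 \<le> \<rho>" "\<rho> ^ (CARD('n) - 1) = l"
    using n2 l1 by (auto simp: \<rho>_def)
  have TTs: "TT = 1 / l + \<tau>" by (simp add: TT_def \<tau>_def l_def sum.remove[of UNIV m])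
  have \<tau>b: "\<rho> / b \<le> \<tau>"
    unfolding \<tau>_def using trace_inverse_lower_bound[OF n2 lam(1) b(1) prod, of \<rho> m] \<rho> by (simp add: l_def)
  have b1: "1 / b \<le> \<tau> / \<rho>" using \<tau>b b \<rho>(1) by (simp add: field_simps)
  have \<tau>0: "0 < \<tau>" using \<tau>b b \<rho>(1) by (meson divide_pos_pos less_le_trans zero_less_one)
  have K\<tau>: "1 \<le> K * \<tau>"
  proof -
    have "1 \<le> \<rho>" by fact
    also have "\<rho> \<le> \<tau> * b" using \<tau>b b by (simp add: field_simps)
    also have "\<dots> \<le> \<tau> * K" using b \<tau>0 by simp
    finally show ?thesis by (simp add: mult.commute)
  qed
  have TT0: "0 < TT" using TTs \<tau>0 l1 by (simp add: add_pos_pos)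
  have TTK: "TT \<le> 2 * K * \<tau>"
  proof -
    have "1 / l \<le> 1" using l1 by simp
    moreover have "1 * \<tau> \<le> K * \<tau>" using K \<tau>0 by (intro mult_right_mono) auto
    ultimately show ?thesis using TTs K\<tau> by linarith
  qed
  have Kl: "K \<le> K * l" "l \<le> K * l" using K l1 by (auto simp: mult_le_cancel_left1 mult_le_cancel_right1)
  have Klk: "K + lam k \<le> 2 * (K * l)" for k using lam(2)[of k] Kl by (simp add: l_def)
  have lam': "\<And>k. 0 \<le> lam k" using lam(1) less_imp_le by blast
  have A1': "\<bar>A1 k i\<bar> \<le> 2 * K^2 * l" for i k
  proof -
    have "\<bar>A1 k i\<bar> \<le> K * (K + lam k)" by (rule A1)
    also have "\<dots> \<le> K * (2 * (K * l))" using Klk K by (intro mult_left_mono) auto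
    finally show ?thesis by (simp add: power2_eq_square)
  qed
  have B1': "\<bar>B1 k\<bar> \<le> 2 * K^2 * l" for k
  proof -
    have "\<bar>B1 k\<bar> \<le> K * (K + lam k)" by (rule B1)
    also have "\<dots> \<le> K * (2 * (K * l))" using Klk K by (intro mult_left_mono) auto
    finally show ?thesis by (simp add: power2_eq_square)
  qed
  have xs: "\<bar>etak k / \<eta>\<bar> \<le> 2 * K * s" for k
  proof -
    have "\<bar>etak k / \<eta>\<bar> = \<bar>etak k\<bar> * (1 / \<eta>)" using eta(1) by simp
    also have "\<dots> \<le> 2 * K * s" using eta K s1 by (intro mult_mono) auto
    finally show ?thesis .
  qed
  have Xm: "X k m / l = - 2 * (etak k / \<eta>)" for k using F1[of k] by (simp add: l_def)
  have Xm': "X k m = - 2 * (etak k / \<eta>) * l" for k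
    using Xm[of k] l1 by (simp add: field_simps)
  have XmB: "\<bar>X k m\<bar> \<le> 4 * K * l * s" for k
  proof -
    have "\<bar>X k m\<bar> = \<bar>etak k / \<eta>\<bar> * (2 * l)" unfolding Xm' using l1 by (simp add: abs_mult)
    also have "\<dots> \<le> 2 * K * s * (2 * l)" using xs[of k] l1 by (intro mult_right_mono) auto
    finally show ?thesis by (simp add: mult_ac)
  qed
  have ls: "l \<le> l * s" "1 \<le> l * s" using s1 l1 mult_mono[of 1 l 1 s] by (auto simp: mult_le_cancel_left1)
  have TmB: "\<bar>T m k\<bar> \<le> 6 * K^2 * (l * s)" for k
  proof -
    have "\<bar>T m k\<bar> \<le> 4 * K * l * s + 2 * K^2 * l" using XmB[of k] A1'[of k m] T[of m k] by linarith
    moreover have "4 * K * (l * s) \<le> 4 * K^2 * (l * s)"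
      using K ls by (intro mult_right_mono) (auto simp: power2_eq_square)
    moreover have "2 * K^2 * l \<le> 2 * K^2 * (l * s)" using ls by (intro mult_left_mono) auto
    ultimately show ?thesis by (simp add: mult.assoc)
  qed
  have J2: "\<bar>uu m\<bar> + (\<Sum>k\<in>UNIV. \<bar>T m k\<bar>) \<le> 8 * K^3 * (l * s)"
  proof -
    have "(\<Sum>k\<in>UNIV. \<bar>T m k\<bar>) \<le> real CARD('n) * (6 * K^2 * (l * s))"
      using sum_bounded_above[of UNIV "\<lambda>k. \<bar>T m k\<bar>" "6 * K^2 * (l * s)"] TmB by simp
    also have "\<dots> \<le> K * (6 * K^2 * (l * s))" using K ls by (intro mult_right_mono) auto
    finally have 1: "(\<Sum>k\<in>UNIV. \<bar>T m k\<bar>) \<le> 6 * K^3 * (l * s)"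
      by (simp add: power2_eq_square power3_eq_cube mult_ac)
    have "\<bar>uu m\<bar> \<le> 2 * (K * l)" using uu[of m] Klk[of m] by simp
    also have "\<dots> \<le> 2 * (K^3 * (l * s))"
      using K ls l1 self_le_power[of K 3] by (intro mult_left_mono mult_mono) auto
    finally show ?thesis using 1 by simp
  qed
  have J2K: "K * (\<bar>uu m\<bar> + (\<Sum>k\<in>UNIV. \<bar>T m k\<bar>)) \<le> 8 * K^4 * (l * s)"
    using mult_left_mono[OF J2, of K] K by (simp add: power_numeral_reduce mult_ac)
  note A3m' = order_trans[OF A3m J2K]
  note B2' = order_trans[OF B2 J2K]
  have J2': "J\<^sup>2 \<le> 4 * K^2 * l^2"
  proof -
    have "J\<^sup>2 \<le> (2 * (K * l))\<^sup>2" using J Klk[of m] by (intro power_mono) (auto simp: l_def)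
    then show ?thesis by (simp add: power_mult_distrib)
  qed
  define S where "S = (\<Sum>k\<in>UNIV. Y k m / lam k)"
  \<comment> \<open>The maximum conditions bound the weighted trace of the second derivatives of \<open>W\<^bsub>mm\<^esub>\<close> from above. The
    rest of the proof bounds it from below; the constant is \<open>28 = 6 * 4 + 4\<close>.\<close>
  have i: "S \<le> 28 * K^2 * s^2 * l * TT"
  proof -
    have "Y k m / lam k \<le> 28 * K^2 * s^2 * l * (1 / lam k)" for k
    proof -
      have "Y k m / l \<le> 6 * (etak k / \<eta>)\<^sup>2 + 4 * (1 / \<eta>)"
      proof -
        have "(X k m / l)\<^sup>2 = 4 * (etak k / \<eta>)\<^sup>2"
          unfolding Xm by (simp only: power_mult_distrib) simp
        moreover have "2 * ((-2) / \<eta> - (etak k / \<eta>)\<^sup>2) = - 4 * (1 / \<eta>) - 2 * (etak k / \<eta>)\<^sup>2"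
          by simp
        ultimately show ?thesis using F2[of k] unfolding l_def by linarith
      qed
      also have "\<dots> \<le> 6 * (2 * K * s)\<^sup>2 + 4 * (K^2 * s^2)"
      proof (intro add_mono mult_left_mono)
        show "(etak k / \<eta>)\<^sup>2 \<le> (2 * K * s)\<^sup>2"
          using power_mono[OF xs[of k], of 2] by (simp only: abs_ge_zero power2_abs)
        have "1 / \<eta> \<le> 1 * s" using s1 by simp
        also have "\<dots> \<le> K^2 * s^2" using K s1 by (intro mult_mono) (auto simp: self_le_power one_le_power)
        finally show "1 / \<eta> \<le> K^2 * s^2" .
      qed auto
      also have "\<dots> = 28 * K^2 * s^2" by (simp add: power_mult_distrib)
      finally have "Y k m \<le> 28 * K^2 * s^2 * l" using l1 by (simp add: divide_le_eq)
      then show ?thesis using lam(1)[of k] by (simp add: divide_right_mono less_imp_le)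
    qed
    then show ?thesis unfolding S_def TT_def sum_distrib_left by (intro sum_mono)
  qed
  \<comment> \<open>The twice differentiated equation. The negative square of \<open>B1 m / b\<close> cancels, and the mixed term
    is linear in \<open>1 / b\<close> thanks to \<open>F1\<close>.\<close>
  have ii: "- ((24 * K^5 * (l * s) + 8 * K^4 * l^2) / b) \<le> (\<Sum>k\<in>UNIV. Y m k / lam k)"
  proof -
    define y where "y = B1 m / b"
    have "n1 * y\<^sup>2 - 2 * y * (X m m / lam m) \<le> (\<Sum>i\<in>UNIV. (X m i / lam i)\<^sup>2)"
      unfolding n1_def by (rule diagonal_sum_of_squares[OF n2]) (simp add: F3 y_def)
    then have "n1 * ((B2 - 2 * K * J\<^sup>2) / b) - 2 * y * (X m m / lam m) \<le> (\<Sum>k\<in>UNIV. Y m k / lam k)"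
      using F4 by (simp add: sum_subtractf n1_def[symmetric] y_def[symmetric] algebra_simps)
    moreover have "n1 * ((B2 - 2 * K * J\<^sup>2) / b) \<ge> - ((8 * K^5 * (l * s) + 8 * K^4 * l^2) / b)"
    proof -
      have "\<bar>B2 - 2 * K * J\<^sup>2\<bar> \<le> 8 * K^4 * (l * s) + 2 * K * (4 * K^2 * l^2)"
      proof -
        have "2 * K * J\<^sup>2 \<le> 2 * K * (4 * K^2 * l^2)" using J2' K by (intro mult_left_mono) auto
        moreover have "0 \<le> 2 * K * J\<^sup>2" using K by simp
        ultimately show ?thesis using B2' by linarith
      qed
      then have "\<bar>n1 * (B2 - 2 * K * J\<^sup>2)\<bar> \<le> K * (8 * K^4 * (l * s) + 2 * K * (4 * K^2 * l^2))"
        unfolding abs_mult using n1 by (intro mult_mono) auto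
      also have "\<dots> = 8 * K^5 * (l * s) + 8 * K^4 * l^2"
        by (simp add: algebra_simps power_numeral_reduce)
      finally have "- (8 * K^5 * (l * s) + 8 * K^4 * l^2) \<le> n1 * (B2 - 2 * K * J\<^sup>2)" by linarith
      then have "- (8 * K^5 * (l * s) + 8 * K^4 * l^2) / b \<le> n1 * (B2 - 2 * K * J\<^sup>2) / b"
        using b by (intro divide_right_mono) auto
      then show ?thesis by (simp only: minus_divide_left times_divide_eq_right)
    qed
    moreover have "2 * y * (X m m / lam m) \<le> 16 * K^5 * (l * s) / b"
    proof -
      have "2 * y * (X m m / lam m) \<le> \<bar>2 * y\<bar> * \<bar>X m m / l\<bar>"
        using abs_ge_self[of "2 * y * (X m m / lam m)"] by (simp only: abs_mult l_def)
      also have "\<dots> \<le> (2 * (2 * K^2 * l / b)) * (4 * K * s)"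
      proof (intro mult_mono)
        show "\<bar>2 * y\<bar> \<le> 2 * (2 * K^2 * l / b)"
          using divide_right_mono[OF B1'[of m], of b] b by (simp add: y_def abs_mult)
        show "\<bar>X m m / l\<bar> \<le> 4 * K * s" using xs[of m] unfolding Xm by (simp only: abs_mult)
      qed (use b K l1 in auto)
      also have "\<dots> = 16 * K^3 * (l * s) / b" by (simp add: power_numeral_reduce)
      also have "\<dots> \<le> 16 * K^5 * (l * s) / b"
        using b K ls by (intro divide_right_mono mult_right_mono mult_left_mono power_increasing) auto
      finally show ?thesis .
    qed
    moreover have "(24 * K^5 * (l * s) + 8 * K^4 * l^2) / b =
        (8 * K^5 * (l * s) + 8 * K^4 * l^2) / b + 16 * K^5 * (l * s) / b"
      by (simp add: add_divide_distrib[symmetric])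
    ultimately show ?thesis by linarith
  qed
  \<comment> \<open>The good term. Strict regularity says nothing about the index \<open>m\<close>, but there the weight
    \<open>1 / lam m\<close> makes the contribution linear in \<open>l\<close>.\<close>
  have iii: "c0 * l^2 * \<tau> - 3 * K^3 * l * \<tau> - 4 * K^3 * l \<le> (\<Sum>k\<in>UNIV. A2 m k / lam k)"
  proof -
    have "(c0 * l^2 - 3 * K^3 * l) * (1 / lam k) \<le> A2 m k / lam k" if "k \<noteq> m" for k
    proof -
      have "K * (2 * K * l + K\<^sup>2) \<le> 3 * K^3 * l"
      proof -
        have "K^2 \<le> K^3" using K by (intro power_increasing) auto
        then have "2 * K^2 * l \<le> 2 * K^3 * l" using l1 by (intro mult_right_mono) auto
        moreover have "K^3 * 1 \<le> K^3 * l" using l1 K by (intro mult_left_mono) auto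
        ultimately show ?thesis by (simp add: algebra_simps power_numeral_reduce)
      qed
      then have "c0 * l^2 - 3 * K^3 * l \<le> A2 m k" using A2m[OF that] by (simp add: l_def)
      then show ?thesis using divide_right_mono[OF _ lam'[of k]] by simp
    qed
    then have "(c0 * l^2 - 3 * K^3 * l) * \<tau> \<le> (\<Sum>k\<in>UNIV - {m}. A2 m k / lam k)"
      unfolding \<tau>_def sum_distrib_left by (intro sum_mono) auto
    moreover have "- (4 * K^3 * l) \<le> A2 m m / l"
    proof -
      have "\<bar>A2 m m\<bar> \<le> K * (2 * (K * l))\<^sup>2"
      proof (rule order_trans[OF A2[of m m]])
        show "K * (K + lam m)\<^sup>2 \<le> K * (2 * (K * l))\<^sup>2"
          using Klk[of m] K lam'[of m] by (intro mult_left_mono power_mono) auto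
      qed
      then have "- (4 * K^3 * l * l) \<le> A2 m m"
        by (simp add: power_mult_distrib power_numeral_reduce mult_ac abs_le_iff)
      then show ?thesis using l1 by (simp add: le_divide_eq)
    qed
    ultimately show ?thesis by (simp add: sum.remove[of UNIV m] l_def[symmetric] algebra_simps)
  qed
  have iv: "- (8 * K^4 * (l * s) * TT) \<le> (\<Sum>k\<in>UNIV. A3 m k / lam k)"
  proof -
    have "- (8 * K^4 * (l * s)) * (1 / lam k) \<le> A3 m k / lam k" for k
    proof -
      have "- (8 * K^4 * (l * s)) \<le> A3 m k" using A3m'[of k] by linarith
      from divide_right_mono[OF this lam'[of k]] show ?thesis by simp
    qed
    then have "- (8 * K^4 * (l * s)) * TT \<le> (\<Sum>k\<in>UNIV. A3 m k / lam k)"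
      unfolding TT_def sum_distrib_left by (intro sum_mono)
    then show ?thesis by simp
  qed
  \<comment> \<open>Here the derivative of the jet in direction \<open>E k\<close> is of size \<open>lam k\<close>, so one of the two factors is
    cancelled by the weight.\<close>
  have v: "(\<Sum>k\<in>UNIV. A2 k m / lam k) \<le> 2 * K^3 * TT + 2 * K^2 * l"
  proof -
    have "A2 k m / lam k \<le> 2 * K^3 * (1 / lam k) + 2 * K * lam k" for k
    proof -
      have "(K + lam k)\<^sup>2 \<le> 2 * (K^2 + (lam k)^2)"
        using zero_le_power2[of "K - lam k"] by (simp add: power2_eq_square algebra_simps)
      then have "K * (K + lam k)\<^sup>2 \<le> K * (2 * (K^2 + (lam k)^2))" using K by (intro mult_left_mono) auto
      then have "A2 k m \<le> K * (2 * (K^2 + (lam k)^2))" using A2[of k m] by linarith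
      from divide_right_mono[OF this lam'[of k]] show ?thesis
        using lam(1)[of k] by (simp add: power_numeral_reduce field_simps)
    qed
    then have "(\<Sum>k\<in>UNIV. A2 k m / lam k) \<le> (\<Sum>k\<in>UNIV. 2 * K^3 * (1 / lam k) + 2 * K * lam k)"
      by (rule sum_mono)
    also have "\<dots> = 2 * K^3 * TT + 2 * K * (\<Sum>k\<in>UNIV. lam k)"
      by (simp only: sum.distrib TT_def sum_distrib_left)
    also have "(\<Sum>k\<in>UNIV. lam k) \<le> real CARD('n) * l"
      using sum_bounded_above[of UNIV lam l] lam(2) by (simp add: l_def)
    also have "real CARD('n) * l \<le> K * l" using K l1 by (intro mult_right_mono) auto
    finally show ?thesis using K by (simp add: power2_eq_square mult_left_mono mult.assoc)
  qed
  \<comment> \<open>The weighted sums of third derivatives are known from the once differentiated equation.\<close>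
  have vi: "(\<Sum>k\<in>UNIV. A3 k m / lam k) \<le> K^2 + K^2 * TT + 2 * K^5 * l / b + 2 * K^4 * l * TT"
  proof -
    have u: "\<bar>\<Sum>k\<in>UNIV. uu k / lam k\<bar> \<le> K + K * TT"
    proof -
      have "\<bar>\<Sum>k\<in>UNIV. uu k / lam k\<bar> \<le> (\<Sum>k\<in>UNIV. 1 + K * (1 / lam k))"
      proof (rule order_trans[OF sum_abs sum_mono])
        show "\<bar>uu k / lam k\<bar> \<le> 1 + K * (1 / lam k)" for k
          using uu[of k] lam(1)[of k] by (simp add: field_simps)
      qed
      also have "\<dots> = real CARD('n) + K * TT"
        by (simp only: sum.distrib TT_def sum_distrib_left) simp
      finally show ?thesis using K by simp
    qed
    have t: "\<bar>\<Sum>k\<in>UNIV. T k j / lam k\<bar> \<le> 2 * K^3 * l / b + 2 * K^2 * l * TT" for j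
    proof -
      have eq: "(\<Sum>k\<in>UNIV. T k j / lam k) = n1 * (B1 j / b) + (\<Sum>k\<in>UNIV. A1 j k / lam k)"
        by (simp add: T add_divide_distrib sum.distrib F3 n1_def)
      have "\<bar>n1 * (B1 j / b)\<bar> \<le> K * (2 * K^2 * l / b)"
        unfolding abs_mult using n1 B1'[of j] b by (intro mult_mono) (auto simp: divide_right_mono)
      also have "\<dots> = 2 * K^3 * l / b" by (simp add: power_numeral_reduce)
      finally have 1: "\<bar>n1 * (B1 j / b)\<bar> \<le> 2 * K^3 * l / b" .
      have 2: "\<bar>\<Sum>k\<in>UNIV. A1 j k / lam k\<bar> \<le> 2 * K^2 * l * TT"
        unfolding TT_def sum_distrib_left
      proof (rule order_trans[OF sum_abs sum_mono])
        show "\<bar>A1 j k / lam k\<bar> \<le> 2 * K^2 * l * (1 / lam k)" for k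
          using divide_right_mono[OF A1'[of j k] lam'[of k]] lam(1)[of k] by (simp add: abs_of_pos)
      qed
      show ?thesis unfolding eq by (rule order_trans[OF abs_triangle_ineq add_mono[OF 1 2]])
    qed
    have "(\<Sum>j\<in>UNIV. \<bar>\<Sum>k\<in>UNIV. T k j / lam k\<bar>) \<le> real CARD('n) * (2 * K^3 * l / b + 2 * K^2 * l * TT)"
      using sum_bounded_above[of UNIV "\<lambda>j. \<bar>\<Sum>k\<in>UNIV. T k j / lam k\<bar>"] t by simp
    also have "\<dots> \<le> K * (2 * K^3 * l / b + 2 * K^2 * l * TT)"
      using K l1 b TT0 by (intro mult_right_mono add_nonneg_nonneg) auto
    finally have "\<bar>\<Sum>k\<in>UNIV. uu k / lam k\<bar> + (\<Sum>j\<in>UNIV. \<bar>\<Sum>k\<in>UNIV. T k j / lam k\<bar>) \<le>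
        K + K * TT + K * (2 * K^3 * l / b + 2 * K^2 * l * TT)" using u by linarith
    from mult_left_mono[OF this, of K] A3 K
    have "(\<Sum>k\<in>UNIV. A3 k m / lam k) \<le> K * (K + K * TT + K * (2 * K^3 * l / b + 2 * K^2 * l * TT))"
      by linarith
    then show ?thesis by (simp add: power_numeral_reduce algebra_simps)
  qed
  have Ssum: "S = (\<Sum>k\<in>UNIV. Y m k / lam k) + (\<Sum>k\<in>UNIV. A2 m k / lam k) + (\<Sum>k\<in>UNIV. A3 m k / lam k)
      - (\<Sum>k\<in>UNIV. A2 k m / lam k) - (\<Sum>k\<in>UNIV. A3 k m / lam k)"
  proof -
    have "Y k m = Y m k + A2 m k + A3 m k - A2 k m - A3 k m" for k using Q[where k=k and i=m] by linarith
    then show ?thesis unfolding S_def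
      by (simp add: add_divide_distrib diff_divide_distrib sum.distrib sum_subtractf)
  qed
  have s2: "1 \<le> s^2" "s \<le> s^2" using s1 by (auto simp: self_le_power one_le_power)
  \<comment> \<open>All error terms are now expressed through \<open>\<tau>\<close>: the full trace of inverses is at most
    \<open>2 * K * \<tau>\<close>, a term without \<open>\<tau>\<close> is multiplied by \<open>K * \<tau> \<ge> 1\<close>, and \<open>1 / b\<close> is at most \<open>\<tau> / \<rho>\<close>.\<close>
  have tot: "c0 * l^2 * \<tau> \<le> K^5 * (118 * (l * s^2) + 8 * l^2 / \<rho>) * \<tau>"
  proof -
    define P where "P = l * s^2 * TT"
    have P: "l * s * TT \<le> P" "TT \<le> P" "l * TT \<le> P" "0 \<le> P"
    proof -
      show "l * s * TT \<le> P" unfolding P_def using s2 l1 TT0 by (intro mult_right_mono mult_left_mono) auto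
      have "1 * 1 \<le> l * s^2" using l1 s2 by (intro mult_mono) auto
      then show "TT \<le> P" unfolding P_def using TT0 by (simp add: mult_le_cancel_right1)
      have "l * 1 \<le> l * s^2" using l1 s2 by (intro mult_left_mono) auto
      then show "l * TT \<le> P" unfolding P_def using TT0 by (intro mult_right_mono) auto
      show "0 \<le> P" using l1 TT0 by (simp add: P_def)
    qed
    have Kp: "K^i \<le> K^j" if "i \<le> j" for i j using K that by (intro power_increasing) auto
    have h1: "28 * K^2 * s^2 * l * TT \<le> 28 * (K^4 * P)"
      unfolding P_def using mult_right_mono[OF Kp[of 2 4], of "s^2 * l * TT"] l1 TT0 by (simp add: mult_ac)
    have h2: "8 * K^4 * (l * s) * TT \<le> 8 * (K^4 * P)"
      using mult_left_mono[OF P(1), of "8 * K^4"] by (simp add: mult_ac)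
    have h3: "2 * K^3 * TT \<le> 2 * (K^4 * P)"
      using mult_mono[OF Kp[of 3 4] P(2)] K TT0 by simp
    have h4: "K^2 * TT \<le> K^4 * P"
      using mult_mono[OF Kp[of 2 4] P(2)] K TT0 by simp
    have h5: "2 * K^4 * l * TT \<le> 2 * (K^4 * P)"
      using mult_left_mono[OF P(3), of "2 * K^4"] by (simp add: mult_ac)
    have h6: "4 * K^3 * l + 2 * K^2 * l + K^2 \<le> 7 * (K^3 * l)"
    proof -
      have "K^2 * l \<le> K^3 * l" using Kp[of 2 3] l1 by (intro mult_right_mono) auto
      moreover have "K^2 * 1 \<le> K^2 * l" using l1 by (intro mult_left_mono) auto
      ultimately show ?thesis by linarith
    qed
    have h7: "(24 * K^5 * (l * s) + 8 * K^4 * l^2) / b + 2 * K^5 * l / b \<le> (26 * K^5 * (l * s) + 8 * K^4 * l^2) / b"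
    proof -
      have "2 * K^5 * l \<le> 2 * K^5 * (l * s)" using ls K by (intro mult_left_mono) auto
      then show ?thesis using b by (simp add: add_divide_distrib[symmetric] divide_right_mono)
    qed
    have "c0 * l^2 * \<tau> \<le> 41 * (K^4 * P) + 3 * K^3 * l * \<tau> + 7 * (K^3 * l) + (26 * K^5 * (l * s) + 8 * K^4 * l^2) / b"
      using i ii iii iv v vi Ssum h1 h2 h3 h4 h5 h6 h7 by linarith
    also have "\<dots> \<le> 82 * (K^5 * (l * s^2) * \<tau>) + 3 * (K^5 * (l * s^2) * \<tau>) + 7 * (K^5 * (l * s^2) * \<tau>)
        + (26 * K^5 * (l * s^2) + 8 * K^5 * l^2 / \<rho>) * \<tau>"
    proof (intro add_mono)
      have "K^4 * P \<le> K^4 * (l * s^2 * (2 * K * \<tau>))"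
        unfolding P_def using TTK l1 by (intro mult_left_mono) auto
      then show "41 * (K^4 * P) \<le> 82 * (K^5 * (l * s^2) * \<tau>)" by (simp add: power_numeral_reduce mult_ac)
      have "l * 1 \<le> l * s^2" using l1 s2 by (intro mult_left_mono) auto
      then have ls2: "l \<le> l * s^2" by simp
      have "K^3 * l * \<tau> \<le> K^5 * (l * s^2) * \<tau>"
        using Kp[of 3 5] ls2 l1 \<tau>0 K by (intro mult_right_mono mult_mono) auto
      then show "3 * K^3 * l * \<tau> \<le> 3 * (K^5 * (l * s^2) * \<tau>)" by simp
      have "K^3 * l * 1 \<le> K^3 * l * (K * \<tau>)" using K\<tau> K l1 by (intro mult_left_mono) auto
      also have "\<dots> = K^4 * l * \<tau>" by (simp add: power_numeral_reduce mult_ac)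
      also have "\<dots> \<le> K^5 * (l * s^2) * \<tau>"
        using Kp[of 4 5] ls2 l1 \<tau>0 K by (intro mult_right_mono mult_mono) auto
      finally show "7 * (K^3 * l) \<le> 7 * (K^5 * (l * s^2) * \<tau>)" by simp
      have "(26 * K^5 * (l * s) + 8 * K^4 * l^2) / b = (26 * K^5 * (l * s) + 8 * K^4 * l^2) * (1 / b)" by simp
      also have "\<dots> \<le> (26 * K^5 * (l * s) + 8 * K^4 * l^2) * (\<tau> / \<rho>)"
        using b1 K ls l1 by (intro mult_left_mono) auto
      also have "\<dots> = (26 * K^5 * (l * s) / \<rho> + 8 * K^4 * l^2 / \<rho>) * \<tau>"
        by (simp add: add_divide_distrib algebra_simps)
      also have "\<dots> \<le> (26 * K^5 * (l * s^2) + 8 * K^5 * l^2 / \<rho>) * \<tau>"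
      proof (intro mult_right_mono add_mono)
        have "26 * K^5 * (l * s) / \<rho> \<le> 26 * K^5 * (l * s)"
          using \<rho>(1) K ls divide_left_mono[of 1 \<rho> "26 * K^5 * (l * s)"] by simp
        also have "\<dots> \<le> 26 * K^5 * (l * s^2)" using K l1 s2 by (intro mult_left_mono) auto
        finally show "26 * K^5 * (l * s) / \<rho> \<le> 26 * K^5 * (l * s^2)" .
        show "8 * K^4 * l^2 / \<rho> \<le> 8 * K^5 * l^2 / \<rho>"
          using Kp[of 4 5] \<rho>(1) by (intro divide_right_mono mult_right_mono mult_left_mono) auto
      qed (use \<tau>0 in auto)
      finally show "(26 * K^5 * (l * s) + 8 * K^4 * l^2) / b \<le> (26 * K^5 * (l * s^2) + 8 * K^5 * l^2 / \<rho>) * \<tau>" .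
    qed
    also have "\<dots> = K^5 * (118 * (l * s^2) + 8 * l^2 / \<rho>) * \<tau>"
      by (simp add: algebra_simps)
    finally show ?thesis .
  qed
  have fin: "c0 * l \<le> K^5 * (118 * s^2 + 8 * l / \<rho>)"
  proof -
    have "(c0 * l) * (l * \<tau>) \<le> (K^5 * (118 * s^2 + 8 * l / \<rho>)) * (l * \<tau>)"
      using tot by (simp add: power2_eq_square algebra_simps)
    moreover have "0 < l * \<tau>" using l1 \<tau>0 by simp
    ultimately show ?thesis by (simp only: mult_le_cancel_right_pos)
  qed
  have e1: "0 \<le> 944 * K ^ 9 / c0" "0 \<le> K ^ 4" "0 \<le> K ^ 4 * (16 * K ^ 5 / c0) ^ (CARD('n) - 1)"
    using K c0 by auto
  \<comment> \<open>If \<open>\<rho>\<close> is large, the term with \<open>l / \<rho>\<close> is absorbed by half of \<open>c0 * l\<close> and the cut-off term bounds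
    \<open>l\<close>, with \<open>236 = 2 * 118\<close> and \<open>944 = 4 * 236\<close>; otherwise \<open>l\<close> is a power of the bounded number \<open>\<rho>\<close>.\<close>
  show ?thesis
  proof (cases "\<rho> \<ge> 16 * K^5 / c0")
    case True
    then have "8 * K^5 / \<rho> \<le> c0 / 2" using c0 \<rho>(1) by (simp add: field_simps)
    from mult_right_mono[OF this, of l] have "K^5 * (8 * l / \<rho>) \<le> c0 * l / 2" using l1 by simp
    then have "c0 * l \<le> 236 * K^5 * s^2" using fin unfolding distrib_left by linarith
    then have "l \<le> 236 * K^5 * s^2 / c0" using c0 by (simp add: field_simps)
    then have "\<eta>\<^sup>2 * l \<le> \<eta>\<^sup>2 * (236 * K^5 * s^2 / c0)" by (intro mult_left_mono) auto
    also have "\<dots> = 236 * K^5 * (\<eta> * s)^2 / c0" by (simp add: power_mult_distrib)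
    also have "\<dots> \<le> 236 * K^5 * (2 * K^2)^2 / c0"
    proof (intro divide_right_mono mult_left_mono power_mono)
      have "\<eta> * s = \<eta> + 1" using eta(1) by (simp add: s_def distrib_left)
      moreover have "1 \<le> K^2" using K by (simp add: one_le_power)
      ultimately show "\<eta> * s \<le> 2 * K^2" using eta by linarith
      show "0 \<le> \<eta> * s" using eta(1) s1 by simp
    qed (use K c0 in auto)
    also have "\<dots> = 944 * K^9 / c0" by (simp add: power_mult_distrib power_numeral_reduce)
    finally show ?thesis using e1 unfolding l_def eigenvalue_bound_def by linarith
  next
    case False
    have "l = \<rho> ^ (CARD('n) - 1)" using \<rho> by simp
    also have "\<dots> \<le> (16 * K^5 / c0) ^ (CARD('n) - 1)" using False \<rho>(1) by (intro power_mono) auto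
    finally have l: "l \<le> (16 * K^5 / c0) ^ (CARD('n) - 1)" .
    have "\<eta>\<^sup>2 * l \<le> (K\<^sup>2)\<^sup>2 * (16 * K^5 / c0) ^ (CARD('n) - 1)"
      using eta l l1 by (intro mult_mono power_mono) auto
    then have "\<eta>\<^sup>2 * l \<le> K^4 * (16 * K^5 / c0) ^ (CARD('n) - 1)" by simp
    then show ?thesis using e1 unfolding l_def eigenvalue_bound_def by linarith
  qed
qed

section \<open>Quadratic forms and frames\<close>

lemma second_deriv_eq:
  assumes S: "open S" "y \<in> S" and d1: "\<And>x. x \<in> S \<Longrightarrow> f differentiable (at x)"
    and d2: "\<And>e. e \<in> Basis \<Longrightarrow> dir_deriv e f differentiable (at y)"
  shows "second_deriv f y v w = dir_deriv v (dir_deriv w f) y"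
proof -
  have "((\<lambda>x. \<Sum>e\<in>Basis. (w \<bullet> e) *\<^sub>R dir_deriv e f x) has_derivative
      (\<lambda>v. \<Sum>e\<in>Basis. (w \<bullet> e) *\<^sub>R dir_deriv v (dir_deriv e f) y)) (at y)"
    by (intro has_derivative_sum has_derivative_scaleR_right has_derivative_dir_deriv d2)
  then have "(dir_deriv w f has_derivative (\<lambda>v. \<Sum>e\<in>Basis. (w \<bullet> e) *\<^sub>R dir_deriv v (dir_deriv e f) y)) (at y)"
    by (rule has_derivative_transform_within_open[OF _ S]) (rule dir_deriv_basis[OF d1, symmetric])
  from dir_deriv_eqI[OF this] show ?thesis by (simp only: second_deriv_def)
qed

lemma second_deriv_bounded_linear:
  assumes L: "bounded_linear L" and S: "open S" "y \<in> S"
    and d1: "\<And>x. x \<in> S \<Longrightarrow> f differentiable (at x)"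
    and d2: "\<And>e. e \<in> Basis \<Longrightarrow> dir_deriv e f differentiable (at y)"
  shows "second_deriv (\<lambda>x. L (f x)) y v w = L (second_deriv f y v w)"
proof -
  interpret bounded_linear L by (rule L)
  have "dir_deriv v (dir_deriv e (\<lambda>x. L (f x))) y = L (dir_deriv v (dir_deriv e f) y)" if e: "e \<in> Basis" for e
  proof -
    have "((\<lambda>x. L (dir_deriv e f x)) has_derivative (\<lambda>v. L (dir_deriv v (dir_deriv e f) y))) (at y)"
      by (intro has_derivative has_derivative_dir_deriv d2 e)
    then have "(dir_deriv e (\<lambda>x. L (f x)) has_derivative (\<lambda>v. L (dir_deriv v (dir_deriv e f) y))) (at y)"
      by (rule has_derivative_transform_within_open[OF _ S])
        (rule dir_deriv_bounded_linear[OF L d1, symmetric])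
    then show ?thesis by (rule dir_deriv_eqI)
  qed
  then show ?thesis by (simp add: second_deriv_def sum scaleR)
qed

lemma second_deriv_linear_left:
  assumes d2: "\<And>e. e \<in> Basis \<Longrightarrow> dir_deriv e f differentiable (at y)"
  shows "second_deriv f y (v + v') w = second_deriv f y v w + second_deriv f y v' w"
    and "second_deriv f y (c *\<^sub>R v) w = c *\<^sub>R second_deriv f y v w"
  by (simp_all add: second_deriv_def linear_add[OF dir_deriv_linear[OF d2]]
      linear_scale[OF dir_deriv_linear[OF d2]] scaleR_right_distrib sum.distrib scaleR_sum_right mult.commute)

lemma second_deriv_linear_right:
  shows "second_deriv f y v (w + w') = second_deriv f y v w + second_deriv f y v w'"
    and "second_deriv f y v (c *\<^sub>R w) = c *\<^sub>R second_deriv f y v w"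
  by (simp_all add: second_deriv_def inner_add_left scaleR_left_distrib sum.distrib scaleR_sum_right)

lemma second_deriv_quadratic_expansion:
  fixes f :: "'a::euclidean_space \<Rightarrow> real"
  assumes d2: "\<And>e. e \<in> Basis \<Longrightarrow> dir_deriv e f differentiable (at y)"
  shows "second_deriv f y (c *\<^sub>R v + w) (c *\<^sub>R v + w) =
    c\<^sup>2 * second_deriv f y v v + c * second_deriv f y v w + c * second_deriv f y w v + second_deriv f y w w"
  by (simp add: second_deriv_linear_left[OF d2] second_deriv_linear_right power2_eq_square algebra_simps)

lemma norm_matrix_vector_mult_le:
  fixes M :: "real^'n^'m::finite"
  shows "norm (M *v x) \<le> norm M * norm x"
proof -
  have "norm (M *v x) = L2_set (\<lambda>i. \<bar>M $ i \<bullet> x\<bar>) UNIV"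
    by (simp add: norm_vec_def matrix_mult_dot)
  also have "\<dots> \<le> L2_set (\<lambda>i. norm (M $ i) * norm x) UNIV"
    by (intro L2_set_mono Cauchy_Schwarz_ineq2) simp
  also have "\<dots> = norm M * norm x"
    by (simp add: norm_vec_def L2_set_left_distrib)
  finally show ?thesis .
qed

lemma bounded_linear_quadratic_form:
  "bounded_linear (\<lambda>M :: real^'n^'n::finite. \<xi> \<bullet> (M *v \<xi>))"
proof (rule bounded_linear_intro)
  fix M :: "real^'n^'n"
  have "\<bar>\<xi> \<bullet> (M *v \<xi>)\<bar> \<le> norm \<xi> * (norm M * norm \<xi>)"
    by (rule order_trans[OF Cauchy_Schwarz_ineq2 mult_left_mono[OF norm_matrix_vector_mult_le]]) simp
  then show "norm (\<xi> \<bullet> (M *v \<xi>)) \<le> norm M * (norm \<xi> * norm \<xi>)" by (simp add: mult_ac)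
qed (simp_all add: matrix_vector_mult_add_rdistrib scaleR_matrix_vector_assoc[symmetric] inner_add_right)

lemma abs_quadratic_form_le:
  fixes M :: "real^'n^'n::finite"
  assumes "norm \<xi> = 1"
  shows "\<bar>\<xi> \<bullet> (M *v \<xi>)\<bar> \<le> norm M"
  using order_trans[OF Cauchy_Schwarz_ineq2 mult_left_mono[OF norm_matrix_vector_mult_le]] assms
  by (metis mult.right_neutral mult_1 norm_ge_zero)

lemma dir_deriv_frame:
  assumes E: "orthonormal_frame E" and d: "f differentiable (at x)"
  shows "dir_deriv v f x = (\<Sum>i\<in>UNIV. (v \<bullet> E i) *\<^sub>R dir_deriv (E i) f x)"
proof -
  have "dir_deriv (\<Sum>i\<in>UNIV. (v \<bullet> E i) *\<^sub>R E i) f x = (\<Sum>i\<in>UNIV. (v \<bullet> E i) *\<^sub>R dir_deriv (E i) f x)"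
    by (simp add: linear_sum[OF dir_deriv_linear[OF d]] linear_scale[OF dir_deriv_linear[OF d]])
  then show ?thesis by (simp add: frame_expansion[OF E])
qed

lemma orthonormal_frame_axis: "orthonormal_frame (\<lambda>i. axis i 1)"
  by (simp add: orthonormal_frame_def inner_axis_axis)

lemma norm_triple_le: "norm (x, z, p) \<le> norm x + norm z + norm p"
  using norm_Pair_le[of x "(z, p)"] norm_Pair_le[of z p] by linarith

section \<open>Solutions and their jets\<close>

locale monge_ampere_solution =
  fixes \<Omega> :: "(real^'n::finite) set" and u :: "real^'n \<Rightarrow> real"
    and A :: "'n jet \<Rightarrow> real^'n^'n" and B :: "'n jet \<Rightarrow> real" and c0 :: real
  assumes n_ge_2: "CARD('n) \<ge> 2"
    and open_\<Omega>: "open \<Omega>" and connected_\<Omega>: "connected \<Omega>" and bounded_\<Omega>: "bounded \<Omega>"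
    and u_C4: "C_k 4 \<Omega> u" and u_C11: "C_11_closure \<Omega> u"
    and B_pos: "\<And>y. y \<in> phase_space \<Omega> \<Longrightarrow> 0 < B y"
    and equation: "\<And>x. x \<in> \<Omega> \<Longrightarrow> det (hessian u x - A (jet u x)) = B (jet u x)"
    and elliptic: "\<And>x. x \<in> \<Omega> \<Longrightarrow> pos_def (hessian u x - A (jet u x))"
    and B_C11: "C_11_closure (phase_space \<Omega>) (\<lambda>y. B y powr (1 / (real CARD('n) - 1)))"
    and A_C2: "C_k_closure 2 (phase_space \<Omega>) A"
    and c0_pos: "0 < c0" and A_regular: "strictly_regular \<Omega> A c0"
begin

definition W :: "real^'n \<Rightarrow> real^'n^'n" where "W x = hessian u x - A (jet u x)"

definition b :: "'n jet \<Rightarrow> real" where "b y = B y powr (1 / (real CARD('n) - 1))"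

abbreviation Q :: "'n jet set" where "Q \<equiv> jet_range \<Omega> u"

abbreviation M :: real where "M \<equiv> sup_grad \<Omega> u"
abbreviation NA :: real where "NA \<equiv> C_k_norm 2 Q A"
abbreviation NB :: real where "NB \<equiv> C_11_norm Q b"

text \<open>The quadratic forms of \<open>A\<close> are used instead of its entries, because the frame in which the
  equation is differentiated depends on the point.\<close>

definition a :: "real^'n \<Rightarrow> 'n jet \<Rightarrow> real" where "a \<xi> y = \<xi> \<bullet> (A y *v \<xi>)"

lemma open_phase: "open (phase_space \<Omega>)"
  unfolding phase_space_def by (intro open_Times open_\<Omega> open_UNIV)

lemma jet_in_phase: "x \<in> \<Omega> \<Longrightarrow> jet u x \<in> phase_space \<Omega>"
  by (simp add: jet_def phase_space_def)

lemma jet_range_subset: "Q \<subseteq> phase_space \<Omega>"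
  by (auto simp: jet_range_def phase_space_def)

lemma u_derivative_C3: "C_k 3 \<Omega> (dir_deriv v u)"
proof (rule C_k_dir_deriv[OF open_\<Omega>])
  have "Suc 3 = 4" by simp
  then show "C_k (Suc 3) \<Omega> u" using u_C4 by (simp only:)
qed

lemma u_derivatives_C2:
  shows "C_k 2 \<Omega> (dir_deriv w (dir_deriv v u))" "C_k 2 \<Omega> (dir_deriv v u)" "C_k 2 \<Omega> u"
proof -
  have 3: "Suc 2 = 3" and 4: "Suc 3 = 4" by simp_all
  then have u3: "C_k (Suc 2) \<Omega> (dir_deriv v u)" for v using u_derivative_C3 by (simp only:)
  show "C_k 2 \<Omega> (dir_deriv w (dir_deriv v u))" by (rule C_k_dir_deriv[OF open_\<Omega> u3])
  show "C_k 2 \<Omega> (dir_deriv v u)" by (rule C_k_Suc_imp[OF u3])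
  have "C_k (Suc 3) \<Omega> u" using u_C4 by (simp only: 4)
  then have "C_k (Suc 2) \<Omega> u" unfolding 3 by (rule C_k_Suc_imp)
  then show "C_k 2 \<Omega> u" by (rule C_k_Suc_imp)
qed

lemma u_C3: "C_k 3 \<Omega> u"
proof -
  have "Suc 3 = 4" by simp
  then have "C_k (Suc 3) \<Omega> u" using u_C4 by (simp only:)
  then show ?thesis by (rule C_k_Suc_imp)
qed

lemma C_k_2_differentiable: "C_k 2 \<Omega> f \<Longrightarrow> x \<in> \<Omega> \<Longrightarrow> f differentiable (at x)"
  by (simp add: numeral_2_eq_2)

lemma fourth_derivatives_commute:
  assumes y: "y \<in> \<Omega>"
  shows "dir_deriv v (dir_deriv v (dir_deriv w (dir_deriv w u))) y
    = dir_deriv w (dir_deriv w (dir_deriv v (dir_deriv v u))) y"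
proof -
  have "Suc 1 = 2" by simp
  then have "C_k (Suc 1) \<Omega> (dir_deriv w (dir_deriv w u))" using u_derivatives_C2(1) by (simp only:)
  from C_k_dir_deriv[OF open_\<Omega> this]
  have "C_k (Suc 0) \<Omega> (dir_deriv v (dir_deriv w (dir_deriv w u)))" unfolding One_nat_def .
  from dir_deriv_cong[OF open_\<Omega> y C_k_differentiable[OF this y]
      C_3_mixed_derivatives_commute[OF open_\<Omega> _ u_C3]]
  have "dir_deriv v (dir_deriv v (dir_deriv w (dir_deriv w u))) y
      = dir_deriv v (dir_deriv w (dir_deriv w (dir_deriv v u))) y" .
  also have "\<dots> = dir_deriv w (dir_deriv w (dir_deriv v (dir_deriv v u))) y"
    by (rule C_3_mixed_derivatives_commute[OF open_\<Omega> y u_derivative_C3])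
  finally show ?thesis .
qed

lemma hessian_form:
  assumes "x \<in> \<Omega>"
  shows "\<xi> \<bullet> (hessian u x *v \<zeta>) = dir_deriv \<xi> (dir_deriv \<zeta> u) x"
proof -
  note ax = orthonormal_frame_axis
  have "((\<lambda>y. \<Sum>j\<in>UNIV. (\<zeta> \<bullet> axis j 1) *\<^sub>R dir_deriv (axis j 1) u y) has_derivative
      (\<lambda>v. \<Sum>j\<in>UNIV. (\<zeta> \<bullet> axis j 1) *\<^sub>R dir_deriv v (dir_deriv (axis j 1) u) x)) (at x)"
    by (intro has_derivative_sum has_derivative_scaleR_right has_derivative_dir_deriv
        C_k_2_differentiable[OF u_derivatives_C2(2) assms])
  then have "(dir_deriv \<zeta> u has_derivative
      (\<lambda>v. \<Sum>j\<in>UNIV. (\<zeta> \<bullet> axis j 1) *\<^sub>R dir_deriv v (dir_deriv (axis j 1) u) x)) (at x)"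
    by (rule has_derivative_transform_within_open[OF _ open_\<Omega> assms])
      (rule dir_deriv_frame[OF ax C_k_2_differentiable[OF u_derivatives_C2(3)], symmetric])
  then have "dir_deriv \<xi> (dir_deriv \<zeta> u) x =
      (\<Sum>j\<in>UNIV. (\<zeta> \<bullet> axis j 1) *\<^sub>R dir_deriv \<xi> (dir_deriv (axis j 1) u) x)"
    by (rule dir_deriv_eqI)
  also have "\<dots> = (\<Sum>j\<in>UNIV. (\<zeta> $ j) * (\<Sum>i\<in>UNIV. \<xi> $ i * dir_deriv (axis i 1) (dir_deriv (axis j 1) u) x))"
    unfolding dir_deriv_frame[OF ax C_k_2_differentiable[OF u_derivatives_C2(2) assms], of \<xi>]
    by (simp add: inner_axis)
  also have "\<dots> = \<xi> \<bullet> (hessian u x *v \<zeta>)"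
    unfolding sum_distrib_left
    by (subst sum.swap) (simp add: inner_vec_def matrix_vector_mult_def hessian_def sum_distrib_left mult_ac)
  finally show ?thesis by simp
qed

lemma W_form:
  assumes "x \<in> \<Omega>"
  shows "\<xi> \<bullet> (W x *v \<xi>) = dir_deriv \<xi> (dir_deriv \<xi> u) x - a \<xi> (jet u x)"
  using hessian_form[OF assms, of \<xi> \<xi>]
  by (simp add: W_def a_def matrix_vector_mult_diff_rdistrib inner_diff_right)

lemma grad_inner:
  assumes x: "x \<in> \<Omega>"
  shows "grad u x \<bullet> w = dir_deriv w u x"
proof -
  have "dir_deriv w u x = (\<Sum>i\<in>UNIV. w $ i * dir_deriv (axis i 1) u x)"
    unfolding dir_deriv_frame[OF orthonormal_frame_axis C_k_2_differentiable[OF u_derivatives_C2(3) x], of w]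
    by (simp add: inner_axis)
  then show ?thesis by (simp add: grad_def inner_vec_def mult.commute)
qed

lemma grad_frame:
  assumes E: "orthonormal_frame E" and x: "x \<in> \<Omega>"
  shows "grad u x = (\<Sum>j\<in>UNIV. dir_deriv (E j) u x *\<^sub>R E j)"
  using frame_expansion[OF E, of "grad u x"] by (simp add: grad_inner[OF x])

lemma norm_grad_le: "x \<in> \<Omega> \<Longrightarrow> norm (grad u x) \<le> M"
proof -
  assume x: "x \<in> \<Omega>"
  have ext: "extends_continuously \<Omega> (dir_deriv e u)" if "e \<in> Basis" for e
    using u_C11 that by (simp add: C_11_closure_def)
  have "\<exists>c. \<forall>x\<in>\<Omega>. norm (dir_deriv (axis i 1) u x) \<le> c" for i :: 'n
    using extends_continuously_bdd_above[OF ext order_refl bounded_\<Omega>, of "axis i 1"]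
    by (auto simp: bdd_above_def axis_in_Basis_iff)
  then obtain c where c: "\<And>i x. x \<in> \<Omega> \<Longrightarrow> norm (dir_deriv (axis i 1) u x) \<le> c i" by metis
  have "bdd_above ((\<lambda>x. norm (grad u x)) ` \<Omega>)"
  proof (rule bdd_aboveI2)
    fix x assume x: "x \<in> \<Omega>"
    have "norm (grad u x) \<le> (\<Sum>i\<in>UNIV. \<bar>grad u x $ i\<bar>)" by (rule norm_le_l1_cart)
    also have "\<dots> \<le> (\<Sum>i\<in>UNIV. c i)" using c[OF x] by (intro sum_mono) (simp add: grad_def)
    finally show "norm (grad u x) \<le> (\<Sum>i\<in>UNIV. c i)" .
  qed
  then show ?thesis unfolding sup_grad_def using x by (intro cSUP_upper)
qed

lemma jet_in_range: "x \<in> \<Omega> \<Longrightarrow> jet u x \<in> Q"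
  using norm_grad_le by (simp add: jet_def jet_range_def)

lemma bounded_range: "bounded Q"
proof -
  have "extends_continuously \<Omega> u" using u_C11 by (simp add: C_11_closure_def)
  from extends_continuously_bdd_above[OF this order_refl bounded_\<Omega>]
  have "bounded (u ` \<Omega>)" by (auto simp: bdd_above_def bounded_iff)
  then show ?thesis unfolding jet_range_def by (intro bounded_Times bounded_\<Omega> bounded_cball)
qed

text \<open>Convexity of the range of \<open>u\<close> comes from the connectedness of \<open>\<Omega>\<close>; it is what allows the norms over
  the range of jets to control increments of \<open>b\<close> along the straight segment between two jets.\<close>

lemma jet_segment:
  assumes "closed_segment x y \<subseteq> \<Omega>"
  shows "closed_segment (jet u x) (jet u y) \<subseteq> Q"
proof
  fix p assume "p \<in> closed_segment (jet u x) (jet u y)"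
  then obtain t where t: "0 \<le> t" "t \<le> 1" "p = (1 - t) *\<^sub>R jet u x + t *\<^sub>R jet u y"
    by (auto simp: in_segment)
  have xy: "x \<in> \<Omega>" "y \<in> \<Omega>" using assms by auto
  have "(1 - t) *\<^sub>R x + t *\<^sub>R y \<in> \<Omega>" using assms t by (auto simp: in_segment subset_iff)
  moreover have "(1 - t) *\<^sub>R u x + t *\<^sub>R u y \<in> u ` \<Omega>"
  proof -
    have "continuous_on \<Omega> u"
      using C_k_2_differentiable[OF u_derivatives_C2(3)]
      by (auto simp: continuous_on_eq_continuous_at open_\<Omega> intro: differentiable_imp_continuous_within)
    then have "connected (u ` \<Omega>)" using connected_\<Omega> connected_continuous_image by blast
    then have "convex (u ` \<Omega>)" by (simp add: connected_convex_1)
    then show ?thesis using xy t by (intro convexD) auto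
  qed
  moreover have "(1 - t) *\<^sub>R grad u x + t *\<^sub>R grad u y \<in> cball 0 M"
    using xy t norm_grad_le by (intro convexD[OF convex_cball]) auto
  ultimately show "p \<in> Q" by (simp add: t(3) jet_def jet_range_def)
qed

lemma A_C2_Suc: "C_k_closure (Suc (Suc 0)) (phase_space \<Omega>) A"
  using A_C2 by (simp only: numeral_2_eq_2)

lemma A_differentiable:
  assumes "y \<in> phase_space \<Omega>"
  shows "A differentiable (at y)" "e \<in> Basis \<Longrightarrow> dir_deriv e A differentiable (at y)"
  using A_C2_Suc assms by auto

lemma continuous_on_W: "continuous_on \<Omega> W"
proof -
  have C2: "continuous_on \<Omega> f" if "C_k 2 \<Omega> f" for f :: "real^'n \<Rightarrow> real"
    using C_k_2_differentiable[OF that]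
    by (auto simp: continuous_on_eq_continuous_at open_\<Omega> intro: differentiable_imp_continuous_within)
  have H: "continuous_on \<Omega> (hessian u)"
    unfolding hessian_def[abs_def] by (intro continuous_on_vec_lambda C2 u_derivatives_C2)
  have J: "continuous_on \<Omega> (jet u)"
    unfolding jet_def[abs_def] grad_def
    by (intro continuous_on_Pair continuous_on_vec_lambda continuous_on_id C2 u_derivatives_C2)
  have "continuous_on (phase_space \<Omega>) A"
    using A_differentiable(1)
    by (auto simp: continuous_on_eq_continuous_at open_phase intro: differentiable_imp_continuous_within)
  then have "continuous_on \<Omega> (\<lambda>x. A (jet u x))"
    by (rule continuous_on_compose2[OF _ J]) (auto simp: jet_in_phase)
  then show ?thesis unfolding W_def[abs_def] by (intro continuous_on_diff H)
qed

lemma a_dir_deriv: "y \<in> phase_space \<Omega> \<Longrightarrow> dir_deriv v (a \<xi>) y = \<xi> \<bullet> (dir_deriv v A y *v \<xi>)"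
  unfolding a_def[abs_def] by (rule dir_deriv_bounded_linear[OF bounded_linear_quadratic_form A_differentiable(1)])

lemma a_second_deriv: "y \<in> phase_space \<Omega> \<Longrightarrow> second_deriv (a \<xi>) y v w = \<xi> \<bullet> (second_deriv A y v w *v \<xi>)"
  unfolding a_def[abs_def]
  by (rule second_deriv_bounded_linear[OF bounded_linear_quadratic_form open_phase _ A_differentiable])

lemma a_differentiable:
  assumes "y \<in> phase_space \<Omega>"
  shows "a \<xi> differentiable (at y)" "e \<in> Basis \<Longrightarrow> dir_deriv e (a \<xi>) differentiable (at y)"
proof -
  have bl: "(\<lambda>y. \<xi> \<bullet> (f y *v \<xi>)) differentiable (at y)" if "f differentiable (at y)" for f :: "'n jet \<Rightarrow> real^'n^'n"
    using bounded_linear.has_derivative[OF bounded_linear_quadratic_form has_derivative_dir_deriv[OF that]]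
    unfolding differentiable_def by blast
  show "a \<xi> differentiable (at y)" unfolding a_def[abs_def] by (rule bl[OF A_differentiable(1)[OF assms]])
  assume "e \<in> Basis"
  from bl[OF A_differentiable(2)[OF assms this]]
  show "dir_deriv e (a \<xi>) differentiable (at y)"
    by (rule differentiable_cong_open[OF open_phase assms]) (simp add: a_dir_deriv)
qed

lemma a_bounds:
  assumes y: "y \<in> Q" and \<xi>: "norm \<xi> = 1"
  shows "\<bar>a \<xi> y\<bar> \<le> NA" "\<bar>dir_deriv v (a \<xi>) y\<bar> \<le> NA * norm v"
    "\<bar>second_deriv (a \<xi>) y v w\<bar> \<le> NA * norm v * norm w"
proof -
  have yp: "y \<in> phase_space \<Omega>" using y jet_range_subset by blast
  show "\<bar>a \<xi> y\<bar> \<le> NA"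
    unfolding a_def using abs_quadratic_form_le[OF \<xi>] norm_le_C_k_norm[OF A_C2 jet_range_subset bounded_range y]
    by (rule order_trans)
  show "\<bar>dir_deriv v (a \<xi>) y\<bar> \<le> NA * norm v"
    unfolding a_dir_deriv[OF yp]
    using abs_quadratic_form_le[OF \<xi>] norm_dir_deriv_le[OF A_C2_Suc jet_range_subset bounded_range y]
    unfolding numeral_2_eq_2 by (rule order_trans)
  show "\<bar>second_deriv (a \<xi>) y v w\<bar> \<le> NA * norm v * norm w"
    unfolding a_second_deriv[OF yp]
    using abs_quadratic_form_le[OF \<xi>] norm_second_deriv_le[OF A_C2 jet_range_subset bounded_range y]
    by (rule order_trans)
qed

lemma a_regular:
  assumes y: "y \<in> phase_space \<Omega>" and \<xi>: "norm \<xi> = 1" "norm \<eta> = 1" "\<xi> \<bullet> \<eta> = 0"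
  shows "c0 \<le> second_deriv (a \<xi>) y (0, 0, \<eta>) (0, 0, \<eta>)"
proof -
  have lin: "dir_deriv (0, 0, \<eta>) f y = (\<Sum>k\<in>UNIV. \<eta> $ k *\<^sub>R dp k f y)"
    if d: "f differentiable (at y)" for f :: "'n jet \<Rightarrow> real^'n^'n" and y
  proof -
    have "(\<Sum>k\<in>UNIV. \<eta> $ k *\<^sub>R axis k 1) = \<eta>"
      using frame_expansion[OF orthonormal_frame_axis, of \<eta>] by (simp add: inner_axis)
    then have "(0 :: real^'n, 0 :: real, \<eta>) = (\<Sum>k\<in>UNIV. \<eta> $ k *\<^sub>R (0, 0, axis k 1))"
      by (simp add: sum_prod[symmetric] prod_eq_iff fst_sum snd_sum)
    then show ?thesis
      by (simp only: dp_def linear_sum[OF dir_deriv_linear[OF d]] linear_scale[OF dir_deriv_linear[OF d]])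
  qed
  have dpd: "dp l A differentiable (at y)" for l
    unfolding dp_def by (rule A_differentiable(2)[OF y]) (simp add: Basis_prod_def axis_in_Basis_iff)
  have "second_deriv A y (0, 0, \<eta>) (0, 0, \<eta>) = dir_deriv (0, 0, \<eta>) (dir_deriv (0, 0, \<eta>) A) y"
    by (rule second_deriv_eq[OF open_phase y A_differentiable(1) A_differentiable(2)[OF y]])
  also have "\<dots> = dir_deriv (0, 0, \<eta>) (\<lambda>x. \<Sum>l\<in>UNIV. \<eta> $ l *\<^sub>R dp l A x) y"
  proof -
    have "((\<lambda>x. \<Sum>l\<in>UNIV. \<eta> $ l *\<^sub>R dp l A x) has_derivative
        (\<lambda>v. \<Sum>l\<in>UNIV. \<eta> $ l *\<^sub>R dir_deriv v (dp l A) y)) (at y)"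
      by (intro has_derivative_sum has_derivative_scaleR_right has_derivative_dir_deriv dpd)
    then have "(\<lambda>x. \<Sum>l\<in>UNIV. \<eta> $ l *\<^sub>R dp l A x) differentiable (at y)"
      unfolding differentiable_def by blast
    then show ?thesis
      by (rule dir_deriv_cong[OF open_phase y, symmetric]) (rule lin[OF A_differentiable(1), symmetric])
  qed
  also have "\<dots> = (\<Sum>l\<in>UNIV. \<eta> $ l *\<^sub>R dir_deriv (0, 0, \<eta>) (dp l A) y)"
    by (rule dir_deriv_eqI) (intro has_derivative_sum has_derivative_scaleR_right has_derivative_dir_deriv dpd)
  also have "\<dots> = (\<Sum>l\<in>UNIV. \<Sum>k\<in>UNIV. (\<eta> $ l * \<eta> $ k) *\<^sub>R dp k (dp l A) y)"
    by (simp add: lin[OF dpd] scaleR_sum_right)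
  finally have sd: "second_deriv A y (0, 0, \<eta>) (0, 0, \<eta>) =
      (\<Sum>l\<in>UNIV. \<Sum>k\<in>UNIV. (\<eta> $ l * \<eta> $ k) *\<^sub>R dp k (dp l A) y)" .
  have "second_deriv (a \<xi>) y (0, 0, \<eta>) (0, 0, \<eta>) =
      (\<Sum>i\<in>UNIV. \<Sum>j\<in>UNIV. \<xi> $ i * (\<xi> $ j * (\<Sum>l\<in>UNIV. \<Sum>k\<in>UNIV. \<eta> $ l * \<eta> $ k * dp k (dp l A) y $ i $ j)))"
    unfolding a_second_deriv[OF y] sd
    by (simp add: inner_vec_def matrix_vector_mult_def sum_distrib_left sum_component mult_ac)
  also have "\<dots> = (\<Sum>i\<in>UNIV. \<Sum>j\<in>UNIV. \<Sum>l\<in>UNIV. \<Sum>k\<in>UNIV.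
      dp k (dp l A) y $ i $ j * \<xi> $ i * \<xi> $ j * \<eta> $ k * \<eta> $ l)"
    by (simp add: sum_distrib_left mult_ac)
  also have "\<dots> = (\<Sum>i\<in>UNIV. \<Sum>j\<in>UNIV. \<Sum>k\<in>UNIV. \<Sum>l\<in>UNIV.
      dp k (dp l A) y $ i $ j * \<xi> $ i * \<xi> $ j * \<eta> $ k * \<eta> $ l)"
    by (intro sum.cong refl sum.swap)
  finally have eq: "second_deriv (a \<xi>) y (0, 0, \<eta>) (0, 0, \<eta>) = \<dots>" .
  have "c0 = c0 * (norm \<xi>)\<^sup>2 * (norm \<eta>)\<^sup>2" using \<xi> by simp
  also have "\<dots> \<le> second_deriv (a \<xi>) y (0, 0, \<eta>) (0, 0, \<eta>)"
    unfolding eq by (rule A_regular[unfolded strictly_regular_def, rule_format, OF y \<xi>(3)])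
  finally show ?thesis .
qed

section \<open>The differentiated equation\<close>

text \<open>The first and second derivatives of the curve \<open>t \<mapsto> jet u (y + t v)\<close> at \<open>t = 0\<close>. The gradient is
  resolved in the frame \<open>E\<close>, so that its components are derivatives of \<open>u\<close> in the directions of \<open>E\<close>.\<close>

definition jet1 :: "('n \<Rightarrow> real^'n) \<Rightarrow> real^'n \<Rightarrow> real^'n \<Rightarrow> 'n jet" where
  "jet1 E y v = (v, dir_deriv v u y, \<Sum>j\<in>UNIV. dir_deriv v (dir_deriv (E j) u) y *\<^sub>R E j)"

definition jet2 :: "('n \<Rightarrow> real^'n) \<Rightarrow> real^'n \<Rightarrow> real^'n \<Rightarrow> 'n jet" where
  "jet2 E y v = (0, dir_deriv v (dir_deriv v u) y,
     \<Sum>j\<in>UNIV. dir_deriv v (dir_deriv v (dir_deriv (E j) u)) y *\<^sub>R E j)"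

lemma line_in_domain: "y \<in> \<Omega> \<Longrightarrow> \<forall>\<^sub>F t in nhds 0. y + t *\<^sub>R v \<in> \<Omega>"
  by (rule eventually_along_curve[OF _ open_\<Omega>]) (auto intro!: continuous_intros)

lemma jet_along_line:
  assumes E: "orthonormal_frame E" and y: "y \<in> \<Omega>"
  shows "has_2jet (\<lambda>t. jet u (y + t *\<^sub>R v)) (jet1 E y v) (jet2 E y v)"
proof -
  have "has_2jet (\<lambda>t. dir_deriv (E j) u (y + t *\<^sub>R v) *\<^sub>R E j)
      (dir_deriv v (dir_deriv (E j) u) y *\<^sub>R E j) (dir_deriv v (dir_deriv v (dir_deriv (E j) u)) y *\<^sub>R E j)" for j
    by (rule has_2jet_bounded_linear[OF bounded_linear_scaleR_left C_k_along_line[OF open_\<Omega> u_derivatives_C2(2) y]])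
  then have g: "has_2jet (\<lambda>t. \<Sum>j\<in>UNIV. dir_deriv (E j) u (y + t *\<^sub>R v) *\<^sub>R E j)
      (\<Sum>j\<in>UNIV. dir_deriv v (dir_deriv (E j) u) y *\<^sub>R E j)
      (\<Sum>j\<in>UNIV. dir_deriv v (dir_deriv v (dir_deriv (E j) u)) y *\<^sub>R E j)"
    by (rule has_2jet_sum)
  have "has_2jet (\<lambda>t. (y + t *\<^sub>R v, u (y + t *\<^sub>R v), \<Sum>j\<in>UNIV. dir_deriv (E j) u (y + t *\<^sub>R v) *\<^sub>R E j))
      (jet1 E y v) (jet2 E y v)"
    unfolding jet1_def jet2_def
    by (rule has_2jet_Pair[OF has_2jet_affine has_2jet_Pair[OF C_k_along_line[OF open_\<Omega> u_derivatives_C2(3) y] g]])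
  moreover have "\<forall>\<^sub>F t in nhds 0. (y + t *\<^sub>R v, u (y + t *\<^sub>R v), \<Sum>j\<in>UNIV. dir_deriv (E j) u (y + t *\<^sub>R v) *\<^sub>R E j)
      = jet u (y + t *\<^sub>R v)"
    using line_in_domain[OF y, of v]
  proof eventually_elim
    case (elim t)
    then show ?case by (simp only: jet_def grad_frame[OF E])
  qed
  ultimately show ?thesis by (rule has_2jet_cong)
qed

lemma W_along_line:
  assumes E: "orthonormal_frame E" and y: "y \<in> \<Omega>"
  shows "has_2jet (\<lambda>t. \<xi> \<bullet> (W (y + t *\<^sub>R v) *v \<xi>))
    (dir_deriv v (dir_deriv \<xi> (dir_deriv \<xi> u)) y - dir_deriv (jet1 E y v) (a \<xi>) (jet u y))
    (dir_deriv v (dir_deriv v (dir_deriv \<xi> (dir_deriv \<xi> u))) y -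
      (second_deriv (a \<xi>) (jet u y) (jet1 E y v) (jet1 E y v) + dir_deriv (jet2 E y v) (a \<xi>) (jet u y)))"
proof -
  have "has_2jet (\<lambda>t. a \<xi> (jet u (y + t *\<^sub>R v))) (dir_deriv (jet1 E y v) (a \<xi>) (jet u (y + 0 *\<^sub>R v)))
    (second_deriv (a \<xi>) (jet u (y + 0 *\<^sub>R v)) (jet1 E y v) (jet1 E y v) + dir_deriv (jet2 E y v) (a \<xi>) (jet u (y + 0 *\<^sub>R v)))"
    by (rule has_2jet_compose[OF jet_along_line[OF E y] open_phase])
      (simp_all add: jet_in_phase y a_differentiable)
  then have "has_2jet (\<lambda>t. a \<xi> (jet u (y + t *\<^sub>R v))) (dir_deriv (jet1 E y v) (a \<xi>) (jet u y))
    (second_deriv (a \<xi>) (jet u y) (jet1 E y v) (jet1 E y v) + dir_deriv (jet2 E y v) (a \<xi>) (jet u y))"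
    by simp
  note h = has_2jet_diff[OF C_k_along_line[OF open_\<Omega> u_derivatives_C2(1)[of \<xi> \<xi>] y, of v] this]
  show ?thesis
  proof (rule has_2jet_cong[OF h])
    show "\<forall>\<^sub>F t in nhds 0. dir_deriv \<xi> (dir_deriv \<xi> u) (y + t *\<^sub>R v) - a \<xi> (jet u (y + t *\<^sub>R v))
        = \<xi> \<bullet> (W (y + t *\<^sub>R v) *v \<xi>)"
      using line_in_domain[OF y, of v] by eventually_elim (simp only: W_form)
  qed
qed

lemma pos_def_W: "x \<in> \<Omega> \<Longrightarrow> pos_def (W x)"
  using elliptic by (simp add: W_def)

lemma W_form_pos: "x \<in> \<Omega> \<Longrightarrow> norm \<xi> = 1 \<Longrightarrow> 0 < \<xi> \<bullet> (W x *v \<xi>)"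
  using pos_def_W[of x] by (metis norm_zero pos_def_def zero_neq_one)

lemma b_pos: "y \<in> phase_space \<Omega> \<Longrightarrow> 0 < b y"
  using B_pos[of y] by (simp add: b_def)

lemma b_power:
  assumes "x \<in> \<Omega>"
  shows "b (jet u x) ^ (CARD('n) - 1) = det (W x)"
proof -
  have B: "0 < B (jet u x)" by (rule B_pos[OF jet_in_phase[OF assms]])
  have "b (jet u x) ^ (CARD('n) - 1) = (B (jet u x) powr (1 / (real CARD('n) - 1))) powr real (CARD('n) - 1)"
    unfolding b_def by (rule powr_realpow[symmetric]) (use B in simp)
  also have "\<dots> = B (jet u x) powr 1"
    using n_ge_2 by (simp add: powr_powr of_nat_diff)
  finally show ?thesis using equation[OF assms] B by (simp add: W_def)
qed

lemma b_C11: "C_11_closure (phase_space \<Omega>) b"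
  using B_C11 by (simp only: b_def[abs_def])

lemma b_differentiable: "y \<in> phase_space \<Omega> \<Longrightarrow> b differentiable (at y)"
  using b_C11 by (simp add: C_11_closure_def)

text \<open>The equation \<open>ln (det W) = (n - 1) ln b\<close> differentiated once and twice in direction \<open>v\<close>, the second
  time as an inequality that keeps only the squares of diagonal third derivatives. By Hadamard's
  inequality and the lower expansion of \<open>b\<close>, the difference of \<open>\<Sum>\<^bsub>i\<^esub> ln W\<^bsub>ii\<^esub>\<close> and \<open>(n - 1) ln h\<close> is
  nonnegative along the line, where \<open>h\<close> is the quadratic lower bound of \<open>b\<close>. It vanishes at \<open>y\<close>, because
  \<open>E\<close> diagonalises \<open>W y\<close>; so its first derivative is zero and its second one nonnegative there.\<close>

lemma differentiated_equation:
  assumes E: "orthonormal_frame E" and y: "y \<in> \<Omega>" and eig: "\<And>i. W y *v E i = lam i *\<^sub>R E i"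
    and K: "NB \<le> K"
    and w: "\<And>i. has_2jet (\<lambda>t. E i \<bullet> (W (y + t *\<^sub>R v) *v E i)) (X i) (Y i)"
  defines "q \<equiv> b (jet u y)"
  shows "(\<Sum>i\<in>UNIV. X i / lam i) = (real CARD('n) - 1) * (dir_deriv (jet1 E y v) b (jet u y) / q)"
    "(real CARD('n) - 1) * ((dir_deriv (jet2 E y v) b (jet u y) - 2 * K * (norm (jet1 E y v))\<^sup>2) / q
        - (dir_deriv (jet1 E y v) b (jet u y) / q)\<^sup>2)
      \<le> (\<Sum>i\<in>UNIV. Y i / lam i - (X i / lam i)\<^sup>2)"
proof -
  let ?k = "real CARD('n) - 1"
  let ?J = "\<lambda>t. jet u (y + t *\<^sub>R v)"
  let ?j1 = "jet1 E y v" and ?j2 = "jet2 E y v"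
  let ?D = "\<lambda>v. dir_deriv v b (jet u y)"
  define h where "h t = q + ?D (?J t - jet u y) - K * ((?J t - jet u y) \<bullet> (?J t - jet u y))" for t
  have k: "?k > 0" using n_ge_2 by simp
  have D: "bounded_linear ?D"
    using has_derivative_dir_deriv[OF b_differentiable[OF jet_in_phase[OF y]]]
    by (rule has_derivative_bounded_linear)
  have "has_2jet (\<lambda>t. ?J t - jet u y) (?j1 - 0) (?j2 - 0)"
    by (rule has_2jet_diff[OF jet_along_line[OF E y] has_2jet_const])
  then have dJ: "has_2jet (\<lambda>t. ?J t - jet u y) ?j1 ?j2" by simp
  have "has_2jet h (0 + ?D ?j1 - K * (?j1 \<bullet> (?J 0 - jet u y) + (?J 0 - jet u y) \<bullet> ?j1))
    (0 + ?D ?j2 - K * (?j2 \<bullet> (?J 0 - jet u y) + 2 * (?j1 \<bullet> ?j1) + (?J 0 - jet u y) \<bullet> ?j2))"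
    unfolding h_def[abs_def]
    by (rule has_2jet_diff[OF has_2jet_add[OF has_2jet_const has_2jet_bounded_linear[OF D dJ]]
          has_2jet_bounded_linear[OF bounded_linear_mult_right has_2jet_inner[OF dJ dJ]]])
  then have hj: "has_2jet h (?D ?j1) (?D ?j2 - 2 * K * (norm ?j1)\<^sup>2)"
    by (simp add: power2_norm_eq_inner mult.assoc mult.left_commute[of K 2])
  have h0: "h 0 = q" using linear_0[OF bounded_linear.linear[OF D]] by (simp add: h_def)
  have q: "0 < q" unfolding q_def by (rule b_pos[OF jet_in_phase[OF y]])
  have w0: "E i \<bullet> (W (y + 0 *\<^sub>R v) *v E i) = lam i" for i by (simp add: eig frame_dot[OF E])
  have lamp: "0 < lam i" for i using W_form_pos[OF y frame_norm[OF E], of i] by (simp add: eig frame_dot[OF E])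
  define g where "g t = (\<Sum>i\<in>UNIV. ln (E i \<bullet> (W (y + t *\<^sub>R v) *v E i))) - ?k * ln (h t)" for t
  have gj: "has_2jet g ((\<Sum>i\<in>UNIV. X i / lam i) - ?k * (?D ?j1 / q))
      ((\<Sum>i\<in>UNIV. Y i / lam i - (X i / lam i)\<^sup>2) - ?k * ((?D ?j2 - 2 * K * (norm ?j1)\<^sup>2) / q - (?D ?j1 / q)\<^sup>2))"
    unfolding g_def[abs_def]
  proof (intro has_2jet_diff has_2jet_sum)
    show "has_2jet (\<lambda>t. ln (E i \<bullet> (W (y + t *\<^sub>R v) *v E i))) (X i / lam i) (Y i / lam i - (X i / lam i)\<^sup>2)" for i
      using has_2jet_ln[OF w[of i]] unfolding w0 using lamp by simp
    show "has_2jet (\<lambda>t. ?k * ln (h t)) (?k * (?D ?j1 / q)) (?k * ((?D ?j2 - 2 * K * (norm ?j1)\<^sup>2) / q - (?D ?j1 / q)\<^sup>2))"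
      using has_2jet_bounded_linear[OF bounded_linear_mult_right has_2jet_ln[OF hj], of ?k] unfolding h0 using q by simp
  qed
  have "\<forall>\<^sub>F t in nhds 0. h t \<in> {0<..}"
    by (rule eventually_along_curve[OF has_2jet_isCont[OF hj]]) (simp_all add: h0 q)
  moreover have "\<forall>\<^sub>F t in nhds 0. closed_segment y (y + t *\<^sub>R v) \<subseteq> \<Omega>"
  proof -
    obtain d where d: "d > 0" "ball y d \<subseteq> \<Omega>" using open_\<Omega> y open_contains_ball by blast
    have "\<forall>\<^sub>F t in nhds 0. y + t *\<^sub>R v \<in> ball y d"
      by (rule eventually_along_curve) (auto intro!: continuous_intros simp: d)
    then show ?thesis
    proof eventually_elim
      case (elim t)
      then have "closed_segment y (y + t *\<^sub>R v) \<subseteq> ball y d"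
        using d by (intro closed_segment_subset) auto
      then show ?case using d(2) by blast
    qed
  qed
  ultimately have "\<forall>\<^sub>F t in nhds 0. 0 \<le> g t"
  proof eventually_elim
    case (elim t)
    have z: "y + t *\<^sub>R v \<in> \<Omega>" using elim(2) by auto
    have "b (jet u y) + ?D (?J t - jet u y) - NB * (norm (?J t - jet u y))\<^sup>2 \<le> b (?J t)"
      by (rule C_11_lower_taylor[OF b_C11 jet_range_subset bounded_range jet_segment[OF elim(2)]])
    moreover have "NB * (norm (?J t - jet u y))\<^sup>2 \<le> K * (norm (?J t - jet u y))\<^sup>2"
      by (rule mult_right_mono[OF K]) simp
    ultimately have "h t \<le> b (?J t)" by (simp add: h_def q_def power2_norm_eq_inner)
    then have "ln (h t) \<le> ln (b (?J t))" using elim(1) by simp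
    then have "?k * ln (h t) \<le> ?k * ln (b (?J t))" using k by (intro mult_left_mono) auto
    also have "\<dots> = ln (b (?J t) ^ (CARD('n) - 1))"
      using b_pos[OF jet_in_phase[OF z]] n_ge_2 by (simp add: ln_realpow of_nat_diff)
    also have "\<dots> = ln (det (W (y + t *\<^sub>R v)))" by (simp only: b_power[OF z])
    also have "\<dots> \<le> (\<Sum>i\<in>UNIV. ln (E i \<bullet> (W (y + t *\<^sub>R v) *v E i)))"
      by (rule hadamard_inequality[OF pos_def_W[OF z] E])
    finally show ?case by (simp add: g_def)
  qed
  moreover have "g 0 = 0"
  proof -
    have "(\<Sum>i\<in>UNIV. ln (lam i)) = ln (\<Prod>i\<in>UNIV. lam i)"
      by (rule ln_prod[symmetric]) (use lamp in \<open>auto simp: less_imp_neq[symmetric]\<close>)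
    also have "\<dots> = ln (q ^ (CARD('n) - 1))"
      using det_eq_prod_eigenvalues[OF E eig] b_power[OF y] by (simp add: q_def)
    also have "\<dots> = ?k * ln q" using q n_ge_2 by (simp add: ln_realpow of_nat_diff)
    finally show ?thesis unfolding g_def w0 h0 by simp
  qed
  ultimately have "\<forall>\<^sub>F t in nhds 0. g 0 \<le> g t" by simp
  note min = has_2jet_local_min[OF gj this]
  show "(\<Sum>i\<in>UNIV. X i / lam i) = ?k * (?D ?j1 / q)" using min(1) by simp
  show "?k * ((?D ?j2 - 2 * K * (norm ?j1)\<^sup>2) / q - (?D ?j1 / q)\<^sup>2) \<le> (\<Sum>i\<in>UNIV. Y i / lam i - (X i / lam i)\<^sup>2)"
    using min(2) by simp
qed

section \<open>The maximum principle\<close>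

text \<open>The only part of the derivative of the jet that grows with the eigenvalue points in the
  \<open>p\<close>-direction of the eigenvector itself. Applied to \<open>E m\<close>, this is what makes the orthogonality
  condition in the strict regularity of \<open>A\<close> match the indices \<open>i \<noteq> m\<close>.\<close>

lemma jet1_eigenvector:
  assumes E: "orthonormal_frame E" and y: "y \<in> \<Omega>" and eig: "\<And>i. W y *v E i = lam i *\<^sub>R E i"
  shows "jet1 E y (E k) = lam k *\<^sub>R (0, 0, E k) + (E k, dir_deriv (E k) u y, A (jet u y) *v E k)"
proof -
  have "(\<Sum>j\<in>UNIV. dir_deriv (E k) (dir_deriv (E j) u) y *\<^sub>R E j) = (\<Sum>j\<in>UNIV. ((hessian u y *v E k) \<bullet> E j) *\<^sub>R E j)"
  proof (intro sum.cong refl)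
    fix j
    have "dir_deriv (E k) (dir_deriv (E j) u) y = dir_deriv (E j) (dir_deriv (E k) u) y"
      by (rule C_2_mixed_derivatives_commute[OF open_\<Omega> y u_derivatives_C2(3)])
    also have "\<dots> = (hessian u y *v E k) \<bullet> E j"
      unfolding hessian_form[OF y, symmetric] by (rule inner_commute)
    finally show "dir_deriv (E k) (dir_deriv (E j) u) y *\<^sub>R E j = ((hessian u y *v E k) \<bullet> E j) *\<^sub>R E j" by simp
  qed
  also have "\<dots> = hessian u y *v E k" by (rule frame_expansion[OF E])
  also have "\<dots> = lam k *\<^sub>R E k + A (jet u y) *v E k"
    using eig[of k] by (simp add: W_def matrix_vector_mult_diff_rdistrib algebra_simps)
  finally show ?thesis by (simp add: jet1_def)
qed

lemma jet1_remainder_bound: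
  assumes y: "y \<in> \<Omega>" and e: "norm e = 1"
  shows "norm (e, dir_deriv e u y, A (jet u y) *v e) \<le> 1 + M + NA"
proof -
  have "\<bar>dir_deriv e u y\<bar> \<le> M"
  proof -
    have "dir_deriv e u y = grad u y \<bullet> e" by (rule grad_inner[OF y, symmetric])
    also have "\<bar>\<dots>\<bar> \<le> norm (grad u y) * norm e" by (rule Cauchy_Schwarz_ineq2)
    finally show ?thesis using norm_grad_le[OF y] e by simp
  qed
  moreover have "norm (A (jet u y) *v e) \<le> NA"
  proof -
    have "norm (A (jet u y) *v e) \<le> norm (A (jet u y)) * norm e" by (rule norm_matrix_vector_mult_le)
    also have "\<dots> \<le> NA"
      using norm_le_C_k_norm[OF A_C2 jet_range_subset bounded_range jet_in_range[OF y]] e by simp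
    finally show ?thesis .
  qed
  ultimately show ?thesis
    using norm_triple_le[of e "dir_deriv e u y" "A (jet u y) *v e"] e by simp
qed

lemma jet2_third_derivatives:
  assumes E: "orthonormal_frame E" and y: "y \<in> \<Omega>"
  shows "jet2 E y v = (0, dir_deriv v (dir_deriv v u) y,
     \<Sum>j\<in>UNIV. dir_deriv (E j) (dir_deriv v (dir_deriv v u)) y *\<^sub>R E j)"
  using C_3_mixed_derivatives_commute[OF open_\<Omega> y u_C3] by (simp add: jet2_def)

text \<open>Third derivatives of \<open>u\<close> enter the estimate only through sums over \<open>k\<close>. With the weights
  \<open>1 / lam k\<close> these sums are given by the once differentiated equation, so the norm has to be taken
  after summing over \<open>k\<close>.\<close>

lemma norm_weighted_jet2_le:
  assumes E: "orthonormal_frame E" and y: "y \<in> \<Omega>"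
  shows "norm (\<Sum>k\<in>I. c k *\<^sub>R jet2 E y (E k)) \<le> \<bar>\<Sum>k\<in>I. c k * dir_deriv (E k) (dir_deriv (E k) u) y\<bar>
     + (\<Sum>j\<in>UNIV. \<bar>\<Sum>k\<in>I. c k * dir_deriv (E j) (dir_deriv (E k) (dir_deriv (E k) u)) y\<bar>)"
proof -
  let ?p = "\<Sum>j\<in>UNIV. (\<Sum>k\<in>I. c k * dir_deriv (E j) (dir_deriv (E k) (dir_deriv (E k) u)) y) *\<^sub>R E j"
  have "(\<Sum>k\<in>I. c k *\<^sub>R jet2 E y (E k)) = (0, \<Sum>k\<in>I. c k * dir_deriv (E k) (dir_deriv (E k) u) y, ?p)"
    by (simp add: jet2_third_derivatives[OF E y] prod_eq_iff fst_sum snd_sum scaleR_sum_right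
        scaleR_sum_left sum.swap[of _ I])
  moreover have "norm ?p \<le> (\<Sum>j\<in>UNIV. \<bar>\<Sum>k\<in>I. c k * dir_deriv (E j) (dir_deriv (E k) (dir_deriv (E k) u)) y\<bar>)"
    by (rule order_trans[OF norm_sum]) (simp add: frame_norm[OF E])
  ultimately show ?thesis
    using norm_triple_le[of "0 :: real^'n" "\<Sum>k\<in>I. c k * dir_deriv (E k) (dir_deriv (E k) u) y" ?p] by simp
qed

text \<open>The number \<open>K\<close> bounds all data at once, and the hypotheses of the arithmetic estimate are verified
  one by one. The eigenvector \<open>E m\<close> is kept fixed while \<open>z\<close> varies, which replaces the largest eigenvalue by
  the smooth function \<open>E m \<bullet> (W z *v E m)\<close> with the same value at the maximum point.\<close>

lemma eigenvalue_estimate_at_maximum: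
  assumes y: "y \<in> \<Omega>" and E: "orthonormal_frame E" and eig: "\<And>i. W y *v E i = lam i *\<^sub>R E i"
    and lam_max: "\<And>i. lam i \<le> lam m"
    and r: "0 < r" "ball x r \<subseteq> \<Omega>" "y \<in> ball x r"
    and K: "1 + M + NA + NB + real CARD('n) + r \<le> K"
    and max: "\<And>z. z \<in> ball x r \<Longrightarrow> (r\<^sup>2 - (norm (z - x))\<^sup>2)\<^sup>2 * (E m \<bullet> (W z *v E m))
       \<le> (r\<^sup>2 - (norm (y - x))\<^sup>2)\<^sup>2 * lam m"
  shows "(r\<^sup>2 - (norm (y - x))\<^sup>2)\<^sup>2 * lam m \<le> eigenvalue_bound CARD('n) K c0"
proof -
  let ?J = "jet u y"
  let ?D = "\<lambda>i. dir_deriv (E i)"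
  let ?j1 = "\<lambda>k. jet1 E y (E k)" and ?j2 = "\<lambda>k. jet2 E y (E k)"
  define \<eta> where "\<eta> = r\<^sup>2 - (norm (y - x))\<^sup>2"
  define T where "T i k = ?D k (?D i (?D i u)) y" for i k
  define uu where "uu k = ?D k (?D k u) y" for k
  define A1 where "A1 k i = dir_deriv (?j1 k) (a (E i)) ?J" for k i
  define A2 where "A2 k i = second_deriv (a (E i)) ?J (?j1 k) (?j1 k)" for k i
  define A3 where "A3 k i = dir_deriv (?j2 k) (a (E i)) ?J" for k i
  define X where "X k i = T i k - A1 k i" for k i
  define Y where "Y k i = ?D k (?D k (?D i (?D i u))) y - (A2 k i + A3 k i)" for k i
  define B1 where "B1 k = dir_deriv (?j1 k) b ?J" for k
  define B2 where "B2 = dir_deriv (?j2 m) b ?J"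
  define etak where "etak k = - 2 * ((y - x) \<bullet> E k)" for k
  note J = jet_in_range[OF y] and Jp = jet_in_phase[OF y]
  have nE: "norm (E i) = 1" for i by (rule frame_norm[OF E])
  have M0: "0 \<le> M" using order_trans[OF norm_ge_zero norm_grad_le[OF y]] .
  have NA0: "0 \<le> NA" by (rule C_k_norm_nonneg[OF A_C2 jet_range_subset bounded_range J])
  have NB0: "0 \<le> NB" using order_trans[OF norm_ge_zero C_11_norm_bounds(1)[OF b_C11 jet_range_subset bounded_range J]] .
  have K': "1 \<le> K" "0 \<le> K" "NA \<le> K" "NB \<le> K" "1 + M + NA \<le> K" "real CARD('n) \<le> K" "r \<le> K"
    using K M0 NA0 NB0 r(1) by auto
  have lamp: "0 < lam i" for i using W_form_pos[OF y nE, of i] by (simp add: eig frame_dot[OF E])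
  have w: "has_2jet (\<lambda>t. E i \<bullet> (W (y + t *\<^sub>R E k) *v E i)) (X k i) (Y k i)" for i k
    unfolding X_def Y_def T_def A1_def A2_def A3_def by (rule W_along_line[OF E y])
  have w0: "E i \<bullet> (W (y + 0 *\<^sub>R E k) *v E i) = lam i" for i k by (simp add: eig frame_dot[OF E])
  have nyx: "norm (y - x) < r" using r(3) by (simp add: dist_norm norm_minus_commute)
  have \<eta>: "0 < \<eta>" "\<eta> \<le> K\<^sup>2"
  proof -
    show "0 < \<eta>" unfolding \<eta>_def using nyx power_strict_mono[of "norm (y - x)" r 2] by simp
    have "r\<^sup>2 \<le> K\<^sup>2" using r(1) K' by (intro power_mono) auto
    then show "\<eta> \<le> K\<^sup>2" unfolding \<eta>_def using zero_le_power2[of "norm (y - x)"] by linarith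
  qed
  have cond: "X k m / lam m + 2 * (etak k / \<eta>) = 0"
    "Y k m / lam m - (X k m / lam m)\<^sup>2 + 2 * ((-2) / \<eta> - (etak k / \<eta>)\<^sup>2) \<le> 0" for k
  proof -
    let ?w = "\<lambda>t. E m \<bullet> (W (y + t *\<^sub>R E k) *v E m)"
    let ?c = "\<lambda>t. r\<^sup>2 - (norm (y + t *\<^sub>R E k - x))\<^sup>2"
    have c: "has_2jet ?c (etak k) (-2)"
      using cutoff_along_line[of r y "E k" x] by (simp add: etak_def frame_dot[OF E])
    have c0: "?c 0 = \<eta>" by (simp add: \<eta>_def)
    have "\<forall>\<^sub>F t in nhds 0. y + t *\<^sub>R E k \<in> ball x r"
      by (rule eventually_along_curve) (use r(3) in \<open>auto intro!: continuous_intros\<close>)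
    then have ev: "\<forall>\<^sub>F t in nhds 0. (?c t)\<^sup>2 * ?w t \<le> (?c 0)\<^sup>2 * ?w 0"
    proof eventually_elim
      case (elim t)
      from max[OF this] show ?case unfolding c0 w0 by (simp only: \<eta>_def)
    qed
    from auxiliary_function_conditions[OF w[of m k] _ c _ ev]
    show "X k m / lam m + 2 * (etak k / \<eta>) = 0"
      "Y k m / lam m - (X k m / lam m)\<^sup>2 + 2 * ((-2) / \<eta> - (etak k / \<eta>)\<^sup>2) \<le> 0"
      unfolding w0 c0 using lamp \<eta> by auto
  qed
  have j1: "?j1 k = lam k *\<^sub>R (0, 0, E k) + (E k, ?D k u y, A ?J *v E k)" for k
    by (rule jet1_eigenvector[OF E y eig])
  have R: "norm (E k, ?D k u y, A ?J *v E k) \<le> K" for k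
    using jet1_remainder_bound[OF y nE[of k]] K' by linarith
  have ne: "norm (0 :: real^'n, 0 :: real, E k) = 1" for k by (simp add: norm_Pair nE)
  have nj1: "norm (?j1 k) \<le> K + lam k" for k
  proof -
    have "norm (?j1 k) \<le> norm (lam k *\<^sub>R (0 :: real^'n, 0 :: real, E k)) + norm (E k, ?D k u y, A ?J *v E k)"
      unfolding j1 by (rule norm_triangle_ineq)
    also have "norm (lam k *\<^sub>R (0 :: real^'n, 0 :: real, E k)) = lam k"
      using lamp[of k] by (simp only: norm_scaleR ne)
    finally show ?thesis using R[of k] by linarith
  qed
  have bound: "N * norm v \<le> K * c" if "N \<le> K" "norm v \<le> c" for N c and v :: "'n jet"
    using that K' by (intro mult_mono) (auto intro: order_trans[OF norm_ge_zero])
  have dA: "\<bar>dir_deriv v (a (E i)) ?J\<bar> \<le> K * c" if "norm v \<le> c" for v c i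
    using a_bounds(2)[OF J nE[of i], of v] bound[OF K'(3) that] by linarith
  have dB: "\<bar>dir_deriv v b ?J\<bar> \<le> K * c" if "norm v \<le> c" for v c
    using C_11_norm_bounds(2)[OF b_C11 jet_range_subset bounded_range J, of v] bound[OF K'(4) that]
    by simp
  have nj2: "norm (?j2 m) \<le> \<bar>uu m\<bar> + (\<Sum>k\<in>UNIV. \<bar>T m k\<bar>)"
    using norm_weighted_jet2_le[OF E y, of "\<lambda>k. 1" "{m}"] by (simp add: uu_def T_def)
  have "\<eta>\<^sup>2 * lam m \<le> eigenvalue_bound CARD('n) K c0"
  proof (rule pointwise_estimate[where lam = lam and etak = etak and b = "b ?J" and X = X and Y = Y
        and ?A1.0 = A1 and ?A2.0 = A2 and ?A3.0 = A3 and ?B1.0 = B1 and ?B2.0 = B2 and T = T and uu = uu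
        and J = "norm (?j1 m)"])
    show "CARD('n) \<ge> 2" by (rule n_ge_2)
    show "1 \<le> K" "real CARD('n) \<le> K" "0 < c0" by (rule K' c0_pos)+
    show "0 < lam i" "lam i \<le> lam m" for i by (rule lamp lam_max)+
    show "0 < b ?J" by (rule b_pos[OF Jp])
    show "b ?J \<le> K"
      using C_11_norm_bounds(1)[OF b_C11 jet_range_subset bounded_range J] K' by simp
    show "(\<Prod>i\<in>UNIV. lam i) = b ?J ^ (CARD('n) - 1)"
      using det_eq_prod_eigenvalues[OF E eig] b_power[OF y] by simp
    show "0 < \<eta>" "\<eta> \<le> K\<^sup>2" by (rule \<eta>)+
    show "\<bar>etak k\<bar> \<le> 2 * K" for k
      using Cauchy_Schwarz_ineq2[of "y - x" "E k"] nE[of k] nyx K' by (simp add: etak_def abs_mult)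
    show "X k m / lam m + 2 * (etak k / \<eta>) = 0"
      "Y k m / lam m - (X k m / lam m)\<^sup>2 + 2 * ((-2) / \<eta> - (etak k / \<eta>)\<^sup>2) \<le> 0" for k
      by (rule cond)+
    note eq = differentiated_equation[OF E y eig K'(4) w]
    show "(\<Sum>i\<in>UNIV. X k i / lam i) = (real CARD('n) - 1) * (B1 k / b ?J)" for k
      unfolding B1_def by (rule eq(1))
    show "(real CARD('n) - 1) * ((B2 - 2 * K * (norm (?j1 m))\<^sup>2) / b ?J - (B1 m / b ?J)\<^sup>2)
       \<le> (\<Sum>i\<in>UNIV. Y m i / lam i - (X m i / lam i)\<^sup>2)"
      unfolding B1_def B2_def by (rule eq(2))
    show "T i k = X k i + A1 k i" for i k by (simp add: X_def)
    show "Y k i + A2 k i + A3 k i = Y i k + A2 i k + A3 i k" for i k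
      using fourth_derivatives_commute[OF y, of "E k" "E i"] by (simp add: Y_def)
    show "0 \<le> norm (?j1 m)" by simp
    show "norm (?j1 m) \<le> K + lam m" by (rule nj1)
    show "\<bar>A1 k i\<bar> \<le> K * (K + lam k)" for i k unfolding A1_def by (rule dA[OF nj1])
    show "\<bar>B1 k\<bar> \<le> K * (K + lam k)" for k unfolding B1_def by (rule dB[OF nj1])
    show "\<bar>uu k\<bar> \<le> lam k + K" for k
    proof -
      have "lam k = uu k - a (E k) ?J"
        using W_form[OF y, of "E k"] by (simp add: uu_def eig frame_dot[OF E])
      then show ?thesis using a_bounds(1)[OF J nE[of k]] lamp[of k] K' by linarith
    qed
    show "\<bar>A3 m i\<bar> \<le> K * (\<bar>uu m\<bar> + (\<Sum>k\<in>UNIV. \<bar>T m k\<bar>))" for i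
      unfolding A3_def by (rule dA[OF nj2])
    show "\<bar>B2\<bar> \<le> K * (\<bar>uu m\<bar> + (\<Sum>k\<in>UNIV. \<bar>T m k\<bar>))"
      unfolding B2_def by (rule dB[OF nj2])
    show "\<bar>\<Sum>k\<in>UNIV. A3 k m / lam k\<bar> \<le>
       K * (\<bar>\<Sum>k\<in>UNIV. uu k / lam k\<bar> + (\<Sum>j\<in>UNIV. \<bar>\<Sum>k\<in>UNIV. T k j / lam k\<bar>))"
    proof -
      note lin = dir_deriv_linear[OF a_differentiable(1)[OF Jp, of "E m"]]
      have "dir_deriv (\<Sum>k\<in>UNIV. (1 / lam k) *\<^sub>R ?j2 k) (a (E m)) ?J = (\<Sum>k\<in>UNIV. A3 k m / lam k)"
        by (simp add: linear_sum[OF lin] linear_scale[OF lin] A3_def)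
      moreover note dA[of "\<Sum>k\<in>UNIV. (1 / lam k) *\<^sub>R ?j2 k" _ m]
      moreover have "norm (\<Sum>k\<in>UNIV. (1 / lam k) *\<^sub>R ?j2 k) \<le>
          \<bar>\<Sum>k\<in>UNIV. uu k / lam k\<bar> + (\<Sum>j\<in>UNIV. \<bar>\<Sum>k\<in>UNIV. T k j / lam k\<bar>)"
        using norm_weighted_jet2_le[OF E y, of "\<lambda>k. 1 / lam k" UNIV] by (simp add: uu_def T_def)
      ultimately show ?thesis by (simp only:)
    qed
    show "\<bar>A2 k i\<bar> \<le> K * (K + lam k)\<^sup>2" for i k
    proof -
      have "\<bar>A2 k i\<bar> \<le> NA * norm (?j1 k) * norm (?j1 k)"
        unfolding A2_def by (rule a_bounds(3)[OF J nE])
      also have "\<dots> \<le> K * (K + lam k) * (K + lam k)"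
        using bound[OF K'(3) nj1[of k]] nj1[of k] K' lamp[of k] by (intro mult_mono) auto
      finally show ?thesis by (simp add: power2_eq_square mult.assoc)
    qed
    show "c0 * (lam m)\<^sup>2 - K * (2 * K * lam m + K\<^sup>2) \<le> A2 m i" if "i \<noteq> m" for i
    proof -
      let ?e = "(0 :: real^'n, 0 :: real, E m)" and ?R = "(E m, ?D m u y, A ?J *v E m)"
      let ?S = "second_deriv (a (E i)) ?J"
      \<comment> \<open>The derivative of the jet is \<open>lam m\<close> times a \<open>p\<close>-direction plus a bounded remainder. Only the square
        of the first part is quadratic in \<open>lam m\<close>, and there \<open>E i\<close> and \<open>E m\<close> are orthogonal.\<close>
      have cross: "lam m * - (K * K) \<le> lam m * s" if "\<bar>s\<bar> \<le> K * K" for s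
        by (intro mult_left_mono) (use that lamp[of m] in linarith)+
      have "A2 m i = (lam m)\<^sup>2 * ?S ?e ?e + lam m * ?S ?e ?R + lam m * ?S ?R ?e + ?S ?R ?R"
        unfolding A2_def j1 by (rule second_deriv_quadratic_expansion[OF a_differentiable(2)[OF Jp]])
      moreover have "(lam m)\<^sup>2 * c0 \<le> (lam m)\<^sup>2 * ?S ?e ?e"
        using a_regular[OF Jp nE nE, of i m] that frame_dot[OF E, of i m] by (intro mult_left_mono) auto
      moreover have S: "\<bar>?S ?e ?R\<bar> \<le> K * K" "\<bar>?S ?R ?e\<bar> \<le> K * K"
      proof -
        have "\<bar>?S ?e ?R\<bar> \<le> NA * 1 * norm ?R" using a_bounds(3)[OF J nE[of i], of ?e ?R] unfolding ne .
        then show "\<bar>?S ?e ?R\<bar> \<le> K * K" using bound[OF K'(3) R[of m]] by simp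
        have "\<bar>?S ?R ?e\<bar> \<le> NA * norm ?R * 1" using a_bounds(3)[OF J nE[of i], of ?R ?e] unfolding ne .
        then show "\<bar>?S ?R ?e\<bar> \<le> K * K" using bound[OF K'(3) R[of m]] by simp
      qed
      moreover note cross[OF S(1)] cross[OF S(2)]
      moreover have "\<bar>?S ?R ?R\<bar> \<le> K * K * K"
      proof -
        have "\<bar>?S ?R ?R\<bar> \<le> NA * norm ?R * norm ?R" by (rule a_bounds(3)[OF J nE])
        also have "\<dots> \<le> K * K * K"
          using bound[OF K'(3) R[of m]] R[of m] K' by (intro mult_mono) auto
        finally show ?thesis .
      qed
      ultimately have "(lam m)\<^sup>2 * c0 + lam m * - (K * K) + lam m * - (K * K) - K * K * K \<le> A2 m i"
        by linarith
      then show ?thesis by (simp add: power2_eq_square algebra_simps)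
    qed
  qed
  then show ?thesis by (simp only: \<eta>_def)
qed

section \<open>The interior estimate\<close>

text \<open>The auxiliary function is maximised over points of the ball and unit directions together. It
  vanishes on the boundary of the ball and is positive at the centre, so the maximum point is interior;
  there the direction may be replaced by an eigenvector of the largest eigenvalue.\<close>

lemma interior_eigenvalue_estimate:
  assumes x: "x \<in> \<Omega>" and r: "0 < r" "cball x r \<subseteq> \<Omega>"
    and K: "1 + M + NA + NB + real CARD('n) + r \<le> K"
    and e: "norm e = 1"
  shows "r ^ 4 * (e \<bullet> (W x *v e)) \<le> eigenvalue_bound CARD('n) K c0"
proof -
  define G where "G = (\<lambda>p :: (real^'n) \<times> (real^'n). (r\<^sup>2 - (norm (fst p - x))\<^sup>2)\<^sup>2 * (snd p \<bullet> (W (fst p) *v snd p)))"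
  let ?S = "cball x r \<times> sphere (0 :: real^'n) 1"
  have "continuous_on ?S (\<lambda>p. W (fst p))"
    by (rule continuous_on_compose2[OF continuous_on_W]) (use r in \<open>auto intro!: continuous_intros\<close>)
  then have "continuous_on ?S G"
    unfolding G_def matrix_vector_mult_def
    by (intro continuous_intros continuous_on_vec_lambda) (auto intro!: continuous_intros)
  moreover have "compact ?S" by (simp add: compact_Times)
  moreover have xe: "(x, e) \<in> ?S" using r e by simp
  ultimately obtain y \<xi> where y: "(y, \<xi>) \<in> ?S" and max: "\<And>p. p \<in> ?S \<Longrightarrow> G p \<le> G (y, \<xi>)"
    using continuous_attains_sup[of ?S G] by fastforce
  have n\<xi>: "norm \<xi> = 1" and yr: "dist x y \<le> r" and y\<Omega>: "y \<in> \<Omega>" using y r by auto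
  have Gx: "G (x, e) = r ^ 4 * (e \<bullet> (W x *v e))" by (simp add: G_def)
  have "0 < G (x, e)" unfolding Gx using r W_form_pos[OF x e] by simp
  then have "0 < G (y, \<xi>)" using max[OF xe] by linarith
  then have "norm (y - x) \<noteq> r" by (auto simp: G_def)
  then have yb: "y \<in> ball x r" using yr by (simp add: dist_norm norm_minus_commute)
  obtain E lam where E: "orthonormal_frame E" and eig: "\<And>i. W y *v E i = lam i *\<^sub>R E i"
    using spectral_theorem[of "W y"] pos_def_W[OF y\<Omega>] by (auto simp: pos_def_def)
  obtain m where m: "\<And>i. lam i \<le> lam m"
  proof -
    have "Max (range lam) \<in> range lam" by (rule Max_in) auto
    then obtain m where "lam m = Max (range lam)" by force
    then show ?thesis using that[of m] by simp
  qed
  have qy: "\<xi> \<bullet> (W y *v \<xi>) \<le> lam m"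
  proof -
    have "W y *v \<xi> = W y *v (\<Sum>k\<in>UNIV. (\<xi> \<bullet> E k) *\<^sub>R E k)" by (simp only: frame_expansion[OF E])
    also have "\<dots> = (\<Sum>k\<in>UNIV. (\<xi> \<bullet> E k) *\<^sub>R (lam k *\<^sub>R E k))"
      by (simp only: linear_sum[OF matrix_vector_mul_linear] linear_scale[OF matrix_vector_mul_linear] eig)
    finally have "\<xi> \<bullet> (W y *v \<xi>) = (\<Sum>k\<in>UNIV. lam k * (\<xi> \<bullet> E k)\<^sup>2)"
      by (simp add: inner_sum_right power2_eq_square mult_ac)
    also have "\<dots> \<le> (\<Sum>k\<in>UNIV. lam m * (\<xi> \<bullet> E k)\<^sup>2)" by (intro sum_mono mult_right_mono m) simp
    also have "\<dots> = lam m"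
      using frame_inner[OF E, of \<xi> \<xi>] n\<xi> by (simp add: norm_eq_1 power2_eq_square sum_distrib_left[symmetric])
    finally show ?thesis .
  qed
  have Gy: "G (y, \<xi>) \<le> (r\<^sup>2 - (norm (y - x))\<^sup>2)\<^sup>2 * lam m"
    unfolding G_def using qy by (simp add: mult_left_mono)
  also have "\<dots> \<le> eigenvalue_bound CARD('n) K c0"
  proof (rule eigenvalue_estimate_at_maximum[OF y\<Omega> E eig m r(1) _ yb K])
    show "ball x r \<subseteq> \<Omega>" using r(2) ball_subset_cball by blast
    fix z assume "z \<in> ball x r"
    then have "(z, E m) \<in> ?S" by (simp add: frame_norm[OF E])
    from order_trans[OF max[OF this] Gy]
    show "(r\<^sup>2 - (norm (z - x))\<^sup>2)\<^sup>2 * (E m \<bullet> (W z *v E m)) \<le> (r\<^sup>2 - (norm (y - x))\<^sup>2)\<^sup>2 * lam m"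
      by (simp add: G_def)
  qed
  finally show ?thesis using max[OF xe] unfolding Gx by linarith
qed

lemma interior_hessian_estimate:
  assumes x: "x \<in> \<Omega>" and r: "0 < r" "cball x r \<subseteq> \<Omega>"
    and K: "1 + M + NA + NB + real CARD('n) + r \<le> K"
  shows "norm (hessian u x) \<le> real CARD('n) ^ 3 * (eigenvalue_bound CARD('n) K c0 / r ^ 4) + NA"
proof -
  obtain E lam where E: "orthonormal_frame E" and eig: "\<And>i. W x *v E i = lam i *\<^sub>R E i"
    using spectral_theorem[of "W x"] pos_def_W[OF x] by (auto simp: pos_def_def)
  have q: "E i \<bullet> (W x *v E i) = lam i" for i by (simp add: eig frame_dot[OF E])
  have "\<bar>lam i\<bar> \<le> eigenvalue_bound CARD('n) K c0 / r ^ 4" for i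
    using interior_eigenvalue_estimate[OF x r K frame_norm[OF E, of i]]
      W_form_pos[OF x frame_norm[OF E, of i]] r(1)
    unfolding q by (simp add: le_divide_eq mult.commute)
  from norm_matrix_le_eigenvalue_bound[OF E eig this]
  have "norm (W x) \<le> real CARD('n) ^ 3 * (eigenvalue_bound CARD('n) K c0 / r ^ 4)" .
  moreover have "norm (A (jet u x)) \<le> NA"
    by (rule norm_le_C_k_norm[OF A_C2 jet_range_subset bounded_range jet_in_range[OF x]])
  moreover have "hessian u x = W x + A (jet u x)" by (simp add: W_def)
  ultimately show ?thesis using norm_triangle_ineq[of "W x" "A (jet u x)"] by simp
qed

end

lemma cball_half_distance_to_frontier:
  fixes x :: "'a::euclidean_space"
  assumes \<Omega>: "open \<Omega>" "bounded \<Omega>" and x: "x \<in> \<Omega>"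
  shows "0 < infdist x (frontier \<Omega>)" "cball x (infdist x (frontier \<Omega>) / 2) \<subseteq> \<Omega>"
proof -
  let ?d = "infdist x (frontier \<Omega>)"
  have ne: "frontier \<Omega> \<noteq> {}"
    using \<Omega>(2) x by (metis empty_iff frontier_eq_empty not_bounded_UNIV)
  have "x \<notin> frontier \<Omega>" using \<Omega>(1) x by (simp add: frontier_def interior_open)
  then show d: "0 < ?d"
    using infdist_pos_not_in_closed[OF frontier_closed ne] by blast
  have disj: "cball x (?d / 2) \<inter> frontier \<Omega> = {}"
  proof (rule ccontr)
    assume "\<not> ?thesis"
    then obtain z where z: "z \<in> cball x (?d / 2)" "z \<in> frontier \<Omega>" by blast
    have "?d \<le> dist x z" by (rule infdist_le[OF z(2)])
    then show False using z(1) d by simp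
  qed
  show "cball x (?d / 2) \<subseteq> \<Omega>"
  proof (rule ccontr)
    assume "\<not> ?thesis"
    then have "cball x (?d / 2) - \<Omega> \<noteq> {}" by blast
    moreover have "x \<in> cball x (?d / 2) \<inter> \<Omega>" using x d by simp
    then have "cball x (?d / 2) \<inter> \<Omega> \<noteq> {}" by blast
    ultimately show False
      using connected_Int_frontier[of "cball x (?d / 2)" \<Omega>] disj convex_connected[OF convex_cball] by blast
  qed
qed

theorem theorem1p1:
  assumes n_ge_2: "CARD('n::finite) \<ge> 2"
  shows "\<exists>C :: real \<Rightarrow> real \<Rightarrow> real \<Rightarrow> real \<Rightarrow> real \<Rightarrow> real.
    \<forall>(\<Omega> :: (real^'n) set) (u :: real^'n \<Rightarrow> real) (A :: 'n jet \<Rightarrow> real^'n^'n) (B :: 'n jet \<Rightarrow> real)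
       (C\<^sub>B :: real) (c\<^sub>0 :: real).
      open \<Omega> \<and> connected \<Omega> \<and> bounded \<Omega> \<and>
      C_k 4 \<Omega> u \<and> C_11_closure \<Omega> u \<and>
      (\<forall>y\<in>phase_space \<Omega>. transpose (A y) = A y) \<and>
      (\<forall>y\<in>phase_space \<Omega>. 0 < B y) \<and>
      (\<forall>x\<in>\<Omega>. det (hessian u x - A (jet u x)) = B (jet u x)) \<and>
      (\<forall>x\<in>\<Omega>. pos_def (hessian u x - A (jet u x))) \<and>
      C_11_closure (phase_space \<Omega>) (\<lambda>y. B y powr (1 / (real CARD('n) - 1))) \<and>
      0 \<le> C\<^sub>B \<and> Dpp_ge \<Omega> (\<lambda>y. ln (B y)) (- C\<^sub>B) \<and>
      C_k_closure 2 (phase_space \<Omega>) A \<and>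
      0 < c\<^sub>0 \<and> strictly_regular \<Omega> A c\<^sub>0
      \<longrightarrow> (\<forall>x\<in>\<Omega>. norm (hessian u x) \<le>
            C (infdist x (frontier \<Omega>)) (sup_grad \<Omega> u)
              (C_11_norm (jet_range \<Omega> u) (\<lambda>y. B y powr (1 / (real CARD('n) - 1))))
              (C_k_norm 2 (jet_range \<Omega> u) A) c\<^sub>0)"
proof -
  define C where "C d m nb na c = real CARD('n) ^ 3 *
      (eigenvalue_bound CARD('n) (1 + m + na + nb + real CARD('n) + d / 2) c / (d / 2) ^ 4) + na"
    for d m nb na c :: real
  show ?thesis
  proof (intro exI[of _ C] allI impI ballI, elim conjE)
    fix \<Omega> :: "(real^'n) set" and u :: "real^'n \<Rightarrow> real" and A :: "'n jet \<Rightarrow> real^'n^'n"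
      and B :: "'n jet \<Rightarrow> real" and C\<^sub>B c\<^sub>0 :: real and x :: "real^'n"
    assume hyps: "open \<Omega>" "connected \<Omega>" "bounded \<Omega>" "C_k 4 \<Omega> u" "C_11_closure \<Omega> u"
      "\<forall>y\<in>phase_space \<Omega>. 0 < B y" "\<forall>x\<in>\<Omega>. det (hessian u x - A (jet u x)) = B (jet u x)"
      "\<forall>x\<in>\<Omega>. pos_def (hessian u x - A (jet u x))"
      "C_11_closure (phase_space \<Omega>) (\<lambda>y. B y powr (1 / (real CARD('n) - 1)))"
      "C_k_closure 2 (phase_space \<Omega>) A" "0 < c\<^sub>0" "strictly_regular \<Omega> A c\<^sub>0"
    assume x: "x \<in> \<Omega>"
    interpret monge_ampere_solution \<Omega> u A B c\<^sub>0
      by unfold_locales (use hyps n_ge_2 in blast)+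
    note d = cball_half_distance_to_frontier[OF hyps(1,3) x]
    show "norm (hessian u x) \<le>
            C (infdist x (frontier \<Omega>)) (sup_grad \<Omega> u)
              (C_11_norm (jet_range \<Omega> u) (\<lambda>y. B y powr (1 / (real CARD('n) - 1))))
              (C_k_norm 2 (jet_range \<Omega> u) A) c\<^sub>0"
      using interior_hessian_estimate[OF x _ d(2) order_refl] d(1)
      unfolding C_def b_def[abs_def] by simp
  qed
qed

end
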